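(* Let $\mathfrak{B}$ be a $C^*$-algebra, $(\mathcal{H},\pi)$ a nonzero irreducible representation of $\mathfrak{B}$, and $r:\mathbb{P}\mathcal{H}\to\mathscr{P}_\pi(\mathfrak{B})$ the uniform isomorphism associated to $(\mathcal{H},\pi)$. For every $\Omega\in\mathbb{S}\mathcal{H}$, let $s_\Omega:\mathbb{B}_2(r(\mathbb{C}\Omega))\to\mathbb{S}\mathcal{H}$ be the unique section of the canonical projection $\mathbb{S}\mathcal{H}\to\mathscr{P}_\pi(\mathfrak{B})$, $\Psi\mapsto r(\mathbb{C}\Psi)$, such that $\langle\Omega,s_\Omega(\omega)\rangle>0$ for all $\omega\in\mathbb{B}_2(r(\mathbb{C}\Omega))$, and let $\xi_\Omega:\mathfrak{B}\to\mathcal{H}$ be the map $\xi_\Omega(B)=\pi(B)\Omega$. Let $\mathfrak{C}$ be another $C^*$-algebra with nonzero irreducible representation $(\tilde{\mathcal{H}},\tilde\pi)$ and associated maps $\tilde r$, $\tilde s_\Psi$ and $\tilde\xi_\Psi$ for $\Psi\in\mathbb{S}\tilde{\mathcal{H}}$ (defined in the same way). Define $$O=\{(\alpha,\Omega,\Psi)\in\mathrm{Iso}(\mathfrak{B},\mathfrak{C})_{\mathrm{n}}\times\mathbb{S}\mathcal{H}\times\mathbb{S}\tilde{\mathcal{H}} : \alpha_*r(\mathbb{C}\Omega)\in\mathbb{B}_2(\tilde r(\mathbb{C}\Psi))\}.$$ Then the following hold: (i) If $\mathfrak{B}=\mathfrak{C}$ and $(\mathcal{H},\pi)=(\tilde{\mathcal{H}},\tilde\pi)$,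 then for each $\Omega,\Psi\in\mathbb{S}\mathcal{H}$ there exists $\alpha\in\mathrm{Aut}(\mathfrak{B})$ such that $(\alpha,\Omega,\Psi)\in O$. (ii) The set $O$ is open in $\mathrm{Iso}(\mathfrak{B},\mathfrak{C})_{\mathrm{n}}\times\mathbb{S}\mathcal{H}\times\mathbb{S}\tilde{\mathcal{H}}$. (iii) The map $\Phi:O\to\mathbb{S}\tilde{\mathcal{H}}$, $\Phi(\alpha,\Omega,\Psi)=\tilde s_\Psi(\alpha_*r(\mathbb{C}\Omega))$, is continuous. (iv) The unique map $U:O\to\mathsf{U}(\mathcal{H},\tilde{\mathcal{H}})_{\mathrm{n}}$ such that $$U(\alpha,\Omega,\Psi)\circ\xi_\Omega=\tilde\xi_{\Phi(\alpha,\Omega,\Psi)}\circ\alpha\quad\text{for all }(\alpha,\Omega,\Psi)\in O$$ is continuous.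
   Context: Inner products are linear in the second variable. $\mathbb{S}\mathcal{H}$ is the unit sphere of $\mathcal{H}$ (norm topology) and $\mathbb{P}\mathcal{H}$ the set of one-dimensional subspaces $\mathbb{C}\Psi$ with the quotient topology. $\mathscr{P}(\mathfrak{B})$ is the set of pure states of $\mathfrak{B}$ with the metric induced by the norm of $\mathfrak{B}^*$, and $\mathbb{B}_2(\omega)=\{\psi\in\mathscr{P}(\mathfrak{B}):\|\psi-\omega\|<2\}$. For an irreducible representation $(\mathcal{H},\pi)$, $\mathscr{P}_\pi(\mathfrak{B})$ is the set of pure $\pi$-normal states, which is the set of vector states $B\mapsto\langle\Psi,\pi(B)\Psi\rangle$ with $\Psi\in\mathbb{S}\mathcal{H}$; the associated uniform isomorphism is $r:\mathbb{P}\mathcal{H}\to\mathscr{P}_\pi(\mathfrak{B})$, $r(\mathbb{C}\Psi)(B)=\langle\Psi,\pi(B)\Psi\rangle$ for $\Psi\in\mathbb{S}\mathcal{H}$ (a well-defined bi-Lipschitz bijection for the metric $\|P_{\mathbb{C}\Psi}-P_{\mathbb{C}\Omega}\|$ given by orthogonal projections on $\mathbb{P}\mathcal{H}$). One has $\mathbb{B}_2(r(\mathbb{C}\Omega))\subset\mathscr{P}_\pi(\mathfrak{B})$. $\mathrm{Iso}(\mathfrak{B},\mathfrak{C})_{\mathrm{n}}$ is the set of $*$-isomorphisms $\mathfrak{B}\to\mathfrak{C}$ with the operator norm topology, $\mathrm{Aut}(\mathfrak{B})=\mathrm{Iso}(\mathfrak{B},\mathfrak{B})$, and $\mathsf{U}(\mathcal{H},\tilde{\mathcal{H}})_{\mathrm{n}}$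 is the set of unitary operators $\mathcal{H}\to\tilde{\mathcal{H}}$ with the norm topology. For $\alpha\in\mathrm{Iso}(\mathfrak{B},\mathfrak{C})$ and a state $\omega$ on $\mathfrak{B}$, $\alpha_*\omega=\omega\circ\alpha^{-1}$. *)

theory Defs
  imports "HOL-Analysis.Analysis" "HOL-Library.Complex_Order"
begin

section \<open>Complex Hilbert spaces\<close>

class scaleC = scaleR +
  fixes scaleC :: "complex \<Rightarrow> 'a \<Rightarrow> 'a" (infixr "*\<^sub>C" 75)

class complex_vector = real_vector + scaleC +
  assumes scaleC_add_right: "a *\<^sub>C (x + y) = a *\<^sub>C x + a *\<^sub>C y"
    and scaleC_add_left: "(a + b) *\<^sub>C x = a *\<^sub>C x + b *\<^sub>C x"
    and scaleC_scaleC: "a *\<^sub>C (b *\<^sub>C x) = (a * b) *\<^sub>C x"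
    and scaleC_one: "1 *\<^sub>C x = x"
    and scaleR_scaleC: "r *\<^sub>R x = complex_of_real r *\<^sub>C x"

text \<open>Inner products are linear in the second variable.  The underlying real Hilbert space
  carries the real part of the complex inner product, so that norm and topology are the usual
  ones.\<close>

class complex_hilbert_space = complex_vector + real_inner + banach +
  fixes cinner :: "'a \<Rightarrow> 'a \<Rightarrow> complex"
  assumes cinner_commute: "cinner x y = cnj (cinner y x)"
    and cinner_add_right: "cinner x (y + z) = cinner x y + cinner x z"
    and cinner_scaleC_right: "cinner x (a *\<^sub>C y) = a * cinner x y"
    and inner_eq_Re_cinner: "inner x y = Re (cinner x y)"

definition clinear :: "('a::complex_vector \<Rightarrow> 'b::complex_vector) \<Rightarrow> bool" where
  "clinear f \<longleftrightarrow> (\<forall>x y. f (x + y) = f x + f y) \<and> (\<forall>a x. f (a *\<^sub>C x) = a *\<^sub>C f x)"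

instantiation complex :: complex_vector
begin

definition scaleC_complex :: "complex \<Rightarrow> complex \<Rightarrow> complex" where
  "scaleC_complex a x = a * x"

instance
  by standard (simp_all add: scaleC_complex_def algebra_simps scaleR_conv_of_real)

end

text \<open>Real-linear bounded maps \<open>'a \<Rightarrow>\<^sub>L 'b\<close> are used as the ambient normed space; the operators
  of interest are the complex-linear ones among them.  For these the operator norm does not
  depend on whether the scalars are real or complex.\<close>

definition unitaries :: "('h::complex_hilbert_space \<Rightarrow>\<^sub>L 'k::complex_hilbert_space) set" where
  "unitaries = {V. clinear (blinfun_apply V) \<and> surj (blinfun_apply V) \<and>
                   (\<forall>x y. cinner (V x) (V y) = cinner x y)}"

section \<open>\<open>C\<^sup>*\<close>-algebras (not necessarily unital)\<close>

class c_star_algebra = complex_vector + real_normed_algebra + banach +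
  fixes star :: "'a \<Rightarrow> 'a"
  assumes norm_scaleC: "norm (a *\<^sub>C x) = cmod a * norm x"
    and mult_scaleC_left: "(a *\<^sub>C x) * y = a *\<^sub>C (x * y)"
    and mult_scaleC_right: "x * (a *\<^sub>C y) = a *\<^sub>C (x * y)"
    and star_star: "star (star x) = x"
    and star_add: "star (x + y) = star x + star y"
    and star_scaleC: "star (a *\<^sub>C x) = cnj a *\<^sub>C star x"
    and star_mult: "star (x * y) = star y * star x"
    and norm_star_mult: "norm (star x * x) = (norm x)\<^sup>2"

text \<open>\<open>*\<close>-isomorphisms are automatically bounded (indeed isometric), hence nothing is lost by
  collecting them in the space of bounded maps, which supplies the operator norm topology.\<close>

definition star_isos :: "('b::c_star_algebra \<Rightarrow>\<^sub>L 'c::c_star_algebra) set" where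
  "star_isos = {\<alpha>. clinear (blinfun_apply \<alpha>) \<and> bij (blinfun_apply \<alpha>) \<and>
                   (\<forall>x y. \<alpha> (x * y) = \<alpha> x * \<alpha> y) \<and> (\<forall>x. \<alpha> (star x) = star (\<alpha> x))}"

definition states :: "('b::c_star_algebra \<Rightarrow>\<^sub>L complex) set" where
  "states = {\<omega>. clinear (blinfun_apply \<omega>) \<and> (\<forall>x. 0 \<le> \<omega> (star x * x)) \<and> norm \<omega> = 1}"

definition pure_states :: "('b::c_star_algebra \<Rightarrow>\<^sub>L complex) set" where
  "pure_states = {\<omega>. \<omega> extreme_point_of states}"

definition state_ball :: "('b::c_star_algebra \<Rightarrow>\<^sub>L complex) \<Rightarrow> ('b \<Rightarrow>\<^sub>L complex) set" where
  "state_ball \<omega> = {\<psi> \<in> pure_states. norm (\<psi> - \<omega>) < 2}"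

text \<open>\<open>\<omega> \<circ> \<alpha>\<inverse>\<close> is bounded for \<open>\<alpha> \<in> star_isos\<close>, so \<^const>\<open>Blinfun\<close> merely repackages it.\<close>

definition push_state ::
  "('b::c_star_algebra \<Rightarrow>\<^sub>L 'c::c_star_algebra) \<Rightarrow> ('b \<Rightarrow>\<^sub>L complex) \<Rightarrow> ('c \<Rightarrow>\<^sub>L complex)" where
  "push_state \<alpha> \<omega> = Blinfun (blinfun_apply \<omega> \<circ> inv (blinfun_apply \<alpha>))"

section \<open>Representations\<close>

definition representation ::
  "('b::c_star_algebra \<Rightarrow> ('h::complex_hilbert_space \<Rightarrow>\<^sub>L 'h)) \<Rightarrow> bool" where
  "representation \<pi> \<longleftrightarrow>
     (\<forall>B. clinear (blinfun_apply (\<pi> B))) \<and>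
     (\<forall>A B. \<pi> (A + B) = \<pi> A + \<pi> B) \<and>
     (\<forall>a B x. \<pi> (a *\<^sub>C B) x = a *\<^sub>C \<pi> B x) \<and>
     (\<forall>A B. \<pi> (A * B) = \<pi> A o\<^sub>L \<pi> B) \<and>
     (\<forall>B x y. cinner (\<pi> (star B) x) y = cinner x (\<pi> B y))"

definition closed_csubspace :: "'h::complex_hilbert_space set \<Rightarrow> bool" where
  "closed_csubspace S \<longleftrightarrow> closed S \<and> 0 \<in> S \<and> (\<forall>x\<in>S. \<forall>y\<in>S. x + y \<in> S) \<and>
     (\<forall>a. \<forall>x\<in>S. a *\<^sub>C x \<in> S)"

text \<open>The requirement that \<open>\<pi>\<close> is not identically zero excludes both the zero space and the
  zero representation on a one-dimensional space.\<close>

definition nonzero_irreducible_rep ::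
  "('b::c_star_algebra \<Rightarrow> ('h::complex_hilbert_space \<Rightarrow>\<^sub>L 'h)) \<Rightarrow> bool" where
  "nonzero_irreducible_rep \<pi> \<longleftrightarrow>
     representation \<pi> \<and> (\<exists>B. \<pi> B \<noteq> 0) \<and>
     (\<forall>S. closed_csubspace S \<and> (\<forall>B. \<forall>x\<in>S. \<pi> B x \<in> S) \<longrightarrow> S = {0} \<or> S = UNIV)"

definition ray :: "'h::complex_hilbert_space \<Rightarrow> 'h set" where
  "ray \<Psi> = range (\<lambda>a. a *\<^sub>C \<Psi>)"

text \<open>Representations are automatically contractive, so \<open>B \<mapsto> \<langle>\<Psi>, \<pi>(B)\<Psi>\<rangle>\<close> is bounded and
  \<^const>\<open>Blinfun\<close> merely repackages it.\<close>

definition vector_state ::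
  "('b::c_star_algebra \<Rightarrow> ('h::complex_hilbert_space \<Rightarrow>\<^sub>L 'h)) \<Rightarrow> 'h \<Rightarrow> ('b \<Rightarrow>\<^sub>L complex)" where
  "vector_state \<pi> \<Psi> = Blinfun (\<lambda>B. cinner \<Psi> (\<pi> B \<Psi>))"

text \<open>The map \<open>r\<close>, defined on one-dimensional subspaces through any of their unit vectors.\<close>

definition ray_state ::
  "('b::c_star_algebra \<Rightarrow> ('h::complex_hilbert_space \<Rightarrow>\<^sub>L 'h)) \<Rightarrow> 'h set \<Rightarrow> ('b \<Rightarrow>\<^sub>L complex)" where
  "ray_state \<pi> L = (THE \<omega>. \<exists>\<Psi>\<in>L. norm \<Psi> = 1 \<and> \<omega> = vector_state \<pi> \<Psi>)"

lemma cinner_self: "cinner x x = complex_of_real ((norm x)\<^sup>2)"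
  for x :: "'h::complex_hilbert_space"
proof (rule complex_eqI)
  show "Re (cinner x x) = Re (complex_of_real ((norm x)\<^sup>2))"
    by (simp add: power2_norm_eq_inner inner_eq_Re_cinner)
  have "Im (cinner x x) = - Im (cinner x x)"
    using arg_cong[OF cinner_commute[of x x], of Im] by simp
  then show "Im (cinner x x) = Im (complex_of_real ((norm x)\<^sup>2))"
    by simp
qed

lemma cinner_scaleC_left: "cinner (a *\<^sub>C x) y = cnj a * cinner x y"
  by (metis cinner_commute cinner_scaleC_right complex_cnj_mult)

lemma ray_state_ray:
  assumes "nonzero_irreducible_rep \<pi>" and "norm \<Psi> = 1"
  shows "ray_state \<pi> (ray \<Psi>) = vector_state \<pi> \<Psi>"
  unfolding ray_state_def
proof (rule the_equality)
  show "\<exists>\<Psi>'\<in>ray \<Psi>. norm \<Psi>' = 1 \<and> vector_state \<pi> \<Psi> = vector_state \<pi> \<Psi>'"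
  proof
    show "\<Psi> \<in> ray \<Psi>"
      unfolding ray_def by (rule range_eqI[of _ _ 1]) (simp add: scaleC_one)
  qed (use assms(2) in simp)
next
  fix \<omega> assume "\<exists>\<Psi>'\<in>ray \<Psi>. norm \<Psi>' = 1 \<and> \<omega> = vector_state \<pi> \<Psi>'"
  then obtain a where a: "norm (a *\<^sub>C \<Psi>) = 1" and \<omega>: "\<omega> = vector_state \<pi> (a *\<^sub>C \<Psi>)"
    by (auto simp: ray_def)
  have "cnj a * a = cnj a * a * cinner \<Psi> \<Psi>"
    using assms(2) by (simp add: cinner_self)
  also have "\<dots> = cinner (a *\<^sub>C \<Psi>) (a *\<^sub>C \<Psi>)"
    by (simp add: cinner_scaleC_left cinner_scaleC_right mult_ac)
  finally have "a * cnj a = 1"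
    using a by (simp add: cinner_self mult.commute)
  moreover have "\<pi> B (a *\<^sub>C \<Psi>) = a *\<^sub>C \<pi> B \<Psi>" for B
    using assms(1) by (auto simp: nonzero_irreducible_rep_def representation_def clinear_def)
  ultimately show "\<omega> = vector_state \<pi> \<Psi>"
    unfolding \<omega> vector_state_def
    by (simp add: cinner_scaleC_left cinner_scaleC_right mult.left_commute[of "cnj a"] flip: mult.assoc)
qed

text \<open>The section \<open>s\<^sub>\<Omega>\<close> of \<open>\<Psi> \<mapsto> r(\<complex>\<Psi>)\<close> over \<open>\<bbbB>\<^sub>2(r(\<complex>\<Omega>))\<close>, determined value by value.  In the
  order on \<^typ>\<open>complex\<close>, \<open>0 < z\<close> says that \<open>z\<close> is real and positive.\<close>

definition pos_section ::
  "('b::c_star_algebra \<Rightarrow> ('h::complex_hilbert_space \<Rightarrow>\<^sub>L 'h)) \<Rightarrow> 'h \<Rightarrow> ('b \<Rightarrow>\<^sub>L complex) \<Rightarrow> 'h" where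
  "pos_section \<pi> \<Omega> = (\<lambda>\<omega>\<in>state_ball (ray_state \<pi> (ray \<Omega>)).
     THE \<Psi>. \<Psi> \<in> sphere 0 1 \<and> ray_state \<pi> (ray \<Psi>) = \<omega> \<and> 0 < cinner \<Omega> \<Psi>)"

definition orbit_map ::
  "('b::c_star_algebra \<Rightarrow> ('h::complex_hilbert_space \<Rightarrow>\<^sub>L 'h)) \<Rightarrow> 'h \<Rightarrow> 'b \<Rightarrow> 'h" where
  "orbit_map \<pi> \<Omega> B = \<pi> B \<Omega>"

definition near_triples ::
  "('b::c_star_algebra \<Rightarrow> ('h::complex_hilbert_space \<Rightarrow>\<^sub>L 'h)) \<Rightarrow>
   ('c::c_star_algebra \<Rightarrow> ('k::complex_hilbert_space \<Rightarrow>\<^sub>L 'k)) \<Rightarrow>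
   (('b \<Rightarrow>\<^sub>L 'c) \<times> 'h \<times> 'k) set" where
  "near_triples \<pi> \<rho> = {(\<alpha>, \<Omega>, \<Psi>) \<in> star_isos \<times> sphere 0 1 \<times> sphere 0 1.
     push_state \<alpha> (ray_state \<pi> (ray \<Omega>)) \<in> state_ball (ray_state \<rho> (ray \<Psi>))}"

definition lift_map ::
  "('b::c_star_algebra \<Rightarrow> ('h::complex_hilbert_space \<Rightarrow>\<^sub>L 'h)) \<Rightarrow>
   ('c::c_star_algebra \<Rightarrow> ('k::complex_hilbert_space \<Rightarrow>\<^sub>L 'k)) \<Rightarrow>
   ('b \<Rightarrow>\<^sub>L 'c) \<times> 'h \<times> 'k \<Rightarrow> 'k" where
  "lift_map \<pi> \<rho> = (\<lambda>(\<alpha>, \<Omega>, \<Psi>). pos_section \<rho> \<Psi> (push_state \<alpha> (ray_state \<pi> (ray \<Omega>))))"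

definition intertwines ::
  "('b::c_star_algebra \<Rightarrow> ('h::complex_hilbert_space \<Rightarrow>\<^sub>L 'h)) \<Rightarrow>
   ('c::c_star_algebra \<Rightarrow> ('k::complex_hilbert_space \<Rightarrow>\<^sub>L 'k)) \<Rightarrow>
   (('b \<Rightarrow>\<^sub>L 'c) \<times> 'h \<times> 'k \<Rightarrow> ('h \<Rightarrow>\<^sub>L 'k)) \<Rightarrow> bool" where
  "intertwines \<pi> \<rho> U \<longleftrightarrow> (\<forall>(\<alpha>, \<Omega>, \<Psi>) \<in> near_triples \<pi> \<rho>.
     blinfun_apply (U (\<alpha>, \<Omega>, \<Psi>)) \<circ> orbit_map \<pi> \<Omega> =
     orbit_map \<rho> (lift_map \<pi> \<rho> (\<alpha>, \<Omega>, \<Psi>)) \<circ> blinfun_apply \<alpha>)"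

end

theory Submission
  imports Defs
begin

text \<open>Everything rests on one estimate: if \<open>\<psi>\<close> is a pure state and \<open>\<omega>\<close> the vector state of a unit
  vector \<open>\<Omega>\<close> with \<open>\<parallel>\<psi> - \<omega>\<parallel> = 2\<theta> < 2\<close>, then \<open>\<psi>\<close> is, up to normalisation, the vector state of some \<open>\<Phi> \<noteq> 0\<close> with
  \<open>\<parallel>\<Omega> - \<Phi>\<parallel>\<^sup>2 \<le> \<theta>\<close>.  A Hahn-Banach argument gives a positive functional \<open>G\<close> of mass at most \<open>\<theta>\<close> with
  \<open>\<omega> \<le> \<psi> + G\<close>; projecting the cyclic vector of \<open>\<psi>\<close> to the cyclic subspace of \<open>\<psi> + G\<close> inside the sum
  of the two GNS spaces, and mapping it to \<open>H\<close> by the contraction that \<open>\<omega> \<le> \<psi> + G\<close> provides, yields \<open>\<Phi>\<close>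
  with \<open>\<omega>\<^sub>\<Phi> \<le> \<psi>\<close>, and purity does the rest.  The estimate gives existence of the section and its
  continuity.  It also shows that orthogonal vectors have states at distance 2, hence by polarisation
  \<open>\<parallel>\<zeta>\<parallel>\<close> is bounded by three times the norm of \<open>B \<mapsto> \<langle>\<zeta>, \<pi>(B)\<Omega>\<rangle>\<close>; this replaces Kadison transitivity in the
  norm continuity of \<open>U\<close>.  For (i), some self-adjoint \<open>a\<close> has \<open>\<langle>\<Psi>, \<pi>(a)\<Omega>\<rangle> \<noteq> 0\<close>, and conjugation by
  \<open>\<surd>(1 - c\<^sup>2) + ic\<close> with \<open>c\<close> a small multiple of \<open>a\<close> does the job.\<close>

text \<open>The estimate comes from orthogonal projection. Let \<xi> and \<gamma> be the cyclic
  vectors of \<psi> and G, and let P project onto the closed span of the orbit of \<xi> + \<gamma>.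
  Then (\<xi> + \<gamma>) - P \<xi> = P \<gamma> has squared length at most G(1) \<le> \<theta>.
  Also P commutes with the action, so a P \<xi> = P a \<xi> is no longer than a \<xi>, which is the
  domination by \<psi>. These spaces vary with the functional and are never formed: a sequence in
  the algebra that represents P \<xi> for the seminorm of \<psi> + G carries the whole argument.

  Two obstacles shape the rest. The algebra may have no unit, while the domination argument and the
  cyclic vectors ask for one; so functionals are extended to the unitization, and approximate units
  link the two. And positivity is handled by norm inequalities: one iteration, which solves 2 Y = A
  + Y^2, serves the roots of positive elements, the contractivity of representations, the absolute
  value in Schur's lemma and the unitary of (i).\<close>

section \<open>Square roots\<close>

text \<open>The solution is Y = 1 - sqrt(1 - A), written without a unit. The iterates from 0 are
  dominated by the scalar iterates for A = 1, which increase and stay below 1; comparing increments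
  gives convergence even when \<open>norm A = 1\<close>, where Z |-> (A + Z^2)/2 need not be a
  strict contraction. The product is abstract so as to cover both algebra elements and operators,
  and the clause about closed S carries algebraic properties of A over to the limit.\<close>

lemma sqrt_iteration:
  fixes pr :: "'a::banach \<Rightarrow> 'a \<Rightarrow> 'a"
  assumes "bounded_bilinear pr" and pr_le: "\<And>x y. norm (pr x y) \<le> norm x * norm y"
    and A: "norm A \<le> 1"
  obtains Y where "norm Y \<le> 1" "2 *\<^sub>R Y = A + pr Y Y"
    "\<And>S. closed S \<Longrightarrow> 0 \<in> S \<Longrightarrow> (\<And>Z. Z \<in> S \<Longrightarrow> (1/2) *\<^sub>R (A + pr Z Z) \<in> S) \<Longrightarrow> Y \<in> S"
proof -
  interpret bounded_bilinear pr by fact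
  define f where "f Z = (1/2) *\<^sub>R (A + pr Z Z)" for Z
  define Y where "Y n = (f ^^ n) 0" for n
  define y :: "nat \<Rightarrow> real" where "y n = ((\<lambda>t. (1 + t\<^sup>2) / 2) ^^ n) 0" for n
  have Y_Suc: "Y (Suc n) = f (Y n)" and Y0: "Y 0 = 0" for n
    by (simp_all add: Y_def)
  have y_Suc: "y (Suc n) = (1 + (y n)\<^sup>2) / 2" and y0: "y 0 = 0" for n
    by (simp_all add: y_def)
  have y_bd: "0 \<le> y n \<and> y n \<le> 1" for n
    by (induction n) (auto simp: y0 y_Suc power_le_one)
  have nY: "norm (Y n) \<le> y n" for n
  proof (induction n)
    case (Suc n)
    have "norm (Y (Suc n)) = norm (A + pr (Y n) (Y n)) / 2"
      by (simp add: Y_Suc f_def)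
    also have "\<dots> \<le> (norm A + norm (Y n) * norm (Y n)) / 2"
      using norm_triangle_ineq[of A "pr (Y n) (Y n)"] pr_le[of "Y n" "Y n"] by simp
    also have "\<dots> \<le> (1 + (y n)\<^sup>2) / 2"
      using A Suc mult_mono[OF Suc Suc] y_bd[of n] by (simp add: power2_eq_square)
    finally show ?case by (simp add: y_Suc)
  qed (simp add: Y0 y0)
  have diff: "norm (Y (Suc n) - Y n) \<le> y (Suc n) - y n" for n
  proof (induction n)
    case 0
    show ?case using A by (simp add: Y_Suc Y0 y_Suc y0 f_def zero_left)
  next
    case (Suc n)
    let ?d = "Y (Suc n) - Y n"
    \<comment> \<open>A difference of squares, split with one factor on each side since
      \<open>pr\<close> may not commute.\<close>
    have "Y (Suc (Suc n)) - Y (Suc n) = (1/2) *\<^sub>R (pr (Y (Suc n)) ?d + pr ?d (Y n))"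
      unfolding Y_Suc[of "Suc n"] Y_Suc[of n] unfolding f_def
      by (simp add: diff_left diff_right algebra_simps)
    then have "norm (Y (Suc (Suc n)) - Y (Suc n)) \<le> (norm (pr (Y (Suc n)) ?d) + norm (pr ?d (Y n))) / 2"
      using norm_triangle_ineq[of "pr (Y (Suc n)) ?d" "pr ?d (Y n)"] by simp
    also have "\<dots> \<le> (y (Suc n) * (y (Suc n) - y n) + (y (Suc n) - y n) * y n) / 2"
    proof -
      have "norm (pr (Y (Suc n)) ?d) \<le> y (Suc n) * (y (Suc n) - y n)"
        using pr_le mult_mono[OF nY[of "Suc n"] Suc] y_bd[of "Suc n"] by (meson norm_ge_zero order_trans)
      moreover have "norm (pr ?d (Y n)) \<le> (y (Suc n) - y n) * y n"
        using pr_le mult_mono[OF Suc nY[of n]] norm_ge_zero Suc by (meson order_trans)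
      ultimately show ?thesis by simp
    qed
    also have "\<dots> = y (Suc (Suc n)) - y (Suc n)"
      unfolding y_Suc[of "Suc n"] y_Suc[of n] by (simp add: power2_eq_square field_simps)
    finally show ?case .
  qed
  have "incseq y"
    by (rule incseq_SucI) (use diff in \<open>smt (verit) norm_ge_zero\<close>)
  then have "convergent y"
    using y_bd by (intro Bseq_monoseq_convergent) (auto simp: incseq_imp_monoseq intro!: BseqI'[of _ 1])
  then obtain l where "y \<longlonglongrightarrow> l" by (auto simp: convergent_def)
  then have "summable (\<lambda>n. y (Suc n) - y n)"
    using telescope_summable by blast
  then have sm: "summable (\<lambda>n. Y (Suc n) - Y n)"
    by (rule summable_comparison_test') (use diff in auto)
  have "Y = (\<lambda>n. \<Sum>k<n. Y (Suc k) - Y k)"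
    by (simp add: sum_lessThan_telescope Y0)
  then obtain L where L: "Y \<longlonglongrightarrow> L"
    using summable_LIMSEQ[OF sm] by metis
  show thesis
  proof (rule that[of L])
    show "norm L \<le> 1"
      by (rule LIMSEQ_le_const2[OF tendsto_norm[OF L]]) (use nY y_bd order_trans in blast)
    have "(\<lambda>n. f (Y n)) \<longlonglongrightarrow> f L"
      unfolding f_def by (intro tendsto_intros tendsto L)
    moreover have "(\<lambda>n. f (Y n)) \<longlonglongrightarrow> L"
      using LIMSEQ_Suc[OF L] by (simp add: Y_Suc)
    ultimately have "f L = L" by (rule LIMSEQ_unique)
    then show "2 *\<^sub>R L = A + pr L L"
      unfolding f_def by (metis mult_2 scaleR_one scaleR_scaleR divide_self_if nonzero_mult_div_cancel_left
          times_divide_eq_right zero_neq_numeral mult.right_neutral)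
    fix S :: "'a set"
    assume S: "closed S" "0 \<in> S" "\<And>Z. Z \<in> S \<Longrightarrow> (1/2) *\<^sub>R (A + pr Z Z) \<in> S"
    have "Y n \<in> S" for n
      by (induction n) (use S in \<open>simp_all add: Y0 Y_Suc f_def\<close>)
    then show "L \<in> S" using closed_sequentially[OF S(1) _ L] by blast
  qed
qed

section \<open>Identities for complex scalars and the involution\<close>

lemma scaleC_zero_right [simp]: "a *\<^sub>C (0::'a::complex_vector) = 0"
  using scaleC_add_right[of a 0 0] by simp

lemma scaleC_zero_left [simp]: "0 *\<^sub>C (x::'a::complex_vector) = 0"
  using scaleC_add_left[of 0 0 x] by simp

lemma scaleC_minus_right [simp]: "a *\<^sub>C (- x) = - (a *\<^sub>C (x::'a::complex_vector))"
  using scaleC_add_right[of a x "- x"] by (simp add: eq_neg_iff_add_eq_0 add.commute)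

lemma scaleC_minus_left [simp]: "(- a) *\<^sub>C x = - (a *\<^sub>C (x::'a::complex_vector))"
  using scaleC_add_left[of a "- a" x] by (simp add: eq_neg_iff_add_eq_0 add.commute)

lemma scaleC_diff_right: "a *\<^sub>C (x - y) = a *\<^sub>C x - a *\<^sub>C (y::'a::complex_vector)"
  using scaleC_add_right[of a x "- y"] by simp

lemma scaleC_diff_left: "(a - b) *\<^sub>C x = a *\<^sub>C x - b *\<^sub>C (x::'a::complex_vector)"
  using scaleC_add_left[of a "- b" x] by simp

lemma scaleC_scaleR: "a *\<^sub>C (r *\<^sub>R x) = r *\<^sub>R (a *\<^sub>C (x::'a::complex_vector))"
  by (simp add: scaleR_scaleC scaleC_scaleC mult.commute)

lemma clinear_simps:
  assumes "clinear f"
  shows "f (x + y) = f x + f y" "f (a *\<^sub>C x) = a *\<^sub>C f x" "f 0 = 0" "f (- x) = - f x"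
    "f (x - y) = f x - f y" "f (r *\<^sub>R x) = r *\<^sub>R f x"
proof -
  show 1: "f (x + y) = f x + f y" "f (a *\<^sub>C x) = a *\<^sub>C f x" for x y a
    using assms by (auto simp: clinear_def)
  show "f 0 = 0" using 1(2)[of 0 0] by simp
  show 2: "f (- x) = - f x" for x using 1(2)[of "-1" x] by (simp add: scaleC_one)
  show "f (x - y) = f x - f y" using 1(1)[of x "- y"] 2 by simp
  show "f (r *\<^sub>R x) = r *\<^sub>R f x" by (simp add: scaleR_scaleC 1)
qed

lemma norm_star [simp]: "norm (star x) = norm (x::'a::c_star_algebra)"
proof -
  have *: "norm x \<le> norm (star x)" for x :: 'a
  proof (cases "x = 0")
    case False
    have "norm x * norm x \<le> norm (star x) * norm x"
      using norm_mult_ineq[of "star x" x] by (simp add: norm_star_mult power2_eq_square)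
    with False show ?thesis by simp
  qed simp
  show ?thesis using *[of x] *[of "star x"] by (simp add: star_star)
qed

lemma star_scaleR: "star (r *\<^sub>R x) = r *\<^sub>R star (x::'a::c_star_algebra)"
  by (simp add: scaleR_scaleC star_scaleC)

lemma star_zero [simp]: "star (0::'a::c_star_algebra) = 0"
  by (metis norm_eq_zero norm_star)

lemma star_minus: "star (- x) = - star (x::'a::c_star_algebra)"
  using star_scaleR[of "-1" x] by simp

lemma star_diff: "star (x - y) = star x - star (y::'a::c_star_algebra)"
  using star_add[of x "- y"] by (simp add: star_minus)

lemma bounded_linear_star: "bounded_linear (star :: 'a::c_star_algebra \<Rightarrow> 'a)"
  by (rule bounded_linear_intro[of _ 1]) (simp_all add: star_add star_scaleR)

lemmas tendsto_star = bounded_linear.tendsto[OF bounded_linear_star]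
lemmas continuous_on_star = bounded_linear.continuous_on[OF bounded_linear_star]

lemma star_one [simp]: "star (1::'a::{c_star_algebra,real_normed_algebra_1}) = 1"
  by (metis mult.right_neutral mult_1 star_mult star_star)

lemma star_of_real [simp]: "star (of_real r :: 'a::{c_star_algebra,real_normed_algebra_1}) = of_real r"
  by (simp add: of_real_def star_scaleR)

lemma star_power: "star (x ^ n) = star (x::'a::{c_star_algebra,real_normed_algebra_1}) ^ n"
  by (induction n) (auto simp: star_mult power_commutes)

lemma mult_star_eq_0: "star x * x = 0 \<longleftrightarrow> x = (0::'a::c_star_algebra)"
  by (metis mult_zero_right norm_eq_zero norm_star_mult power_eq_0_iff)

lemma norm_sa_square: "star x = x \<Longrightarrow> norm (x * x) = (norm (x::'a::c_star_algebra))\<^sup>2"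
  by (metis norm_star_mult)

text \<open>Here 1 - Y is the square root of 1 - A, in a form that makes sense in a non-unital
  algebra. The bound by \<open>norm A\<close> comes from 2 |Y| \<le> |A| + |Y|^2 \<le> |A| + |Y|;
  for A = c * c it makes Y of second order in c, which part (i) relies on.\<close>

lemma sqrt_in_c_star_algebra:
  fixes A :: "'a::c_star_algebra"
  assumes "norm A \<le> 1" and sa: "star A = A"
  obtains Y where "norm Y \<le> norm A" "2 *\<^sub>R Y = A + Y * Y" "star Y = Y"
    "\<And>b. A * b = b * A \<Longrightarrow> Y * b = b * Y"
proof -
  obtain Y where Y: "norm Y \<le> 1" "2 *\<^sub>R Y = A + Y * Y"
    and S: "\<And>S. closed S \<Longrightarrow> 0 \<in> S \<Longrightarrow> (\<And>Z. Z \<in> S \<Longrightarrow> (1/2) *\<^sub>R (A + Z * Z) \<in> S) \<Longrightarrow> Y \<in> S"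
    using sqrt_iteration[OF bounded_bilinear_mult norm_mult_ineq assms(1)] by blast
  have "Y \<in> {Z. star Z = Z}"
  proof (rule S)
    show "closed {Z::'a. star Z = Z}"
      by (intro closed_Collect_eq continuous_on_star continuous_on_id)
  qed (auto simp: star_scaleR star_add star_mult sa)
  moreover have "Y * b = b * Y" if b: "A * b = b * A" for b
  proof -
    have "Y \<in> {Z. Z * b = b * Z}"
    proof (rule S)
      show "closed {Z. Z * b = b * Z}"
        by (intro closed_Collect_eq continuous_intros)
      show "(1 / 2) *\<^sub>R (A + Z * Z) \<in> {Z. Z * b = b * Z}" if "Z \<in> {Z. Z * b = b * Z}" for Z
        using b that by (simp add: algebra_simps) (metis mult.assoc)
    qed auto
    then show ?thesis by simp
  qed
  moreover have "norm Y \<le> norm A"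
  proof -
    have "2 * norm Y = norm (A + Y * Y)" by (simp flip: Y(2))
    also have "\<dots> \<le> norm A + norm Y * norm Y"
      using norm_triangle_ineq[of A "Y * Y"] norm_mult_ineq[of Y Y] by simp
    also have "\<dots> \<le> norm A + 1 * norm Y" using Y(1) by (intro add_left_mono mult_right_mono) auto
    finally show ?thesis by simp
  qed
  ultimately show thesis using that[of Y] Y(2) by blast
qed

section \<open>Positive elements of unital \<open>C\<^sup>*\<close>-algebras\<close>

text \<open>For self-adjoint a the inequality says that the spectrum lies in [0, 2t]. Positivity
  thus becomes a statement about norms, and stability under sums is the triangle inequality.\<close>

definition pos :: "'a::{c_star_algebra,real_normed_algebra_1} \<Rightarrow> bool" where
  "pos a \<longleftrightarrow> star a = a \<and> (\<exists>t. norm (of_real t - a) \<le> t)"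

lemma posI: "star a = a \<Longrightarrow> norm (of_real t - a) \<le> t \<Longrightarrow> pos a"
  by (auto simp: pos_def)

lemma pos_star: "pos a \<Longrightarrow> star a = a"
  by (simp add: pos_def)

lemma pos_add:
  assumes "pos a" "pos b" shows "pos (a + b)"
proof -
  obtain s t where "norm (of_real t - a) \<le> t" "norm (of_real s - b) \<le> s"
    using assms by (auto simp: pos_def)
  then have "norm ((of_real t - a) + (of_real s - b)) \<le> t + s"
    by (meson add_mono norm_triangle_ineq order_trans)
  then have "norm (of_real (t + s) - (a + b)) \<le> t + s" by (simp add: algebra_simps)
  then show ?thesis using assms by (intro posI[of _ "t + s"]) (simp_all add: star_add pos_star)
qed

lemma pos_of_real [simp]: "t \<ge> 0 \<Longrightarrow> pos (of_real t)"
  by (rule posI[of _ t]) auto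

lemma pos_zero [simp]: "pos 0" and pos_one [simp]: "pos 1"
  using pos_of_real[of 0] pos_of_real[of 1] by simp_all

lemma pos_sum: "(\<And>x. x \<in> F \<Longrightarrow> pos (f x)) \<Longrightarrow> pos (sum f F)"
  by (induction F rule: infinite_finite_induct) (auto intro: pos_add)

lemma pos_scaleR:
  assumes "pos a" "0 \<le> r" shows "pos (r *\<^sub>R a)"
proof -
  obtain t where t: "norm (of_real t - a) \<le> t"
    using assms by (auto simp: pos_def)
  have "norm (of_real (r * t) - r *\<^sub>R a) = r * norm (of_real t - a)"
    using assms(2) by (simp add: scaleR_conv_of_real flip: right_diff_distrib)
      (simp add: norm_scaleR flip: scaleR_conv_of_real)
  also have "\<dots> \<le> r * t" using t assms(2) by (rule mult_left_mono)
  finally show ?thesis using assms by (intro posI[of _ "r * t"]) (simp_all add: star_scaleR pos_star)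
qed

lemma pos_norm_minus: "star a = a \<Longrightarrow> norm a \<le> m \<Longrightarrow> pos (of_real m - a)"
  by (rule posI[of _ m]) (simp_all add: star_diff)

lemma pos_sqrt:
  assumes "pos a"
  obtains c where "pos c" "c * c = a" "\<And>b. a * b = b * a \<Longrightarrow> c * b = b * c"
proof -
  obtain t0 where t0: "norm (of_real t0 - a) \<le> t0"
    using assms by (auto simp: pos_def)
  \<comment> \<open>The added 1 makes t positive, so that a can be divided by it.\<close>
  define t where "t = t0 + 1"
  have t: "t > 0" "norm (of_real t - a) \<le> t"
  proof -
    have "0 \<le> t0" using t0 norm_ge_zero order_trans by blast
    then show "t > 0" by (simp add: t_def)
    show "norm (of_real t - a) \<le> t"
      using t0 norm_triangle_ineq[of "of_real t0 - a" 1] by (simp add: t_def algebra_simps)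
  qed
  define A where "A = 1 - (1/t) *\<^sub>R a"
  have "A = (1/t) *\<^sub>R (of_real t - a)"
    using t by (simp add: A_def of_real_def scaleR_right_diff_distrib)
  then have "norm A = norm (of_real t - a) / t" using t(1) by simp
  then have "norm A \<le> 1" using t by simp
  moreover have "star A = A"
    using assms by (simp add: A_def star_diff star_scaleR pos_star)
  ultimately obtain Y where Y: "norm Y \<le> norm A" "2 *\<^sub>R Y = A + Y * Y" "star Y = Y"
    "\<And>b. A * b = b * A \<Longrightarrow> Y * b = b * Y"
    by (rule sqrt_in_c_star_algebra) blast
  define c where "c = sqrt t *\<^sub>R (1 - Y)"
  show thesis
  proof (rule that)
    have "norm Y \<le> 1" using Y(1) \<open>norm A \<le> 1\<close> by simp
    then have "pos (1 - Y)" by (intro posI[of _ 1]) (simp_all add: star_diff Y)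
    then show "pos c" unfolding c_def using t by (intro pos_scaleR) auto
    have "(1 - Y) * (1 - Y) = 1 - 2 *\<^sub>R Y + Y * Y"
      by (simp add: algebra_simps scaleR_2)
    also have "\<dots> = (1/t) *\<^sub>R a" by (simp add: Y(2)) (simp add: A_def)
    finally show "c * c = a" using t by (simp add: c_def)
    fix b assume "a * b = b * a"
    then have "A * b = b * A" by (simp add: A_def algebra_simps)
    then have "Y * b = b * Y" by (rule Y)
    then show "c * b = b * c" by (simp add: c_def algebra_simps)
  qed
qed

text \<open>The element \<open>y + iw\<close> is unitary.\<close>

lemma norm_le_one_if_squares_sum_one:
  fixes y w :: "'a::{c_star_algebra,real_normed_algebra_1}"
  assumes sa: "star y = y" "star w = w" and comm: "y * w = w * y" and one: "y * y + w * w = 1"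
  shows "norm y \<le> 1"
proof -
  define u where "u = y + \<i> *\<^sub>C w"
  have su: "star u = y - \<i> *\<^sub>C w"
    by (simp add: u_def star_add star_scaleC sa)
  have "star u * u = 1"
    unfolding su using one
    by (simp add: u_def algebra_simps mult_scaleC_left mult_scaleC_right scaleC_scaleC comm scaleC_one scaleC_diff_right)
  then have "norm u = 1"
    by (metis norm_ge_zero norm_one norm_star_mult power2_eq_1_iff one_neq_neg_one
        abs_of_nonneg abs_neg_one)
  moreover have "2 *\<^sub>R y = u + star u"
    by (simp add: su) (simp add: u_def scaleR_2)
  then have "2 * norm y \<le> norm u + norm (star u)"
    by (metis norm_scaleR norm_triangle_ineq abs_numeral)
  ultimately show ?thesis by simp
qed

text \<open>Double angle formulas: with d of norm 1 as a cosine and s = sqrt(1 - d^2) as a sine, the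
  squares of 2 d^2 - 1 and 2 d s add up to 1. Hence |2 d^2 - 1| \<le> 1, which puts d^2 within 1/2
  of 1/2.\<close>

lemma pos_square:
  fixes c :: "'a::{c_star_algebra,real_normed_algebra_1}"
  assumes sa: "star c = c"
  shows "pos (c * c)"
proof (cases "c = 0")
  case False
  define d where "d = (1 / norm c) *\<^sub>R c"
  have d: "star d = d" "norm d = 1" "c = norm c *\<^sub>R d"
    using False by (auto simp: d_def star_scaleR sa)
  have "norm (d * d) \<le> 1" using norm_mult_ineq[of d d] d by simp
  moreover have "star (d * d) = d * d" by (simp add: star_mult d)
  ultimately obtain Y where Y: "2 *\<^sub>R Y = d * d + Y * Y" "star Y = Y"
    "\<And>b. d * d * b = b * (d * d) \<Longrightarrow> Y * b = b * Y"
    by (rule sqrt_in_c_star_algebra) blast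
  define s where "s = 1 - Y"
  have s: "star s = s" "s * s = 1 - d * d"
  proof -
    show "star s = s" by (simp add: s_def star_diff Y(2))
    have "s * s = 1 - 2 *\<^sub>R Y + Y * Y" by (simp add: s_def algebra_simps scaleR_2)
    then show "s * s = 1 - d * d" by (simp add: Y(1))
  qed
  have ds: "s * d = d * s"
    using Y(3)[of d] by (simp add: s_def algebra_simps)
  have 1: "(d * s) * (d * s) = (d * d) * (s * s)"
    by (metis ds mult.assoc)
  have "norm (2 *\<^sub>R (d * d) - 1) \<le> 1"
  proof (rule norm_le_one_if_squares_sum_one[of _ "2 *\<^sub>R (d * s)"])
    show "(2 *\<^sub>R (d * d) - 1) * 2 *\<^sub>R (d * s) = 2 *\<^sub>R (d * s) * (2 *\<^sub>R (d * d) - 1)"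
      using ds by (simp add: algebra_simps) (metis mult.assoc)
    show "(2 *\<^sub>R (d * d) - 1) * (2 *\<^sub>R (d * d) - 1) + 2 *\<^sub>R (d * s) * 2 *\<^sub>R (d * s) = 1"
      by (simp add: 1 s(2)) (simp add: algebra_simps flip: scaleR_2)
  qed (auto simp: star_scaleR star_diff star_mult d s ds)
  then have "norm ((1/2) *\<^sub>R (2 *\<^sub>R (d * d) - 1)) \<le> 1/2" by simp
  moreover have "of_real (1/2) - d * d = - ((1/2) *\<^sub>R (2 *\<^sub>R (d * d) - 1))"
    by (simp add: algebra_simps of_real_def)
  ultimately have "norm (of_real (1/2) - d * d) \<le> 1/2" by (metis norm_minus_cancel)
  then have "pos (d * d)" by (intro posI[of _ "1/2"]) (simp_all add: star_mult d)
  moreover have "c * c = (norm c)\<^sup>2 *\<^sub>R (d * d)"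
    by (subst d(3), subst (2) d(3)) (simp add: power2_eq_square)
  ultimately show ?thesis by (simp only: pos_scaleR zero_le_power2)
qed simp

text \<open>The same double angle argument with cosine sqrt(k/m) and sine sqrt((m - k)/m), which
  commute because each root commutes with whatever commutes with its square. The first bound is what
  later halves the distance of two states.\<close>

lemma pos_le_norm:
  assumes k: "pos k" "pos (of_real m - k)" and m: "m > 0"
  shows "norm (2 *\<^sub>R k - of_real m) \<le> m" "norm k \<le> m"
proof -
  obtain c where c: "pos c" "c * c = k" "\<And>b. k * b = b * k \<Longrightarrow> c * b = b * c"
    using pos_sqrt[OF k(1)] by blast
  obtain s where s: "pos s" "s * s = of_real m - k" "\<And>b. (of_real m - k) * b = b * (of_real m - k) \<Longrightarrow> s * b = b * s"
    using pos_sqrt[OF k(2)] by blast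
  have kc: "c * k = k * c" by (simp add: mult.assoc flip: c(2))
  have mc: "of_real m * x = x * of_real m" for x :: 'a by (simp add: of_real_def)
  have sc: "s * c = c * s"
    by (rule s(3)) (simp add: algebra_simps kc mc)
  have ks: "s * k = k * s" by (metis c(2) sc mult.assoc)
  define y where "y = (1/m) *\<^sub>R (2 *\<^sub>R k - of_real m)"
  define w where "w = (2/m) *\<^sub>R (c * s)"
  have css: "(c * s) * (c * s) = m *\<^sub>R k - k * k"
    using sc c(2) s(2) by (metis mult.assoc right_diff_distrib mc scaleR_conv_of_real)
  have "norm y \<le> 1"
  proof (rule norm_le_one_if_squares_sum_one)
    show "star y = y" by (simp add: y_def star_scaleR star_diff pos_star[OF k(1)])
    show "star w = w" by (simp add: w_def star_scaleR star_mult pos_star[OF c(1)] pos_star[OF s(1)] sc)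
    have "k * (c * s) = (c * s) * k" using kc ks by (metis mult.assoc)
    then show "y * w = w * y"
      by (simp add: y_def w_def algebra_simps of_real_def)
    have "y * y + w * w = (1/m^2) *\<^sub>R ((2 *\<^sub>R k - of_real m) * (2 *\<^sub>R k - of_real m) + 4 *\<^sub>R (m *\<^sub>R k - k * k))"
    proof -
      have "w * w = (4/m^2) *\<^sub>R (m *\<^sub>R k - k * k)"
        unfolding css[symmetric] by (simp add: w_def power2_eq_square)
      moreover have "y * y = (1/m^2) *\<^sub>R ((2 *\<^sub>R k - of_real m) * (2 *\<^sub>R k - of_real m))"
        by (simp only: y_def mult_scaleR_left mult_scaleR_right scaleR_scaleR power2_eq_square) simp
      ultimately show ?thesis by (simp add: scaleR_add_right)
    qed
    also have "(2 *\<^sub>R k - of_real m) * (2 *\<^sub>R k - of_real m) = 4 *\<^sub>R (k * k) - (4 * m) *\<^sub>R k + (m^2) *\<^sub>R 1"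
      by (simp add: algebra_simps of_real_def power2_eq_square flip: scaleR_add_left)
    finally show "y * y + w * w = 1"
      using m by (simp add: algebra_simps)
  qed
  then show 1: "norm (2 *\<^sub>R k - of_real m) \<le> m"
  proof -
    have "norm y = norm (2 *\<^sub>R k - of_real m) / m" using m by (simp add: y_def)
    with \<open>norm y \<le> 1\<close> m show ?thesis by (simp add: divide_le_eq)
  qed
  have "norm (2 *\<^sub>R k) \<le> norm (2 *\<^sub>R k - of_real m) + norm (of_real m :: 'a)"
    by (metis norm_triangle_sub add.commute)
  then show "norm k \<le> m" using 1 m by simp
qed

lemma pos_norm_mono:
  assumes "pos k" "pos l" shows "norm k \<le> norm (k + l)"
proof (rule field_le_epsilon)
  fix e :: real assume "e > 0"
  \<comment> \<open>The e keeps the bound positive, as \<open>pos_le_norm\<close> requires.\<close>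
  let ?m = "norm (k + l) + e"
  have "pos (of_real ?m - (k + l))"
    by (rule pos_norm_minus) (use assms \<open>e > 0\<close> in \<open>simp_all add: star_add pos_star\<close>)
  from pos_add[OF this assms(2)] have "pos (of_real ?m - k)" by (simp add: algebra_simps)
  then show "norm k \<le> ?m" using assms \<open>e > 0\<close>
    by (intro pos_le_norm(2)) (auto intro: add_nonneg_pos)
qed

lemma pos_antisym: "pos a \<Longrightarrow> pos (- a) \<Longrightarrow> a = 0"
  using pos_norm_mono[of a "- a"] by simp

text \<open>Negativity passes from y* y to y y*, in place of a comparison of spectra. With X = s + y
  y* one has X^n y = y (s + y* y)^n, so |X^n| exceeds s^n by a factor of at most linear growth;
  since |X|^(2^m) = |X^(2^m)| for self-adjoint X, this forces |X| \<le> s. On the other hand y* y +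
  y y* is twice a sum of self-adjoint squares, so y y* is positive as well and vanishes.\<close>

lemma pos_star_mult_aux:
  fixes y :: "'a::{c_star_algebra,real_normed_algebra_1}"
  assumes "pos (- (star y * y))"
  shows "y = 0"
proof -
  let ?a = "star y * y" and ?b = "y * star y"
  obtain s0 where s0: "norm (of_real s0 + ?a) \<le> s0" using assms by (auto simp: pos_def)
  define s where "s = s0 + 1"
  have s: "s > 0" "norm (of_real s + ?a) \<le> s"
  proof -
    have "0 \<le> s0" using s0 norm_ge_zero order_trans by blast
    then show "s > 0" by (simp add: s_def)
    show "norm (of_real s + ?a) \<le> s"
      using s0 norm_triangle_ineq[of "of_real s0 + ?a" 1] by (simp add: s_def algebra_simps)
  qed
  define X where "X = of_real s + ?b"
  have mc: "of_real s * x = x * of_real s" for x :: 'a by (simp add: of_real_def)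
  have Xy: "X ^ n * y = y * (of_real s + ?a) ^ n" for n
  proof (induction n)
    case (Suc n)
    have "X ^ Suc n * y = X ^ n * (X * y)" by (metis power_Suc2 mult.assoc)
    also have "X * y = y * (of_real s + ?a)" by (simp add: X_def algebra_simps mc)
    also have "X ^ n * (y * (of_real s + ?a)) = y * (of_real s + ?a) ^ Suc n"
      by (metis Suc mult.assoc power_Suc2)
    finally show ?case .
  qed simp
  define \<kappa> where "\<kappa> = (norm y)\<^sup>2 / s"
  have Xn: "norm (X ^ n) \<le> s ^ n * (1 + real n * \<kappa>)" for n
  proof (induction n)
    case (Suc n)
    have "X ^ Suc n = s *\<^sub>R X ^ n + y * (of_real s + ?a) ^ n * star y"
      by (metis X_def Xy mult.assoc power_Suc2 distrib_left mc scaleR_conv_of_real)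
    then have "norm (X ^ Suc n) \<le> s * norm (X ^ n) + norm (y * (of_real s + ?a) ^ n * star y)"
      by (metis norm_triangle_ineq norm_scaleR abs_of_pos s(1))
    also have "norm (y * (of_real s + ?a) ^ n * star y) \<le> norm y * norm ((of_real s + ?a) ^ n) * norm y"
      using norm_mult_ineq[of "y * (of_real s + ?a) ^ n" "star y"]
        mult_right_mono[OF norm_mult_ineq[of y "(of_real s + ?a) ^ n"], of "norm y"] by simp
    also have "\<dots> \<le> norm y * s ^ n * norm y"
      by (intro mult_right_mono mult_left_mono)
        (use norm_power_ineq[of "of_real s + ?a" n] power_mono[OF s(2), of n] in auto)
    also have "\<dots> = s ^ Suc n * \<kappa>"
      using s(1) by (simp add: \<kappa>_def power2_eq_square)
    also have "s * norm (X ^ n) \<le> s * (s ^ n * (1 + real n * \<kappa>))"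
      using Suc s(1) by simp
    finally show ?case by (simp add: algebra_simps)
  qed simp
  have sX: "star X = X" by (simp add: X_def star_add star_mult star_star)
  have pow2: "norm (X ^ (2 ^ m)) = norm X ^ (2 ^ m)" for m
  proof (induction m)
    case (Suc m)
    have "X ^ (2 ^ Suc m) = X ^ (2 ^ m) * X ^ (2 ^ m)" by (simp add: power_add mult_2)
    then show ?case using norm_sa_square[of "X ^ (2 ^ m)"] Suc
      by (simp add: star_power sX power_mult mult.commute flip: power_mult)
  qed simp
  have "norm X \<le> s"
  proof (rule ccontr)
    assume notle: "\<not> ?thesis"
    define r where "r = norm X / s"
    have r: "r > 1" using notle s(1) by (simp add: r_def)
    have "r ^ (2 ^ m) \<le> 1 + real (2 ^ m) * \<kappa>" for m
      using Xn[of "2 ^ m"] s(1) unfolding pow2 r_def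
      by (simp add: power_divide field_simps)
    then have "1 \<le> 1 / r ^ (2 ^ m) + \<kappa> * (real (2 ^ m) / r ^ (2 ^ m))" for m
      using r by (simp add: field_simps)
    moreover have "(\<lambda>m. 1 / r ^ (2 ^ m) + \<kappa> * (real (2 ^ m) / r ^ (2 ^ m))) \<longlonglongrightarrow> 0 + \<kappa> * 0"
    proof (intro tendsto_intros)
      have sub: "strict_mono (\<lambda>m. 2 ^ m :: nat)" by (simp add: strict_monoI_Suc)
      have 1: "(\<lambda>n. 1 / r ^ n) \<longlonglongrightarrow> 0"
        using LIMSEQ_realpow_zero[of "1/r"] r by (simp add: power_one_over)
      show "(\<lambda>m. 1 / r ^ (2 ^ m)) \<longlonglongrightarrow> 0"
        using LIMSEQ_subseq_LIMSEQ[OF 1 sub] by (simp add: o_def)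
      have 2: "(\<lambda>n. real n / r ^ n) \<longlonglongrightarrow> 0"
        using lim_n_over_pown[of r] r by simp
      show "(\<lambda>m. real (2 ^ m) / r ^ (2 ^ m)) \<longlonglongrightarrow> 0"
        using LIMSEQ_subseq_LIMSEQ[OF 2 sub] by (simp add: o_def)
    qed
    ultimately have "1 \<le> 0 + \<kappa> * 0"
      by (intro LIMSEQ_le_const) auto
    then show False by simp
  qed
  then have negb: "pos (- ?b)"
    by (intro posI[of _ s]) (simp_all add: star_minus star_mult star_star X_def)
  \<comment> \<open>Real and imaginary parts: y = R + i I with R and I self-adjoint.\<close>
  define R where "R = (1/2) *\<^sub>R (y + star y)"
  define I where "I = (\<i>/2) *\<^sub>C (star y - y)"
  have "star R = R" "star I = I"
    by (simp_all add: R_def I_def star_scaleR star_scaleC star_add star_diff star_star add.commute)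
      (simp add: scaleC_diff_right algebra_simps)
  then have "pos (2 *\<^sub>R (R * R + I * I))" by (intro pos_scaleR pos_add pos_square) auto
  moreover have "2 *\<^sub>R (R * R + I * I) = ?a + ?b"
  proof -
    have "R * R = (1/4) *\<^sub>R ((y + star y) * (y + star y))" by (simp add: R_def)
    moreover have "I * I = - (1/4) *\<^sub>R ((star y - y) * (star y - y))"
      by (simp add: I_def mult_scaleC_left mult_scaleC_right scaleC_scaleC scaleR_scaleC)
    moreover have "(y + star y) * (y + star y) - (star y - y) * (star y - y) = 2 *\<^sub>R (?a + ?b)"
      by (simp add: algebra_simps scaleR_2)
    ultimately have "R * R + I * I = (1/4) *\<^sub>R (2 *\<^sub>R (?a + ?b))"
      by (metis scaleR_right_diff_distrib scaleR_minus_left diff_conv_add_uminus)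
    then show ?thesis by simp
  qed
  ultimately have "pos (?a + ?b)" by simp
  from pos_add[OF this assms] have "pos ?b" by simp
  from pos_antisym[OF this negb] have "?b = 0" .
  then show "y = 0" using mult_star_eq_0[of "star y"] by (simp add: star_star) (metis star_star star_zero)
qed

text \<open>With r = |h| the element q = r - h is twice the negative part of h, and (r + h) q = 0
  gives h q = - r q. So y = x q has y* y = q h q = - (c q)^2 with c^2 = r. By
  \<open>pos_star_mult_aux\<close> y = 0, whence r q = 0, then q^2 = 0 and h = r.\<close>

lemma pos_star_mult:
  fixes x :: "'a::{c_star_algebra,real_normed_algebra_1}"
  shows "pos (star x * x)"
proof -
  define h where "h = star x * x"
  have sh: "star h = h" by (simp add: h_def star_mult star_star)
  obtain r where r: "pos r" "r * r = h * h" "\<And>b. h * h * b = b * (h * h) \<Longrightarrow> r * b = b * r"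
    using pos_sqrt[OF pos_square[OF sh]] by blast
  obtain c where c: "pos c" "c * c = r" "\<And>b. r * b = b * r \<Longrightarrow> c * b = b * c"
    using pos_sqrt[OF r(1)] by blast
  have rh: "r * h = h * r" by (rule r(3)) (simp add: mult.assoc)
  then have ch: "c * h = h * c" by (rule c(3))
  have cr: "c * r = r * c" by (simp add: mult.assoc flip: c(2))
  define q where "q = r - h"
  have q: "star q = q" "c * q = q * c" "h * q = q * h" "r * q = q * r"
    by (simp_all add: q_def star_diff pos_star r sh algebra_simps ch cr rh)
  have "(r + h) * q = 0" by (simp add: q_def algebra_simps rh r(2))
  then have hq: "h * q = - (r * q)" by (simp add: algebra_simps eq_neg_iff_add_eq_0)
  define y where "y = x * q"
  have "star y * y = q * (h * q)" by (simp add: y_def h_def star_mult q mult.assoc)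
  also have "\<dots> = - ((c * q) * (c * q))"
    by (simp add: hq) (metis c(2) mult.assoc q(2))
  finally have y: "- (star y * y) = (c * q) * (c * q)" by simp
  moreover have scq: "star (c * q) = c * q" by (simp add: star_mult q pos_star c)
  ultimately have "pos (- (star y * y))" by (simp add: pos_square)
  then have "y = 0" by (rule pos_star_mult_aux)
  then have "c * q = 0" using y mult_star_eq_0[of "c * q"] scq by simp
  then have "r * q = 0" by (metis c(2) mult.assoc mult_zero_right)
  then have "q * q = 0" using hq by (simp add: q_def left_diff_distrib)
  then have "q = 0" using mult_star_eq_0[of q] q(1) by simp
  then show ?thesis using r(1) by (simp add: q_def h_def)
qed

lemma pos_conj:
  assumes "pos a" shows "pos (star x * a * x)"
proof -
  obtain c where "pos c" "c * c = a" using pos_sqrt[OF assms] by blast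
  then have "star x * a * x = star (c * x) * (c * x)" by (auto simp: star_mult pos_star mult.assoc)
  then show ?thesis by (simp add: pos_star_mult)
qed

lemma pos_mult:
  assumes "pos a" "pos b" "a * b = b * a" shows "pos (a * b)"
proof -
  obtain c where c: "pos c" "c * c = a" "\<And>b. a * b = b * a \<Longrightarrow> c * b = b * c"
    using pos_sqrt[OF assms(1)] by blast
  have "a * b = star c * b * c" using c(2) c(3)[OF assms(3)] pos_star[OF c(1)] by (metis mult.assoc)
  then show ?thesis by (simp add: pos_conj assms)
qed

text \<open>Square roots show that f keeps positivity; applied to |x|^2 + e - x* x this bounds |f
  x|^2.\<close>

lemma star_hom_contractive:
  fixes f :: "'a::{c_star_algebra,real_normed_algebra_1} \<Rightarrow> 'b::{c_star_algebra,real_normed_algebra_1}"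
  assumes "clinear f" "\<And>x y. f (x * y) = f x * f y" "\<And>x. f (star x) = star (f x)" "f 1 = 1"
  shows "norm (f x) \<le> norm x"
proof -
  have ps: "pos (f a)" if a: "pos a" for a
  proof -
    obtain c where "pos c" "c * c = a" using pos_sqrt[OF a] by blast
    then have "f a = star (f c) * f c" by (metis assms(2,3) pos_star)
    then show ?thesis by (simp add: pos_star_mult)
  qed
  have fr: "f (of_real r) = of_real r" for r
    by (simp add: of_real_def clinear_simps[OF assms(1)] assms(4))
  have "(norm (f x))\<^sup>2 \<le> (norm x)\<^sup>2 + e" if "e > 0" for e
  proof -
    have "pos (of_real ((norm x)\<^sup>2 + e) - star x * x)"
      by (rule pos_norm_minus) (use that in \<open>simp_all add: star_mult star_star norm_star_mult\<close>)
    then have "pos (of_real ((norm x)\<^sup>2 + e) - star (f x) * f x)"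
      using ps by (metis assms(2,3) clinear_simps(5)[OF assms(1)] fr)
    then have "norm (star (f x) * f x) \<le> (norm x)\<^sup>2 + e"
      using that by (intro pos_le_norm(2) pos_star_mult) (auto intro: add_nonneg_pos)
    then show ?thesis by (simp add: norm_star_mult)
  qed
  then have "(norm (f x))\<^sup>2 \<le> (norm x)\<^sup>2" by (rule field_le_epsilon)
  then show ?thesis by (simp add: power2_le_iff_abs_le)
qed

section \<open>The unitization\<close>

datatype 'a unitization = Adj (ipart: 'a) (spart: complex)

definition unit_op :: "'a::c_star_algebra unitization \<Rightarrow> 'a \<Rightarrow> 'a" where
  "unit_op x v = ipart x * v + spart x *\<^sub>C v"

lemma bounded_linear_scaleC: "bounded_linear (\<lambda>x::'a::c_star_algebra. a *\<^sub>C x)"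
  by (rule bounded_linear_intro[of _ "cmod a"])
    (simp_all add: scaleC_add_right scaleC_scaleR norm_scaleC mult.commute)

lemma bounded_linear_unit_op: "bounded_linear (unit_op x)"
proof -
  have "bounded_linear (\<lambda>v. ipart x * v + spart x *\<^sub>C v)"
    by (intro bounded_linear_add bounded_linear_mult_right bounded_linear_scaleC)
  then show ?thesis by (simp add: unit_op_def[abs_def])
qed

lemma unitization_eqI: "ipart x = ipart y \<Longrightarrow> spart x = spart y \<Longrightarrow> x = y"
  by (cases x; cases y) simp

instantiation unitization :: (c_star_algebra) complex_vector
begin
definition "0 = Adj 0 0"
definition "x + y = Adj (ipart x + ipart y) (spart x + spart y)"
definition "x - y = Adj (ipart x - ipart y) (spart x - spart y)"
definition "- x = Adj (- ipart x) (- spart x)"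
definition "r *\<^sub>R x = Adj (r *\<^sub>R ipart x) (r *\<^sub>R spart x)"
definition "a *\<^sub>C x = Adj (a *\<^sub>C ipart x) (a * spart x)"
instance
  by standard (auto intro!: unitization_eqI
      simp: zero_unitization_def plus_unitization_def minus_unitization_def uminus_unitization_def
        scaleR_unitization_def scaleC_unitization_def algebra_simps
        scaleC_add_left scaleC_add_right scaleC_scaleC scaleC_one scaleR_scaleC scaleC_complex_def)
end

lemma unitization_sel [simp]:
  fixes x y :: "'a::c_star_algebra unitization"
  shows "ipart 0 = (0::'a)" "spart (0::'a unitization) = 0"
    "ipart (x + y) = ipart x + ipart y" "spart (x + y) = spart x + spart y"
    "ipart (x - y) = ipart x - ipart y" "spart (x - y) = spart x - spart y"
    "ipart (- x) = - ipart x" "spart (- x) = - spart x"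
    "ipart (r *\<^sub>R x) = r *\<^sub>R ipart x" "spart (r *\<^sub>R x) = r *\<^sub>R spart x"
    "ipart (a *\<^sub>C x) = a *\<^sub>C ipart x" "spart (a *\<^sub>C x) = a * spart x"
  by (simp_all add: zero_unitization_def plus_unitization_def minus_unitization_def
      uminus_unitization_def scaleR_unitization_def scaleC_unitization_def)

instantiation unitization :: (c_star_algebra) real_normed_vector
begin
text \<open>If the algebra has a unit u, then \<open>Adj (- u) 1\<close> acts as zero and the
  operator norm alone would only be a seminorm; the scalar part repairs this.\<close>

definition "norm x = max (onorm (unit_op x)) (cmod (spart x))"
definition "dist x y = norm (x - y :: 'a unitization)"
definition "sgn x = (x :: 'a unitization) /\<^sub>R norm x"
definition [code del]:
  "(uniformity :: ('a unitization \<times> 'a unitization) filter) = (INF e\<in>{0<..}. principal {(x, y). dist x y < e})"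
definition [code del]:
  "open (U :: 'a unitization set) = (\<forall>x\<in>U. eventually (\<lambda>(x', y). x' = x \<longrightarrow> y \<in> U) uniformity)"
instance
proof
  fix x y :: "'a unitization" and r :: real
  show "norm x = 0 \<longleftrightarrow> x = 0"
  proof
    assume 0: "norm x = 0"
    then have s: "spart x = 0"
      using onorm_pos_le[OF bounded_linear_unit_op, of x] by (auto simp: norm_unitization_def max_def split: if_splits)
    then have "onorm (unit_op x) = 0"
      using 0 onorm_pos_le[OF bounded_linear_unit_op, of x] by (simp add: norm_unitization_def max_def split: if_splits)
    then have "unit_op x (star (ipart x)) = 0"
      by (simp add: onorm_eq_0 bounded_linear_unit_op)
    then have "ipart x = 0"
      using mult_star_eq_0[of "star (ipart x)"] s
      by (simp add: unit_op_def star_star) (metis star_star star_zero)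
    with s show "x = 0" by (intro unitization_eqI) auto
  next
    assume "x = 0"
    then show "norm x = 0" by (simp add: norm_unitization_def unit_op_def[abs_def] onorm_zero)
  qed
  show "norm (x + y) \<le> norm x + norm y"
  proof -
    have "unit_op (x + y) = (\<lambda>v. unit_op x v + unit_op y v)"
      by (auto simp: unit_op_def algebra_simps scaleC_add_left)
    then have "onorm (unit_op (x + y)) \<le> onorm (unit_op x) + onorm (unit_op y)"
      using onorm_triangle[OF bounded_linear_unit_op bounded_linear_unit_op, of x y] by simp
    moreover have "cmod (spart (x + y)) \<le> cmod (spart x) + cmod (spart y)"
      by (simp add: norm_triangle_ineq)
    ultimately show ?thesis by (auto simp: norm_unitization_def max_def)
  qed
  show "norm (r *\<^sub>R x) = \<bar>r\<bar> * norm x"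
  proof -
    have "unit_op (r *\<^sub>R x) = (\<lambda>v. r *\<^sub>R unit_op x v)"
      by (simp add: unit_op_def fun_eq_iff scaleR_add_right scaleR_conv_of_real)
        (simp add: scaleR_scaleC scaleC_scaleC)
    then have "onorm (unit_op (r *\<^sub>R x)) = \<bar>r\<bar> * onorm (unit_op x)"
      using onorm_scaleR[OF bounded_linear_unit_op, of r x] by simp
    then show ?thesis by (simp add: norm_unitization_def max_mult_distrib_left norm_mult)
  qed
qed (auto simp: dist_unitization_def sgn_unitization_def uniformity_unitization_def open_unitization_def)
end

instantiation unitization :: (c_star_algebra) real_normed_algebra_1
begin
definition "1 = Adj 0 1"
definition "x * y = Adj (ipart x * ipart y + spart y *\<^sub>C ipart x + spart x *\<^sub>C ipart y) (spart x * spart y)"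

lemma unitization_mult_sel [simp]:
  fixes x y :: "'a unitization"
  shows "ipart (1 :: 'a unitization) = 0" "spart (1 :: 'a unitization) = 1"
    "ipart (x * y) = ipart x * ipart y + spart y *\<^sub>C ipart x + spart x *\<^sub>C ipart y"
    "spart (x * y) = spart x * spart y"
  by (simp_all add: one_unitization_def times_unitization_def)

lemma unit_op_mult: "unit_op (x * y) = unit_op x \<circ> unit_op (y :: 'a unitization)"
  by (auto simp: unit_op_def algebra_simps mult_scaleC_left mult_scaleC_right scaleC_add_right scaleC_scaleC)

instance
proof
  fix x y z :: "'a unitization" and r :: real
  show "norm (x * y) \<le> norm x * norm y"
  proof -
    have "onorm (unit_op (x * y)) \<le> onorm (unit_op x) * onorm (unit_op y)"
      unfolding unit_op_mult by (intro onorm_compose bounded_linear_unit_op)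
    also have "\<dots> \<le> norm x * norm y"
      by (intro mult_mono) (auto simp: norm_unitization_def onorm_pos_le bounded_linear_unit_op intro: order_trans[OF norm_ge_zero max.cobounded2])
    finally have "onorm (unit_op (x * y)) \<le> norm x * norm y" .
    moreover have "cmod (spart (x * y)) \<le> norm x * norm y"
      by (auto simp: norm_unitization_def norm_mult intro!: mult_mono intro: order_trans[OF norm_ge_zero max.cobounded2])
    ultimately show ?thesis by (simp add: norm_unitization_def)
  qed
  show "(0 :: 'a unitization) \<noteq> 1"
    by (metis unitization_mult_sel(2) unitization_sel(2) zero_neq_one)
  have "unit_op (1 :: 'a unitization) = (\<lambda>v. v)" by (simp add: unit_op_def fun_eq_iff scaleC_one)
  moreover have "onorm (\<lambda>v::'a. v) \<le> 1" by (rule onorm_bound) auto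
  ultimately show "norm (1 :: 'a unitization) = 1"
    by (simp add: norm_unitization_def max_def)
qed (auto intro!: unitization_eqI
      simp: algebra_simps scaleC_add_left scaleC_add_right scaleC_scaleC scaleC_one
         scaleC_scaleR mult_scaleC_left mult_scaleC_right scaleR_scaleC scaleC_complex_def)
end

definition emb :: "'a::c_star_algebra \<Rightarrow> 'a unitization" where
  "emb b = Adj b 0"

lemma emb_sel [simp]: "ipart (emb b) = b" "spart (emb b) = 0"
  by (simp_all add: emb_def)

lemma emb_ipart: "spart x = 0 \<Longrightarrow> emb (ipart x) = x"
  by (rule unitization_eqI) auto

lemma emb_simps:
  "emb (a + b) = emb a + emb b" "emb (a * b) = emb a * emb b" "emb (a - b) = emb a - emb b"
  "emb (c *\<^sub>C a) = c *\<^sub>C emb a" "emb 0 = 0" "emb (r *\<^sub>R a) = r *\<^sub>R emb a"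
  by (rule unitization_eqI; simp)+

text \<open>The operator norm is bounded below by testing on \<open>star b\<close>, where the C*
  identity applies.\<close>

lemma norm_emb [simp]: "norm (emb b) = norm b"
proof -
  have op: "unit_op (emb b) = (\<lambda>v. b * v)" by (simp add: unit_op_def fun_eq_iff)
  have "onorm (unit_op (emb b)) \<le> norm b"
    unfolding op by (rule onorm_bound) (auto simp: norm_mult_ineq)
  moreover have "norm b \<le> onorm (unit_op (emb b))"
  proof (cases "b = 0")
    case False
    have "norm (b * star b) \<le> onorm (unit_op (emb b)) * norm (star b)"
      using onorm[OF bounded_linear_unit_op, of "emb b" "star b"] by (simp add: op)
    moreover have "norm (b * star b) = norm b * norm b"
      by (metis norm_star norm_star_mult power2_eq_square star_star)
    ultimately show ?thesis using False by simp
  qed (simp add: onorm_pos_le bounded_linear_unit_op)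
  ultimately show ?thesis
    by (simp add: norm_unitization_def onorm_pos_le bounded_linear_unit_op max_def)
qed

lemma unitization_decomp: "x = emb (ipart x) + spart x *\<^sub>C 1"
  by (rule unitization_eqI) auto

lemma norm_scaleC_one: "norm (a *\<^sub>C (1 :: 'a::c_star_algebra unitization)) = cmod a"
proof -
  have "unit_op (a *\<^sub>C (1 :: 'a unitization)) = (\<lambda>v. a *\<^sub>C v)" by (simp add: unit_op_def fun_eq_iff)
  moreover have "onorm (\<lambda>v::'a. a *\<^sub>C v) \<le> cmod a" by (rule onorm_bound) (auto simp: norm_scaleC)
  ultimately show ?thesis by (simp add: norm_unitization_def max_def)
qed

lemma norm_unitization_le: "norm x \<le> norm (ipart x) + cmod (spart x)"
  by (metis norm_emb norm_scaleC_one norm_triangle_ineq unitization_decomp)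

lemma norm_spart_le: "cmod (spart x) \<le> norm x"
  by (simp add: norm_unitization_def)

lemma norm_ipart_le: "norm (ipart x) \<le> 2 * norm x"
proof -
  have "emb (ipart x) = x - spart x *\<^sub>C 1" by (rule unitization_eqI) auto
  then have "norm (ipart x) \<le> norm x + cmod (spart x)"
    by (metis norm_emb norm_scaleC_one norm_triangle_ineq4)
  then show ?thesis using norm_spart_le[of x] by simp
qed

instance unitization :: (c_star_algebra) banach
proof
  fix X :: "nat \<Rightarrow> 'a unitization"
  assume X: "Cauchy X"
  have "Cauchy (\<lambda>n. spart (X n))"
    unfolding Cauchy_def dist_norm
  proof (intro allI impI)
    fix e :: real assume "e > 0"
    then obtain M where "\<forall>m\<ge>M. \<forall>n\<ge>M. dist (X m) (X n) < e" using X by (auto simp: Cauchy_def)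
    then show "\<exists>M. \<forall>m\<ge>M. \<forall>n\<ge>M. cmod (spart (X m) - spart (X n)) < e"
      by (metis dist_norm norm_spart_le order_le_less_trans unitization_sel(6))
  qed
  moreover have "Cauchy (\<lambda>n. ipart (X n))"
    unfolding Cauchy_def dist_norm
  proof (intro allI impI)
    fix e :: real assume "e > 0"
    then have "e / 2 > 0" by simp
    then obtain M where M: "\<forall>m\<ge>M. \<forall>n\<ge>M. dist (X m) (X n) < e/2" using X unfolding Cauchy_def by blast
    have "norm (ipart (X m) - ipart (X n)) < e" if "m \<ge> M" "n \<ge> M" for m n
      using M that norm_ipart_le[of "X m - X n"] by (fastforce simp: dist_norm)
    then show "\<exists>M. \<forall>m\<ge>M. \<forall>n\<ge>M. norm (ipart (X m) - ipart (X n)) < e" by blast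
  qed
  ultimately obtain b c where bc: "(\<lambda>n. ipart (X n)) \<longlonglongrightarrow> b" "(\<lambda>n. spart (X n)) \<longlonglongrightarrow> c"
    by (meson Cauchy_convergent_iff convergentD)
  have "(\<lambda>n. norm (ipart (X n) - b) + cmod (spart (X n) - c)) \<longlonglongrightarrow> 0 + 0"
    by (intro tendsto_add) (use bc in \<open>simp_all add: LIM_zero_iff tendsto_norm_zero_iff\<close>)
  moreover have "norm (X n - Adj b c) \<le> norm (ipart (X n) - b) + cmod (spart (X n) - c)" for n
    using norm_unitization_le[of "X n - Adj b c"] by simp
  ultimately have "(\<lambda>n. X n - Adj b c) \<longlonglongrightarrow> 0"
    by (intro Lim_null_comparison[where f="\<lambda>n. X n - Adj b c"] always_eventually) auto
  then have "X \<longlonglongrightarrow> Adj b c" by (simp add: LIM_zero_iff)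
  then show "convergent X" by (rule convergentI)
qed

instantiation unitization :: (c_star_algebra) c_star_algebra
begin
definition "star x = Adj (star (ipart x)) (cnj (spart x))"

lemma unitization_star_sel [simp]:
  "ipart (star x) = star (ipart x :: 'a)" "spart (star x) = cnj (spart x)"
  by (simp_all add: star_unitization_def)

text \<open>Adjointness for the algebra-valued pairing of v and w by star v * w; it yields the C*
  inequality for the operator norm just as in a Hilbert space.\<close>

lemma unit_op_star: "star (unit_op x v) * w = star v * unit_op (star x) (w::'a)"
  by (simp add: unit_op_def star_add star_mult star_scaleC distrib_left distrib_right
      mult_scaleC_left mult_scaleC_right mult.assoc)

instance
proof
  fix x y :: "'a unitization" and a :: complex
  show "norm (a *\<^sub>C x) = cmod a * norm x"
  proof -
    have le: "norm (a *\<^sub>C x) \<le> cmod a * norm x" for a and x :: "'a unitization"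
    proof -
      have "a *\<^sub>C x = (a *\<^sub>C 1) * x" by (rule unitization_eqI) (auto)
      then show ?thesis by (metis norm_mult_ineq norm_scaleC_one)
    qed
    show ?thesis
    proof (cases "a = 0")
      case False
      have "norm x \<le> cmod (inverse a) * norm (a *\<^sub>C x)"
        using le[of "inverse a" "a *\<^sub>C x"] False by (simp add: scaleC_scaleC scaleC_one)
      then have "cmod a * norm x \<le> cmod a * (inverse (cmod a) * norm (a *\<^sub>C x))"
        by (intro mult_left_mono) (simp_all add: norm_inverse)
      also have "\<dots> = norm (a *\<^sub>C x)" using False by simp
      finally have "cmod a * norm x \<le> norm (a *\<^sub>C x)" .
      then show ?thesis using le[of a x] by simp
    qed simp
  qed
  have on: "(onorm (unit_op x))\<^sup>2 \<le> onorm (unit_op (star x * x))" for x :: "'a unitization"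
  proof -
    have "norm (unit_op x v) \<le> sqrt (onorm (unit_op (star x * x))) * norm v" for v
    proof -
      have "(norm (unit_op x v))\<^sup>2 = norm (star v * unit_op (star x * x) v)"
        by (simp add: unit_op_mult flip: norm_star_mult unit_op_star)
      also have "\<dots> \<le> norm v * (onorm (unit_op (star x * x)) * norm v)"
        using norm_mult_ineq[of "star v" "unit_op (star x * x) v"]
          mult_left_mono[OF onorm[OF bounded_linear_unit_op, of "star x * x" v], of "norm v"]
        by simp
      also have "\<dots> = (sqrt (onorm (unit_op (star x * x))) * norm v)\<^sup>2"
        by (simp add: power_mult_distrib onorm_pos_le bounded_linear_unit_op power2_eq_square)
      finally show ?thesis
        by (rule power2_le_imp_le) (simp add: onorm_pos_le bounded_linear_unit_op)
    qed
    then have "onorm (unit_op x) \<le> sqrt (onorm (unit_op (star x * x)))"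
      by (intro onorm_bound) (auto simp: onorm_pos_le bounded_linear_unit_op)
    then show ?thesis
      using onorm_pos_le[OF bounded_linear_unit_op, of x] onorm_pos_le[OF bounded_linear_unit_op, of "star x * x"]
      by (metis real_sqrt_pow2 power_mono)
  qed
  have sub: "onorm (unit_op (star x * x)) \<le> onorm (unit_op (star x)) * onorm (unit_op x)" for x :: "'a unitization"
    unfolding unit_op_mult by (intro onorm_compose bounded_linear_unit_op)
  have ss: "star (star x) = x" for x :: "'a unitization"
    by (rule unitization_eqI) (auto simp: star_star)
  have le: "onorm (unit_op x) \<le> onorm (unit_op (star x))" for x :: "'a unitization"
  proof (cases "onorm (unit_op x) = 0")
    case True
    then show ?thesis using onorm_pos_le[OF bounded_linear_unit_op, of "star x"] by simp
  next
    case False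
    then have "onorm (unit_op x) > 0" using onorm_pos_le[OF bounded_linear_unit_op, of x] by simp
    moreover have "onorm (unit_op x) * onorm (unit_op x) \<le> onorm (unit_op (star x)) * onorm (unit_op x)"
      using on[of x] sub[of x] by (simp add: power2_eq_square)
    ultimately show ?thesis by simp
  qed
  have eq: "onorm (unit_op (star x)) = onorm (unit_op x)"
    using le[of x] le[of "star x"] by (simp add: ss)
  have "onorm (unit_op (star x * x)) = (onorm (unit_op x))\<^sup>2"
    using on[of x] sub[of x] eq by (simp add: power2_eq_square)
  moreover have "cmod (spart (star x * x)) = (cmod (spart x))\<^sup>2"
    by (simp add: norm_mult power2_eq_square)
  ultimately show "norm (star x * x) = (norm x)\<^sup>2"
    using onorm_pos_le[OF bounded_linear_unit_op, of x]
    by (simp add: norm_unitization_def max_def power_mono_iff)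
qed (auto intro!: unitization_eqI
      simp: algebra_simps scaleC_add_left scaleC_add_right scaleC_scaleC scaleC_one
         star_star star_add star_mult star_scaleC mult_scaleC_left mult_scaleC_right)
end

lemma emb_star: "emb (star b) = star (emb b)"
  by (rule unitization_eqI) auto

lemma spart_of_real [simp]: "spart (of_real r) = of_real r"
  by (simp add: of_real_def)

lemma spart_power: "spart (x ^ n) = spart x ^ n"
  by (induction n) auto

lemma spart_sum: "spart (sum f F) = (\<Sum>x\<in>F. spart (f x))"
  by (induction F rule: infinite_finite_induct) auto

text \<open>\<open>spart\<close> is multiplicative, so a square root of an element of the algebra
  has scalar part 0 and lies in the algebra itself.\<close>

lemma pos_emb_square:
  assumes "pos (emb a)" obtains c where "star c = c" "a = star c * c"
proof -
  obtain c where c: "pos c" "c * c = emb a" using pos_sqrt[OF assms] by blast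
  then have "spart c * spart c = 0" by (metis emb_sel(2) unitization_mult_sel(4))
  then have "c = emb (ipart c)" by (simp add: emb_ipart)
  then have "star (ipart c) = ipart c" "a = ipart c * ipart c"
    using c by (metis pos_star unitization_star_sel(1), metis c(2) emb_sel(1) emb_simps(2))
  then show thesis using that by metis
qed

section \<open>Approximate units\<close>

definition unit_interval :: "'a::c_star_algebra \<Rightarrow> bool" where
  "unit_interval u \<longleftrightarrow> pos (emb u) \<and> pos (1 - emb u)"

lemma pos_power:
  assumes "pos g" shows "pos (g ^ n)"
proof (induction n)
  case (Suc n)
  have "pos (g * g ^ n)" by (rule pos_mult) (use assms Suc in \<open>simp_all add: power_commutes\<close>)
  then show ?case by simp
qed simp

text \<open>The scalar model is n t (1 - t)^n \<le> 1 - (1 - t)^n, from the geometric sum 1 - g^n =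
  h (1 + g + ... + g^(n-1)) in which every g^j is at least g^n. The induction proves the operator
  form.\<close>

lemma norm_power_complement_le:
  fixes h :: "'a::{c_star_algebra,real_normed_algebra_1}"
  assumes h: "pos h" "pos (1 - h)"
  shows "real n * norm (h * (1 - h) ^ n) \<le> 1"
proof -
  define g where "g = 1 - h"
  have hg: "h * g = g * h" by (simp add: g_def algebra_simps)
  have hgn: "h * g ^ n = g ^ n * h" for n
    by (rule power_commuting_commutes[symmetric]) (simp add: hg)
  have pg: "pos (g ^ n)" for n using h by (simp add: g_def pos_power)
  have phg: "pos (h * g ^ n)" for n by (rule pos_mult) (use h pg hgn in auto)
  have phhg: "pos (h * (h * g ^ n))" for n
    by (rule pos_mult[OF h(1) phg]) (metis hgn mult.assoc)
  have "pos (1 - g ^ n - real n *\<^sub>R (h * g ^ n))" for n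
  proof (induction n)
    case (Suc n)
    have gS: "g ^ Suc n = g ^ n - h * g ^ n" by (simp add: g_def algebra_simps)
    have "1 - g ^ Suc n - real (Suc n) *\<^sub>R (h * g ^ Suc n) =
      (1 - g ^ n - real n *\<^sub>R (h * g ^ n)) + real (Suc n) *\<^sub>R (h * (h * g ^ n))"
      unfolding gS by (simp add: algebra_simps)
    then show ?case using Suc by (simp only: pos_add pos_scaleR phhg of_nat_0_le_iff)
  qed simp
  from pos_add[OF this[of n] pg[of n]] have "pos (of_real 1 - real n *\<^sub>R (h * g ^ n))"
    by (simp add: algebra_simps)
  then have "norm (real n *\<^sub>R (h * g ^ n)) \<le> 1"
    by (intro pos_le_norm(2) pos_scaleR phg) auto
  then show ?thesis by (simp add: g_def)
qed

text \<open>Take u = 1 - g^n with g = 1 - h and h a normalised sum of all b b* for b in F. Then |u b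
  - b|^2 = |g^n b b* g^n| is at most |g^n h0 g^n|, because the other summands are positive, and this
  equals m |h g^(2n)|, of order 1/n.\<close>

lemma ex_approximate_unit:
  fixes F :: "'a::c_star_algebra set"
  assumes "finite F" "e > 0"
  shows "\<exists>u. unit_interval u \<and> (\<forall>b\<in>F. norm (u * b - b) < e)"
proof -
  define h0 where "h0 = (\<Sum>b\<in>F. emb b * star (emb b))"
  have pb: "pos (emb b * star (emb b))" for b :: 'a
    using pos_star_mult[of "star (emb b)"] by (simp add: star_star)
  define m where "m = norm h0 + 1"
  have m: "m > 0" by (simp add: m_def add_nonneg_pos)
  define h where "h = (1/m) *\<^sub>R h0"
  have ph0: "pos h0" unfolding h0_def by (intro pos_sum pb)
  then have ph: "pos h" using m by (simp add: h_def pos_scaleR)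
  have ph': "pos (1 - h)"
    using pos_norm_minus[of h 1] pos_star[OF ph] m by (simp add: h_def) (simp add: m_def)
  define g where "g = 1 - h"
  obtain n :: nat where n: "n > 0" "m / real (2 * n) < e\<^sup>2"
  proof -
    obtain n :: nat where n: "m / e\<^sup>2 < real n" using reals_Archimedean2 by blast
    then have "n > 0" using assms m by (metis divide_pos_pos less_trans of_nat_0_less_iff zero_less_power)
    moreover have "m < real n * e\<^sup>2" using n assms by (simp add: divide_less_eq)
    moreover have "0 < real n * e\<^sup>2" using assms \<open>n > 0\<close> by simp
    ultimately have "m < e\<^sup>2 * real (2 * n)" by (simp add: algebra_simps)
    then show thesis using that[of n] \<open>n > 0\<close> by (simp add: divide_less_eq)
  qed
  have pg: "pos (g ^ n)" using ph' by (simp add: g_def pos_power)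
  have pE: "pos (1 - g ^ n)"
  proof (induction n)
    case (Suc n)
    have "pos (h * g ^ n)"
      by (rule pos_mult[OF ph])
        (use ph' in \<open>auto simp: g_def pos_power intro!: power_commuting_commutes[symmetric]\<close>,
         simp add: algebra_simps)
    with Suc have "pos ((1 - g ^ n) + h * g ^ n)" by (rule pos_add)
    then show ?case by (simp add: g_def algebra_simps)
  qed simp
  define E where "E = 1 - g ^ n"
  \<comment> \<open>1 - (1 - h)^n is a polynomial in h without constant term, so E belongs to the
    algebra.\<close>
  have "spart h = 0" by (simp add: h_def h0_def spart_sum)
  then have "spart E = 0" by (simp add: E_def g_def spart_power)
  then have E: "emb (ipart E) = E" by (rule emb_ipart)
  have "norm (ipart E * b - b) < e" if b: "b \<in> F" for b
  proof -
    have "emb (ipart E * b - b) = - (g ^ n * emb b)" by (simp add: emb_simps E) (simp add: E_def algebra_simps)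
    then have "norm (ipart E * b - b) = norm (g ^ n * emb b)" by (metis norm_emb norm_minus_cancel)
    then have "(norm (ipart E * b - b))\<^sup>2 = norm ((g ^ n * emb b) * star (g ^ n * emb b))"
      using norm_star_mult[of "star (g ^ n * emb b)"] by (simp add: star_star)
    also have "\<dots> = norm (star (g ^ n) * (emb b * star (emb b)) * g ^ n)"
      by (simp add: star_mult pos_star[OF pg] mult.assoc)
    also have "\<dots> \<le> norm (star (g ^ n) * (emb b * star (emb b)) * g ^ n +
        star (g ^ n) * (\<Sum>c\<in>F - {b}. emb c * star (emb c)) * g ^ n)"
      by (intro pos_norm_mono pos_conj pb pos_sum)
    also have "\<dots> = norm (star (g ^ n) * h0 * g ^ n)"
      unfolding h0_def using assms b by (subst sum.remove[of F b]) (auto simp: algebra_simps)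
    also have "star (g ^ n) * h0 * g ^ n = m *\<^sub>R (h * g ^ (2 * n))"
    proof -
      have "g ^ n * h = h * g ^ n" by (rule power_commuting_commutes) (simp add: g_def algebra_simps)
      moreover have "h0 = m *\<^sub>R h" using m by (simp add: h_def)
      ultimately show ?thesis by (simp add: pos_star[OF pg] mult_2 power_add mult.assoc)
    qed
    also have "norm \<dots> = m * norm (h * g ^ (2 * n))" using m by simp
    also have "\<dots> \<le> m / real (2 * n)"
      using norm_power_complement_le[OF ph ph', of "2 * n"] m n(1) by (simp add: g_def field_simps)
    also have "\<dots> < e\<^sup>2" by (rule n)
    finally show ?thesis by (rule power2_less_imp_less) (use assms in simp)
  qed
  moreover have "unit_interval (ipart E)"
    using pE pg by (simp add: unit_interval_def E) (simp add: E_def)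
  ultimately show ?thesis by blast
qed

text \<open>A filter in place of a net: the algebra may be non-separable, so sequences do not
  suffice, and limits along a filter obey the rules for \<open>tendsto\<close>.\<close>

definition approx_unit :: "'a::c_star_algebra filter" where
  "approx_unit = (INF Fe \<in> {(F, e). finite F \<and> e > (0::real)}.
     principal {u. unit_interval u \<and> (\<forall>b\<in>fst Fe. norm (u * b - b) < snd Fe)})"

lemma eventually_approx_unit:
  "eventually P (approx_unit :: 'a::c_star_algebra filter) \<longleftrightarrow>
    (\<exists>F e. finite F \<and> e > 0 \<and> (\<forall>u. unit_interval u \<and> (\<forall>b\<in>F. norm (u * b - b) < e) \<longrightarrow> P u))"
  unfolding approx_unit_def
proof (subst eventually_INF_base)
  show "{(F, e). finite F \<and> (0::real) < e} \<noteq> {}" by (auto intro!: exI[of _ "{}"] exI[of _ 1])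
  fix A B :: "'a set \<times> real"
  assume AB: "A \<in> {(F, e). finite F \<and> 0 < e}" "B \<in> {(F, e). finite F \<and> 0 < e}"
  show "\<exists>x\<in>{(F, e). finite F \<and> 0 < e}.
          principal {u. unit_interval u \<and> (\<forall>b\<in>fst x. norm (u * b - b) < snd x)}
          \<le> inf (principal {u. unit_interval u \<and> (\<forall>b\<in>fst A. norm (u * b - b) < snd A)})
              (principal {u. unit_interval u \<and> (\<forall>b\<in>fst B. norm (u * b - b) < snd B)})"
    by (rule bexI[of _ "(fst A \<union> fst B, min (snd A) (snd B))"]) (use AB in auto)
qed (force simp: eventually_principal)

lemma approx_unit_neq_bot [simp]: "approx_unit \<noteq> (bot :: 'a::c_star_algebra filter)"
proof -
  have "\<not> eventually (\<lambda>_. False) (approx_unit :: 'a filter)"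
    unfolding eventually_approx_unit using ex_approximate_unit by blast
  then show ?thesis by (auto simp: trivial_limit_def)
qed

lemma eventually_unit_interval: "eventually unit_interval approx_unit"
  unfolding eventually_approx_unit by (auto intro!: exI[of _ "{}"] exI[of _ 1])

lemma unit_interval_sa: "unit_interval u \<Longrightarrow> star u = u"
  unfolding unit_interval_def by (metis emb_sel(1) emb_star pos_star)

lemma unit_interval_norm: "unit_interval u \<Longrightarrow> norm u \<le> 1"
  using pos_le_norm(2)[of "emb u" 1] by (simp add: unit_interval_def)

lemma approx_unit_left: "((\<lambda>u. u * b) \<longlongrightarrow> b) approx_unit"
proof (rule tendstoI)
  fix e :: real assume "e > 0"
  then show "eventually (\<lambda>u. dist (u * b) b < e) approx_unit"
    unfolding eventually_approx_unit dist_norm by (intro exI[of _ "{b}"] exI[of _ e]) auto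
qed

lemma approx_unit_right: "((\<lambda>u. b * u) \<longlongrightarrow> b) approx_unit"
proof -
  have "((\<lambda>u. star (u * star b)) \<longlongrightarrow> star (star b)) approx_unit"
    by (intro tendsto_star approx_unit_left)
  moreover have "eventually (\<lambda>u. star (u * star b) = b * u) approx_unit"
    using eventually_unit_interval by eventually_elim (simp add: star_mult star_star unit_interval_sa)
  ultimately show ?thesis by (simp add: star_star filterlim_cong)
qed

section \<open>Positive functionals\<close>

definition pos_functional :: "('a::c_star_algebra \<Rightarrow> complex) \<Rightarrow> bool" where
  "pos_functional f \<longleftrightarrow> clinear f \<and> (\<forall>x. 0 \<le> f (star x * x))"

lemma pos_functional_clinear: "pos_functional f \<Longrightarrow> clinear f"
  by (simp add: pos_functional_def)

lemma pos_functional_nonneg: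
  assumes "pos_functional f" shows "0 \<le> Re (f (star x * x))" "Im (f (star x * x)) = 0"
  using assms by (auto simp: pos_functional_def less_eq_complex_def)

lemma complex_functional_simps:
  fixes f :: "'a::complex_vector \<Rightarrow> complex"
  assumes "clinear f"
  shows "f (x + y) = f x + f y" "f (a *\<^sub>C x) = a * f x" "f 0 = 0" "f (- x) = - f x"
    "f (x - y) = f x - f y" "f (r *\<^sub>R x) = of_real r * f x"
  using clinear_simps[OF assms] by (auto simp: scaleC_complex_def scaleR_conv_of_real)

lemma pos_functional_herm:
  assumes f: "pos_functional f" shows "f (star x * y) = cnj (f (star y * x))"
proof -
  note [simp] = complex_functional_simps[OF pos_functional_clinear[OF f]]
  note im = pos_functional_nonneg(2)[OF f]
  have "Im (f (star x * y)) = - Im (f (star y * x))"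
    using im[of "x + y"] im[of x] im[of y] by (simp add: star_add distrib_left distrib_right)
  moreover have "Re (f (star x * y)) = Re (f (star y * x))"
    using im[of "x + \<i> *\<^sub>C y"] im[of x] im[of y]
    by (simp add: star_add star_scaleC distrib_left distrib_right left_diff_distrib
        mult_scaleC_left mult_scaleC_right)
  ultimately show ?thesis by (simp add: complex_eq_iff)
qed

lemma quadratic_nonneg_imp:
  fixes a b c :: real
  assumes nn: "\<And>s. 0 \<le> a + 2 * s * b + s\<^sup>2 * c" and "c \<ge> 0"
  shows "b\<^sup>2 \<le> a * c"
proof (cases "c = 0")
  case True
  have "b = 0"
  proof (rule ccontr)
    assume "b \<noteq> 0"
    then have "2 * (- (a + 1) / (2 * b)) * b = - (a + 1)" by simp
    then show False using nn[of "- (a + 1) / (2 * b)"] True by simp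
  qed
  then show ?thesis using True by simp
next
  case False
  with assms have "c > 0" by simp
  then show ?thesis using nn[of "- b / c"] by (simp add: power2_eq_square field_simps)
qed

lemma pos_functional_cauchy_schwarz:
  assumes f: "pos_functional f"
  shows "(cmod (f (star y * x)))\<^sup>2 \<le> Re (f (star y * y)) * Re (f (star x * x))"
proof -
  note [simp] = complex_functional_simps[OF pos_functional_clinear[OF f]]
  define p where "p = f (star y * x)"
  have h: "f (star x * y) = cnj p" by (simp add: p_def pos_functional_herm[OF f, of x y])
  have "0 \<le> Re (f (star x * x)) + 2 * s * (cmod p)\<^sup>2 + s\<^sup>2 * ((cmod p)\<^sup>2 * Re (f (star y * y)))" for s
  proof -
    \<comment> \<open>The factor p aligns the phases, so that both cross terms equal s |p|^2. The
      extra |p|^2 in the last coefficient is divided out at the end.\<close>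
    let ?z = "x + (of_real s * p) *\<^sub>C y"
    have "f (star ?z * ?z) = f (star x * x) + of_real (2 * s) * (p * cnj p) + of_real (s\<^sup>2) * (p * cnj p) * f (star y * y)"
      by (simp add: star_add star_scaleC distrib_left distrib_right mult_scaleC_left mult_scaleC_right h
          power2_eq_square flip: p_def)
    also have "p * cnj p = of_real ((cmod p)\<^sup>2)" by (simp only: complex_norm_square)
    finally show ?thesis using pos_functional_nonneg(1)[OF f, of ?z] by (simp add: mult.assoc)
  qed
  then have "((cmod p)\<^sup>2)\<^sup>2 \<le> Re (f (star x * x)) * ((cmod p)\<^sup>2 * Re (f (star y * y)))"
    by (rule quadratic_nonneg_imp) (simp add: pos_functional_nonneg[OF f])
  then have le: "(cmod p)\<^sup>2 * (cmod p)\<^sup>2 \<le> (Re (f (star y * y)) * Re (f (star x * x))) * (cmod p)\<^sup>2"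
    by (simp add: power2_eq_square mult_ac)
  show ?thesis
  proof (cases "p = 0")
    case True
    then show ?thesis using pos_functional_nonneg(1)[OF f] by (simp add: flip: p_def)
  next
    case False
    show ?thesis unfolding p_def[symmetric]
      by (rule mult_right_le_imp_le[OF le]) (use False in simp)
  qed
qed

lemma pos_functional_cauchy_schwarz_sqrt:
  assumes f: "pos_functional f"
  shows "cmod (f (star y * x)) \<le> sqrt (Re (f (star y * y))) * sqrt (Re (f (star x * x)))"
  using real_sqrt_le_mono[OF pos_functional_cauchy_schwarz[OF f, of y x]] by (simp add: real_sqrt_mult)

lemma pos_functional_add:
  "pos_functional f \<Longrightarrow> pos_functional g \<Longrightarrow> pos_functional (\<lambda>x. f x + g x)"
  by (auto simp: pos_functional_def clinear_def scaleC_complex_def algebra_simps intro: add_nonneg_nonneg)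

lemma pos_functional_pos:
  assumes "pos_functional f" "pos a" shows "0 \<le> Re (f a)" "Im (f a) = 0"
proof -
  obtain c where "pos c" "c * c = a" using pos_sqrt[OF assms(2)] by blast
  then have "a = star c * c" by (simp add: pos_star)
  then show "0 \<le> Re (f a)" "Im (f a) = 0" using pos_functional_nonneg[OF assms(1)] by auto
qed

lemma pos_functional_mult_le:
  fixes f :: "'a::{c_star_algebra,real_normed_algebra_1} \<Rightarrow> complex"
  assumes f: "pos_functional f"
  shows "Re (f (star (c * x) * (c * x))) \<le> (norm c)\<^sup>2 * Re (f (star x * x))"
proof -
  have "pos (of_real ((norm c)\<^sup>2) - star c * c)"
    by (rule pos_norm_minus) (simp_all add: star_mult star_star norm_star_mult)
  then have "0 \<le> Re (f (star x * (of_real ((norm c)\<^sup>2) - star c * c) * x))"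
    by (intro pos_functional_pos(1)[OF f] pos_conj)
  also have "star x * (of_real ((norm c)\<^sup>2) - star c * c) * x = (norm c)\<^sup>2 *\<^sub>R (star x * x) - star (c * x) * (c * x)"
    by (simp add: of_real_def star_mult algebra_simps)
  finally show ?thesis by (simp add: complex_functional_simps[OF pos_functional_clinear[OF f]])
qed

context
  fixes \<psi> :: "'b::c_star_algebra \<Rightarrow>\<^sub>L complex"
  assumes \<psi>: "pos_functional (blinfun_apply \<psi>)"
begin

lemma pos_functional_unit_interval:
  assumes u: "unit_interval u"
  shows "Re (\<psi> (star u * u)) \<le> Re (\<psi> u)" "Re (\<psi> u) \<le> norm \<psi>" "0 \<le> Re (\<psi> u)" "Im (\<psi> u) = 0"
proof -
  note [simp] = complex_functional_simps[OF pos_functional_clinear[OF \<psi>]]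
  obtain c where "star c = c" "u = star c * c"
    using u pos_emb_square[of u] by (auto simp: unit_interval_def)
  then show "0 \<le> Re (\<psi> u)" "Im (\<psi> u) = 0" using pos_functional_nonneg[OF \<psi>, of c] by auto
  have "pos (emb u * (1 - emb u))"
    using u by (intro pos_mult) (auto simp: unit_interval_def algebra_simps)
  moreover have "emb u * (1 - emb u) = emb (u - u * u)" by (simp add: emb_simps algebra_simps)
  ultimately obtain d where "star d = d" "u - u * u = star d * d"
    using pos_emb_square by metis
  then have "0 \<le> Re (\<psi> (u - u * u))" using pos_functional_nonneg(1)[OF \<psi>] by metis
  then show "Re (\<psi> (star u * u)) \<le> Re (\<psi> u)" by (simp add: unit_interval_sa[OF u])
  have "Re (\<psi> u) \<le> norm \<psi> * norm u"
    using complex_Re_le_cmod norm_blinfun order_trans by blast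
  also have "\<dots> \<le> norm \<psi>" using unit_interval_norm[OF u] by (simp add: mult_left_le)
  finally show "Re (\<psi> u) \<le> norm \<psi>" .
qed

text \<open>Hermitian symmetry is known so far on products star x * y; the approximate unit supplies
  the missing factor.\<close>

lemma pos_functional_star: "\<psi> (star b) = cnj (\<psi> b)"
proof (rule tendsto_unique[OF approx_unit_neq_bot])
  show "((\<lambda>u. \<psi> (star b * u)) \<longlongrightarrow> \<psi> (star b)) approx_unit"
    by (intro tendsto_intros approx_unit_right)
  have "((\<lambda>u. cnj (\<psi> (u * b))) \<longlongrightarrow> cnj (\<psi> b)) approx_unit"
    by (intro tendsto_intros approx_unit_left)
  moreover have "eventually (\<lambda>u. cnj (\<psi> (u * b)) = \<psi> (star b * u)) approx_unit"
    using eventually_unit_interval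
  proof eventually_elim
    case (elim u)
    then show ?case using pos_functional_herm[OF \<psi>, of b u] by (simp add: unit_interval_sa)
  qed
  ultimately show "((\<lambda>u. \<psi> (star b * u)) \<longlongrightarrow> cnj (\<psi> b)) approx_unit"
    by (rule Lim_transform_eventually)
qed

lemma pos_functional_mult_unit_interval:
  assumes u: "unit_interval u"
  shows "(cmod (\<psi> (u * b)))\<^sup>2 \<le> Re (\<psi> u) * Re (\<psi> (star b * b))"
proof -
  have "(cmod (\<psi> (u * b)))\<^sup>2 \<le> Re (\<psi> (star u * u)) * Re (\<psi> (star b * b))"
    using pos_functional_cauchy_schwarz[OF \<psi>, of u b] by (simp add: unit_interval_sa[OF u])
  also have "\<dots> \<le> Re (\<psi> u) * Re (\<psi> (star b * b))"
    by (intro mult_right_mono pos_functional_unit_interval[OF u] pos_functional_nonneg[OF \<psi>])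
  finally show ?thesis .
qed

text \<open>Cauchy-Schwarz against 1, with the approximate unit standing in for 1.\<close>

lemma pos_functional_norm_bound: "(cmod (\<psi> b))\<^sup>2 \<le> norm \<psi> * Re (\<psi> (star b * b))"
proof (rule tendsto_upperbound)
  show "((\<lambda>u. (cmod (\<psi> (u * b)))\<^sup>2) \<longlongrightarrow> (cmod (\<psi> b))\<^sup>2) approx_unit"
    by (intro tendsto_intros approx_unit_left)
  show "eventually (\<lambda>u. (cmod (\<psi> (u * b)))\<^sup>2 \<le> norm \<psi> * Re (\<psi> (star b * b))) approx_unit"
    using eventually_unit_interval
  proof eventually_elim
    case (elim u)
    show ?case
      by (rule order_trans[OF pos_functional_mult_unit_interval[OF elim]])
        (intro mult_right_mono pos_functional_unit_interval[OF elim] pos_functional_nonneg[OF \<psi>])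
  qed
qed simp

text \<open>The norm of a positive functional becomes a limit of expressions linear in it. This is
  the source of the additivity of the norm and of the value given to 1 in the unitization.\<close>

lemma pos_functional_approx_unit: "((\<lambda>u. Re (\<psi> u)) \<longlongrightarrow> norm \<psi>) approx_unit"
proof (rule order_tendstoI)
  fix a assume a: "a > norm \<psi>"
  show "eventually (\<lambda>u. Re (\<psi> u) < a) approx_unit"
    using eventually_unit_interval
    by eventually_elim (use a pos_functional_unit_interval(2) in \<open>metis le_less_trans\<close>)
next
  fix a assume a: "a < norm \<psi>"
  show "eventually (\<lambda>u. a < Re (\<psi> u)) approx_unit"
  proof (cases "a < 0")
    case True
    show ?thesis
      using eventually_unit_interval
      by eventually_elim (use True pos_functional_unit_interval(3) in \<open>metis less_le_trans\<close>)
  next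
    case False
    then have n: "norm \<psi> > 0" using a by linarith
    \<comment> \<open>The geometric mean of a and \<open>norm \<psi>\<close> lies below
      \<open>norm \<psi>\<close>, so some b exceeds it. In |\<psi>(u b)|^2 \<le> \<psi>(u) |\<psi>|
      |b|^2 the factor |\<psi>| then cancels and \<psi>(u) > a remains.\<close>
    let ?c = "sqrt (a * norm \<psi>)"
    have "\<exists>b. \<not> cmod (\<psi> b) \<le> ?c * norm b"
    proof (rule ccontr)
      assume "\<not> ?thesis"
      then have "norm \<psi> \<le> ?c" using False by (intro norm_blinfun_bound) auto
      then have "(norm \<psi>)\<^sup>2 \<le> a * norm \<psi>" using False n by (simp add: real_le_rsqrt real_sqrt_le_iff sqrt_ge_absD)
      then show False using a n by (simp add: power2_eq_square)
    qed
    then obtain b where b: "cmod (\<psi> b) > ?c * norm b" by (auto simp: not_le)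
    then have b2: "(cmod (\<psi> b))\<^sup>2 > a * norm \<psi> * (norm b)\<^sup>2"
      using power_strict_mono[OF b, of 2] False n by (simp add: power_mult_distrib)
    have "b \<noteq> 0" using b by (auto simp: blinfun.zero_right)
    have "((\<lambda>u. (cmod (\<psi> (u * b)))\<^sup>2) \<longlongrightarrow> (cmod (\<psi> b))\<^sup>2) approx_unit"
      by (intro tendsto_intros approx_unit_left)
    from order_tendstoD(1)[OF this b2] eventually_unit_interval show ?thesis
    proof eventually_elim
      case (elim u)
      have "Re (\<psi> (star b * b)) \<le> norm \<psi> * (norm b)\<^sup>2"
        by (metis complex_Re_le_cmod norm_blinfun norm_star_mult order_trans)
      then have "Re (\<psi> u) * Re (\<psi> (star b * b)) \<le> Re (\<psi> u) * (norm \<psi> * (norm b)\<^sup>2)"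
        using pos_functional_unit_interval(3)[OF elim(2)] by (rule mult_left_mono)
      then have "a * (norm \<psi> * (norm b)\<^sup>2) < Re (\<psi> u) * (norm \<psi> * (norm b)\<^sup>2)"
        using elim(1) pos_functional_mult_unit_interval[OF elim(2), of b] by (simp add: mult.assoc)
      then show ?case by (rule mult_right_less_imp_less) (use n in simp)
    qed
  qed
qed

end

lemma norm_add_pos_functional:
  fixes \<psi> \<phi> :: "'b::c_star_algebra \<Rightarrow>\<^sub>L complex"
  assumes "pos_functional \<psi>" "pos_functional \<phi>"
  shows "norm (\<psi> + \<phi>) = norm \<psi> + norm \<phi>"
proof (rule tendsto_unique[OF approx_unit_neq_bot])
  have "pos_functional (blinfun_apply (\<psi> + \<phi>))"
    using pos_functional_add[OF assms] by (simp add: blinfun.add_left[abs_def])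
  then show "((\<lambda>u. Re ((\<psi> + \<phi>) u)) \<longlongrightarrow> norm (\<psi> + \<phi>)) approx_unit"
    by (rule pos_functional_approx_unit)
  show "((\<lambda>u. Re ((\<psi> + \<phi>) u)) \<longlongrightarrow> norm \<psi> + norm \<phi>) approx_unit"
    using tendsto_add[OF pos_functional_approx_unit[OF assms(1)] pos_functional_approx_unit[OF assms(2)]]
    by (simp add: blinfun.add_left)
qed

section \<open>Extension of functionals to the unitization\<close>

text \<open>A positive extension of the same norm must take this value at 1; it is the limit of
  \<psi> along the approximate unit.\<close>

definition extend :: "('b::c_star_algebra \<Rightarrow>\<^sub>L complex) \<Rightarrow> 'b unitization \<Rightarrow> complex" where
  "extend \<psi> x = \<psi> (ipart x) + spart x * of_real (norm \<psi>)"

lemma extend_emb [simp]: "extend \<psi> (emb b) = \<psi> b"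
  by (simp add: extend_def)

lemma extend_one [simp]: "extend \<psi> 1 = of_real (norm \<psi>)"
  by (simp add: extend_def blinfun.zero_right)

text \<open>Completing the square: \<open>pos_functional_norm_bound\<close> controls the mixed
  term.\<close>

lemma pos_functional_extend:
  fixes \<psi> :: "'b::c_star_algebra \<Rightarrow>\<^sub>L complex"
  assumes \<psi>: "pos_functional \<psi>"
  shows "pos_functional (extend \<psi>)"
  unfolding pos_functional_def
proof (intro conjI allI)
  note [simp] = complex_functional_simps[OF pos_functional_clinear[OF \<psi>]]
  show "clinear (extend \<psi>)" by (simp add: clinear_def extend_def scaleC_complex_def algebra_simps)
  fix x :: "'b unitization"
  let ?b = "ipart x" and ?l = "spart x"
  have eq: "extend \<psi> (star x * x) = \<psi> (star ?b * ?b) + (?l * cnj (\<psi> ?b) + cnj (?l * cnj (\<psi> ?b))) + of_real ((cmod ?l)\<^sup>2 * norm \<psi>)"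
    unfolding of_real_mult complex_norm_square
    by (simp add: extend_def pos_functional_star[OF \<psi>] algebra_simps)
  have "cmod (?l * cnj (\<psi> ?b)) \<le> cmod ?l * sqrt (norm \<psi>) * sqrt (Re (\<psi> (star ?b * ?b)))"
    using mult_left_mono[OF real_sqrt_le_mono[OF pos_functional_norm_bound[OF \<psi>, of ?b]], of "cmod ?l"]
    by (simp add: real_sqrt_mult norm_mult mult.assoc)
  moreover have "2 * (cmod ?l * sqrt (norm \<psi>) * sqrt (Re (\<psi> (star ?b * ?b)))) \<le> (cmod ?l)\<^sup>2 * norm \<psi> + Re (\<psi> (star ?b * ?b))"
    using sum_squares_bound[of "cmod ?l * sqrt (norm \<psi>)" "sqrt (Re (\<psi> (star ?b * ?b)))"]
      pos_functional_nonneg(1)[OF \<psi>, of ?b] by (simp add: power_mult_distrib)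
  moreover have "- cmod (?l * cnj (\<psi> ?b)) \<le> Re (?l * cnj (\<psi> ?b))"
    using abs_Re_le_cmod[of "?l * cnj (\<psi> ?b)"] by linarith
  moreover have "Re (extend \<psi> (star x * x)) = Re (\<psi> (star ?b * ?b)) + 2 * Re (?l * cnj (\<psi> ?b)) + (cmod ?l)\<^sup>2 * norm \<psi>"
    unfolding eq by (simp only: plus_complex.simps complex_cnj Re_complex_of_real complex_cnj(1)) simp
  ultimately have "0 \<le> Re (extend \<psi> (star x * x))" by linarith
  moreover have "Im (extend \<psi> (star x * x)) = 0"
    unfolding eq using pos_functional_nonneg(2)[OF \<psi>, of ?b] by simp
  ultimately show "0 \<le> extend \<psi> (star x * x)" by (simp add: less_eq_complex_def)
qed

text \<open>For u in the approximate unit, x u lies in the ideal formed by the algebra and has norm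
  at most |x|. There \<psi> - \<phi> is bounded by its own norm, and its values at x u tend to the
  difference of the extensions at x. So the extension does not increase the distance of two
  states.\<close>

lemma extend_diff_bound:
  fixes \<psi> \<phi> :: "'b::c_star_algebra \<Rightarrow>\<^sub>L complex"
  assumes "pos_functional \<psi>" "pos_functional \<phi>" and eq: "norm \<psi> = norm \<phi>"
  shows "cmod (extend \<psi> x - extend \<phi> x) \<le> norm (\<psi> - \<phi>) * norm x"
proof (rule tendsto_upperbound)
  let ?b = "ipart x" and ?l = "spart x"
  have "((\<lambda>u. \<psi> (?b * u) - \<phi> (?b * u) + ?l * of_real (Re (\<psi> u) - Re (\<phi> u))) \<longlongrightarrow>
    \<psi> ?b - \<phi> ?b + ?l * of_real (norm \<psi> - norm \<phi>)) approx_unit"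
    by (intro tendsto_intros approx_unit_right pos_functional_approx_unit assms)
  then have "((\<lambda>u. \<psi> (?b * u) - \<phi> (?b * u) + ?l * of_real (Re (\<psi> u) - Re (\<phi> u))) \<longlongrightarrow>
    extend \<psi> x - extend \<phi> x) approx_unit"
    by (simp add: extend_def eq)
  then show "((\<lambda>u. cmod (\<psi> (?b * u) - \<phi> (?b * u) + ?l * of_real (Re (\<psi> u) - Re (\<phi> u)))) \<longlongrightarrow>
    cmod (extend \<psi> x - extend \<phi> x)) approx_unit"
    by (rule tendsto_norm)
  show "eventually (\<lambda>u. cmod (\<psi> (?b * u) - \<phi> (?b * u) + ?l * of_real (Re (\<psi> u) - Re (\<phi> u)))
    \<le> norm (\<psi> - \<phi>) * norm x) approx_unit"
    using eventually_unit_interval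
  proof eventually_elim
    case (elim u)
    let ?w = "ipart (x * emb u)"
    have "\<psi> u = of_real (Re (\<psi> u))" "\<phi> u = of_real (Re (\<phi> u))"
      using pos_functional_unit_interval(4)[OF assms(1) elim] pos_functional_unit_interval(4)[OF assms(2) elim]
      by (auto simp: complex_eq_iff)
    then have "\<psi> (?b * u) - \<phi> (?b * u) + ?l * of_real (Re (\<psi> u) - Re (\<phi> u)) = (\<psi> - \<phi>) ?w"
      using complex_functional_simps[OF pos_functional_clinear[OF assms(1)]]
        complex_functional_simps[OF pos_functional_clinear[OF assms(2)]]
      by (simp add: blinfun.diff_left algebra_simps)
    also have "cmod \<dots> \<le> norm (\<psi> - \<phi>) * norm ?w" by (rule norm_blinfun)
    also have "norm ?w = norm (x * emb u)"
      by (metis emb_ipart emb_sel(2) mult_zero_right norm_emb unitization_mult_sel(4))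
    also have "\<dots> \<le> norm x * 1"
      using norm_mult_ineq[of x "emb u"] mult_left_mono[OF unit_interval_norm[OF elim], of "norm x"] by simp
    finally show ?case by (simp add: mult_left_mono)
  qed
qed simp

section \<open>Domination by positive functionals\<close>

text \<open>Positive homogeneity is asked as an inequality: applied with 1/t it gives the reverse
  one, and the infima formed below then have only one direction to verify.\<close>

definition sublinear :: "('v::real_vector \<Rightarrow> real) \<Rightarrow> bool" where
  "sublinear p \<longleftrightarrow> (\<forall>x y. p (x + y) \<le> p x + p y) \<and> (\<forall>t>0. \<forall>x. p (t *\<^sub>R x) \<le> t * p x)"

lemma sublinear_simps:
  assumes "sublinear p"
  shows "p (x + y) \<le> p x + p y" "p 0 = 0" "t \<ge> 0 \<Longrightarrow> p (t *\<^sub>R x) = t * p x" "- p (- x) \<le> p x"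
proof -
  show add: "p (x + y) \<le> p x + p y" for x y using assms by (auto simp: sublinear_def)
  have sc: "t > 0 \<Longrightarrow> p (t *\<^sub>R x) \<le> t * p x" for t x using assms by (auto simp: sublinear_def)
  show 0: "p 0 = 0" using add[of 0 0] sc[of "1/2" 0] by simp
  show "t \<ge> 0 \<Longrightarrow> p (t *\<^sub>R x) = t * p x"
    using sc[of t x] sc[of "1/t" "t *\<^sub>R x"] 0 by (cases "t = 0") (auto simp: field_simps)
  show "- p (- x) \<le> p x" using add[of x "- x"] 0 by simp
qed

text \<open>Sublinear functionals that are minimal below \<open>p\<close> are linear.\<close>

lemma Hahn_Banach_sublinear:
  assumes p: "sublinear p"
  obtains g where "linear g" "\<And>x. g x \<le> (p x :: real)"
proof -
  define A where "A = {q. sublinear q \<and> (\<forall>x. q x \<le> p x)}"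
  \<comment> \<open>The order is reversed, so that Zorn's lemma delivers a minimal
    functional.\<close>
  define P where "P q q' \<longleftrightarrow> (\<forall>x. q' x \<le> q x)" for q q' :: "'a \<Rightarrow> real"
  have "\<exists>m\<in>A. \<forall>a\<in>A. P m a \<longrightarrow> a = m"
  proof (rule predicate_Zorn)
    show "partial_order_on A (relation_of P A)"
    proof (rule partial_order_on_relation_ofI)
      show "P a c" if "P a b" "P b c" for a b c
        using that order_trans unfolding P_def by blast
      show "a = b" if "P a b" "P b a" for a b
        using that by (auto simp: P_def fun_eq_iff intro: order_antisym)
    qed (simp add: P_def)
    fix C assume C: "C \<in> Chains (relation_of P A)"
    show "\<exists>u\<in>A. \<forall>a\<in>C. P a u"
    proof (cases "C = {}")
      case True
      then show ?thesis using p by (auto simp: A_def)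
    next
      case False
      have CA: "q \<in> A" if "q \<in> C" for q using C that by (auto simp: Chains_def relation_of_def)
      have lin: "P q r \<or> P r q" if "q \<in> C" "r \<in> C" for q r
        using C that by (auto simp: Chains_def relation_of_def)
      have sq: "sublinear q" and qp: "\<And>x. q x \<le> p x" if "q \<in> C" for q
        using CA[OF that] by (auto simp: A_def)
      have bd: "bdd_below ((\<lambda>q. q x) ` C)" for x
      proof (rule bdd_belowI2)
        fix q assume "q \<in> C"
        then show "- p (- x) \<le> q x" using sublinear_simps(4)[OF sq, of q x] qp[of q "- x"] by simp
      qed
      define m where "m x = (INF q\<in>C. q x)" for x
      have mle: "m x \<le> q x" if "q \<in> C" for q x unfolding m_def by (rule cINF_lower[OF bd that])
      have mge: "c \<le> m x" if "\<And>q. q \<in> C \<Longrightarrow> c \<le> q x" for c x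
        unfolding m_def using False that by (rule cINF_greatest)
      have "m (x + y) \<le> m x + m y" for x y
      proof -
        have "m (x + y) - r y \<le> m x" if r: "r \<in> C" for r
        proof (rule mge)
          fix q assume q: "q \<in> C"
          have "\<exists>s\<in>C. s x \<le> q x \<and> s y \<le> r y"
            using lin[OF q r] q r unfolding P_def by blast
          then obtain s where s: "s \<in> C" "s x \<le> q x" "s y \<le> r y" by blast
          then have "m (x + y) \<le> q x + r y"
            using mle[OF s(1), of "x + y"] sublinear_simps(1)[OF sq[OF s(1)], of x y] by simp
          then show "m (x + y) - r y \<le> q x" by simp
        qed
        then have "m (x + y) - m x \<le> m y" by (intro mge) (simp add: algebra_simps)
        then show ?thesis by simp
      qed
      moreover have "m (t *\<^sub>R x) \<le> t * m x" if t: "t > 0" for t x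
      proof -
        have "m (t *\<^sub>R x) / t \<le> m x"
        proof (rule mge)
          fix q assume q: "q \<in> C"
          show "m (t *\<^sub>R x) / t \<le> q x"
            using mle[OF q, of "t *\<^sub>R x"] sublinear_simps(3)[OF sq[OF q], of t x] t
            by (simp add: divide_le_eq mult.commute)
        qed
        then show ?thesis using t by (simp add: divide_le_eq mult.commute)
      qed
      moreover have "m x \<le> p x" for x
        using False mle qp order_trans by blast
      ultimately have "m \<in> A" by (simp add: A_def sublinear_def)
      then show ?thesis using mle by (auto simp: P_def)
    qed
  qed
  then obtain q where qA: "q \<in> A" and minA: "\<And>r. r \<in> A \<Longrightarrow> P q r \<Longrightarrow> r = q" by blast
  then have q: "sublinear q" "\<And>x. q x \<le> p x" by (auto simp: A_def)
  have min: "r = q" if "sublinear r" "\<forall>x. r x \<le> q x" for r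
  proof (rule minA)
    show "r \<in> A" using that q(2) by (auto simp: A_def intro: order_trans)
    show "P q r" using that by (simp add: P_def)
  qed
  have neg: "q (- x) \<le> - q x" for x
  proof -
    \<comment> \<open>Pushing q in the direction x gives a sublinear functional that is below q
      (take t = 0) and has r (- x) \<le> - q x (take t = 1). Minimality makes r = q, so q is
      odd.\<close>
    define r where "r y = (INF t\<in>{0..}. q (y + t *\<^sub>R x) - t * q x)" for y
    have bd: "bdd_below ((\<lambda>t. q (y + t *\<^sub>R x) - t * q x) ` {0..})" for y
    proof (rule bdd_belowI2)
      fix t :: real assume "t \<in> {0..}"
      then show "- q (- y) \<le> q (y + t *\<^sub>R x) - t * q x"
        using sublinear_simps(1)[OF q(1), of "y + t *\<^sub>R x" "- y"] sublinear_simps(3)[OF q(1), of t x] by simp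
    qed
    have rle: "r y \<le> q (y + t *\<^sub>R x) - t * q x" if "t \<ge> 0" for y t
      unfolding r_def by (rule cINF_lower[OF bd]) (use that in simp)
    have rge: "c \<le> r y" if "\<And>t. t \<ge> 0 \<Longrightarrow> c \<le> q (y + t *\<^sub>R x) - t * q x" for c y
      unfolding r_def by (rule cINF_greatest) (use that in auto)
    have "r (y + z) \<le> r y + r z" for y z
    proof -
      have "r (y + z) - (q (z + s *\<^sub>R x) - s * q x) \<le> r y" if s: "s \<ge> 0" for s
      proof (rule rge)
        fix t :: real assume t: "t \<ge> 0"
        have "r (y + z) \<le> q ((y + t *\<^sub>R x) + (z + s *\<^sub>R x)) - (t + s) * q x"
          using rle[of "t + s" "y + z"] s t by (simp add: algebra_simps)
        then show "r (y + z) - (q (z + s *\<^sub>R x) - s * q x) \<le> q (y + t *\<^sub>R x) - t * q x"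
          using sublinear_simps(1)[OF q(1), of "y + t *\<^sub>R x" "z + s *\<^sub>R x"] by (simp add: distrib_right)
      qed
      then have "r (y + z) - r y \<le> r z" by (intro rge) (simp add: algebra_simps)
      then show ?thesis by simp
    qed
    moreover have "r (c *\<^sub>R y) \<le> c * r y" if c: "c > 0" for c y
    proof -
      have "r (c *\<^sub>R y) / c \<le> r y"
      proof (rule rge)
        fix t :: real assume t: "t \<ge> 0"
        have "r (c *\<^sub>R y) \<le> q (c *\<^sub>R (y + t *\<^sub>R x)) - c * t * q x"
          using rle[of "c * t" "c *\<^sub>R y"] t c by (simp add: scaleR_add_right)
        also have "\<dots> = c * (q (y + t *\<^sub>R x) - t * q x)"
          using sublinear_simps(3)[OF q(1), of c "y + t *\<^sub>R x"] c by (simp add: algebra_simps)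
        finally show "r (c *\<^sub>R y) / c \<le> q (y + t *\<^sub>R x) - t * q x"
          using c by (simp add: divide_le_eq mult.commute)
      qed
      then show ?thesis using c by (simp add: divide_le_eq mult.commute)
    qed
    ultimately have "sublinear r" by (simp add: sublinear_def)
    moreover have "\<forall>y. r y \<le> q y" using rle[of 0] by simp
    ultimately have "r = q" by (rule min)
    then show ?thesis using rle[of 1 "- x"] sublinear_simps(2)[OF q(1)] by simp
  qed
  then have odd: "q (- x) = - q x" for x
    using sublinear_simps(4)[OF q(1), of x] neg[of x] by linarith
  show thesis
  proof (rule that)
    show "linear q"
    proof (rule linearI)
      show "q (x + y) = q x + q y" for x y
        using sublinear_simps(1)[OF q(1), of x y] sublinear_simps(1)[OF q(1), of "- x" "- y"]
          odd[of x] odd[of y] odd[of "x + y"] by simp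
      show "q (r *\<^sub>R x) = r *\<^sub>R q x" for r x
        using sublinear_simps(3)[OF q(1), of r x] sublinear_simps(3)[OF q(1), of "- r" x] odd[of "r *\<^sub>R x"]
        by (cases "r \<ge> 0") auto
    qed
  qed (rule q)
qed

text \<open>G(x) = g(Re x) + i g(Im x), where Re x and Im x are the self-adjoint parts of x; what g
  does to other elements is discarded.\<close>

lemma complexify_functional:
  fixes g :: "'a::c_star_algebra \<Rightarrow> real"
  assumes g: "linear g"
  obtains G :: "'a \<Rightarrow> complex" where "clinear G" "\<And>x. star x = x \<Longrightarrow> G x = of_real (g x)"
proof -
  define G where "G x = Complex (g ((1/2) *\<^sub>R (x + star x))) (g ((-\<i>/2) *\<^sub>C (x - star x)))" for x
  have add: "G (x + y) = G x + G y" for x y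
    by (simp add: G_def star_add complex_eq_iff scaleC_add_right scaleC_diff_right algebra_simps
        flip: linear_add[OF g])
  have scR: "G (r *\<^sub>R x) = of_real r * G x" for r x
  proof -
    have "(1/2) *\<^sub>R (r *\<^sub>R x + star (r *\<^sub>R x)) = r *\<^sub>R ((1/2) *\<^sub>R (x + star x))"
      by (simp add: star_scaleR scaleR_add_right)
    moreover have "(-\<i>/2) *\<^sub>C (r *\<^sub>R x - star (r *\<^sub>R x)) = r *\<^sub>R ((-\<i>/2) *\<^sub>C (x - star x))"
      by (simp add: star_scaleR scaleC_scaleR flip: scaleR_right_diff_distrib)
    ultimately show ?thesis unfolding G_def by (simp only: linear_scale[OF g]) (simp add: complex_eq_iff)
  qed
  have sci: "G (\<i> *\<^sub>C x) = \<i> * G x" for x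
  proof -
    have "(1/2) *\<^sub>R (\<i> *\<^sub>C x + star (\<i> *\<^sub>C x)) = - ((-\<i>/2) *\<^sub>C (x - star x))"
      by (simp add: star_scaleC scaleR_scaleC scaleC_add_right scaleC_diff_right scaleC_scaleC)
    moreover have "(-\<i>/2) *\<^sub>C (\<i> *\<^sub>C x - star (\<i> *\<^sub>C x)) = (1/2) *\<^sub>R (x + star x)"
      by (simp add: star_scaleC scaleR_scaleC scaleC_add_right scaleC_diff_right scaleC_scaleC)
    ultimately show ?thesis unfolding G_def by (simp add: complex_eq_iff linear_neg[OF g])
  qed
  have "G (a *\<^sub>C x) = a * G x" for a x
  proof -
    have "a *\<^sub>C x = Re a *\<^sub>R x + Im a *\<^sub>R (\<i> *\<^sub>C x)"
      by (simp add: scaleR_scaleC scaleC_scaleC flip: scaleC_add_left)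
        (metis complex_eq mult.commute)
    then have "G (a *\<^sub>C x) = (of_real (Re a) + of_real (Im a) * \<i>) * G x"
      by (simp add: add scR sci algebra_simps)
    also have "of_real (Re a) + of_real (Im a) * \<i> = a" by (simp add: complex_eq_iff)
    finally show ?thesis .
  qed
  then have "clinear G" by (simp add: clinear_def add scaleC_complex_def)
  moreover have "G x = of_real (g x)" if "star x = x" for x
    using that by (simp add: G_def complex_eq_iff linear_0[OF g] flip: scaleR_2)
  ultimately show thesis using that by blast
qed

text \<open>G has to lie above f and above 0 on positive elements, and below \<theta> |x|. All three
  demands are packed into p(x) = inf of \<theta> |x + k + l| - f(k) over positive k and l: a linear
  g below p satisfies them, on taking x = - k with l = 0, x = - l with k = 0, and k = l = 0. That p
  is finite is the bound on f together with the monotonicity of the norm.\<close>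

lemma ex_dominating_pos_functional:
  fixes f :: "'a::{c_star_algebra,real_normed_algebra_1} \<Rightarrow> real"
  assumes f: "linear f" and bd: "\<And>k. pos k \<Longrightarrow> f k \<le> \<theta> * norm k" and "\<theta> \<ge> 0"
  obtains G where "pos_functional G" "\<And>x. f (star x * x) \<le> Re (G (star x * x))" "Re (G 1) \<le> \<theta>"
proof -
  define D where "D = {(k::'a, l::'a). pos k \<and> pos l}"
  define F where "F x = (\<lambda>(k, l). \<theta> * norm (x + k + l) - f k)" for x
  define p where "p x = (INF kl\<in>D. F x kl)" for x
  have D: "D \<noteq> {}" by (auto simp: D_def intro: exI[of _ 0])
  have bdd: "bdd_below (F x ` D)" for x
  proof (rule bdd_belowI2)
    fix kl assume "kl \<in> D"
    then obtain k l where kl: "kl = (k, l)" "pos k" "pos l" by (auto simp: D_def)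
    have "f k \<le> \<theta> * norm k" by (rule bd) fact
    also have "\<dots> \<le> \<theta> * norm (k + l)" using kl \<open>\<theta> \<ge> 0\<close> by (intro mult_left_mono pos_norm_mono)
    also have "\<dots> \<le> \<theta> * (norm (x + k + l) + norm x)"
      using \<open>\<theta> \<ge> 0\<close> norm_triangle_ineq4[of "x + k + l" x] by (intro mult_left_mono) (auto simp: algebra_simps)
    finally show "- \<theta> * norm x \<le> F x kl" by (simp add: F_def kl algebra_simps)
  qed
  have ple: "p x \<le> \<theta> * norm (x + k + l) - f k" if "pos k" "pos l" for x k l
    using cINF_lower[OF bdd, of "(k, l)" x] that by (simp add: p_def D_def F_def)
  have pge: "c \<le> p x" if "\<And>k l. pos k \<Longrightarrow> pos l \<Longrightarrow> c \<le> \<theta> * norm (x + k + l) - f k" for c x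
    unfolding p_def by (rule cINF_greatest[OF D]) (use that in \<open>auto simp: D_def F_def\<close>)
  have "p (x + y) \<le> p x + p y" for x y
  proof -
    have "p (x + y) - (\<theta> * norm (y + k' + l') - f k') \<le> p x" if "pos k'" "pos l'" for k' l'
    proof (rule pge)
      fix k l :: 'a assume "pos k" "pos l"
      then have "p (x + y) \<le> \<theta> * norm (x + y + (k + k') + (l + l')) - f (k + k')"
        using that by (intro ple pos_add)
      also have "\<dots> \<le> \<theta> * (norm (x + k + l) + norm (y + k' + l')) - f (k + k')"
        using \<open>\<theta> \<ge> 0\<close> norm_triangle_ineq[of "x + k + l" "y + k' + l'"]
        by (intro diff_right_mono mult_left_mono) (auto simp: algebra_simps)
      finally show "p (x + y) - (\<theta> * norm (y + k' + l') - f k') \<le> \<theta> * norm (x + k + l) - f k"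
        by (simp add: linear_add[OF f] algebra_simps)
    qed
    then have "p (x + y) - p x \<le> p y" by (intro pge) (simp add: algebra_simps)
    then show ?thesis by simp
  qed
  moreover have "p (t *\<^sub>R x) \<le> t * p x" if t: "t > 0" for t x
  proof -
    have "p (t *\<^sub>R x) / t \<le> p x"
    proof (rule pge)
      fix k l :: 'a assume "pos k" "pos l"
      then have "p (t *\<^sub>R x) \<le> \<theta> * norm (t *\<^sub>R x + t *\<^sub>R k + t *\<^sub>R l) - f (t *\<^sub>R k)"
        using t by (intro ple pos_scaleR) auto
      also have "\<dots> = t * (\<theta> * norm (x + k + l) - f k)"
        using t by (simp add: linear_scale[OF f] algebra_simps flip: scaleR_add_right)
      finally show "p (t *\<^sub>R x) / t \<le> \<theta> * norm (x + k + l) - f k"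
        using t by (simp add: divide_le_eq mult.commute)
    qed
    then show ?thesis using t by (simp add: divide_le_eq mult.commute)
  qed
  ultimately have "sublinear p" by (simp add: sublinear_def)
  then obtain g where g: "linear g" "\<And>x. g x \<le> p x" by (rule Hahn_Banach_sublinear) blast
  have g_norm: "g x \<le> \<theta> * norm x" for x
    using g(2)[of x] ple[of 0 0 x] by (simp add: linear_0[OF f])
  have g_ge: "f k \<le> g k" "0 \<le> g k" if "pos k" for k
    using g(2)[of "- k"] ple[of k 0 "- k"] ple[of 0 k "- k"] that
    by (auto simp: linear_neg[OF g(1)] linear_0[OF f])
  obtain G :: "'a \<Rightarrow> complex" where G: "clinear G" "\<And>x. star x = x \<Longrightarrow> G x = of_real (g x)"
    using complexify_functional[OF g(1)] by blast
  have GG: "G (star x * x) = of_real (g (star x * x))" for x by (rule G) (simp add: star_mult star_star)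
  show thesis
  proof (rule that)
    show "pos_functional G"
      unfolding pos_functional_def using G(1) g_ge(2)[OF pos_star_mult] by (simp add: GG less_eq_complex_def)
    show "f (star x * x) \<le> Re (G (star x * x))" for x using g_ge(1)[OF pos_star_mult] by (simp add: GG)
    show "Re (G 1) \<le> \<theta>" using g_norm[of 1] by (simp add: G)
  qed
qed

text \<open>The sequence \<open>b\<close> minimises \<open>\<phi>(b\<^sup>* b) - 2 Re \<psi>(b)\<close>: in the GNS space of \<open>\<phi>\<close> it converges
  to the vector that represents \<open>\<psi>\<close>.\<close>

lemma ex_representing_sequence:
  fixes \<psi> \<phi> G :: "'a::{c_star_algebra,real_normed_algebra_1} \<Rightarrow> complex"
  assumes \<psi>: "pos_functional \<psi>" and G: "pos_functional G" and \<phi>_def: "\<And>x. \<phi> x = \<psi> x + G x"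
  obtains b :: "nat \<Rightarrow> 'a" where "\<And>x. (\<lambda>n. \<phi> (star x * b n)) \<longlonglongrightarrow> \<psi> (star x)"
    "\<And>e. e > 0 \<Longrightarrow> \<exists>N. \<forall>m\<ge>N. \<forall>n\<ge>N. Re (\<phi> (star (b n - b m) * (b n - b m))) < e"
proof -
  have \<phi>: "pos_functional \<phi>" using pos_functional_add[OF \<psi> G] by (simp add: \<phi>_def[abs_def])
  note [simp] = complex_functional_simps[OF pos_functional_clinear[OF \<phi>]]
    complex_functional_simps[OF pos_functional_clinear[OF \<psi>]]
  define q where "q x = Re (\<phi> (star x * x))" for x
  have q0: "0 \<le> q x" for x using pos_functional_nonneg[OF \<phi>] by (simp add: q_def)
  define J where "J x = q x - 2 * Re (\<psi> x)" for x
  have J_low: "- Re (\<psi> 1) \<le> J x" for x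
  proof -
    have "Re (\<psi> x) \<le> cmod (\<psi> (star 1 * x))" using complex_Re_le_cmod by simp
    also have "\<dots> \<le> sqrt (Re (\<psi> (star 1 * 1))) * sqrt (Re (\<psi> (star x * x)))"
      by (rule pos_functional_cauchy_schwarz_sqrt[OF \<psi>])
    also have "2 * \<dots> \<le> Re (\<psi> (star 1 * 1)) + Re (\<psi> (star x * x))"
      using sum_squares_bound[of "sqrt (Re (\<psi> (star 1 * 1)))" "sqrt (Re (\<psi> (star x * x)))"]
        pos_functional_nonneg(1)[OF \<psi>, of 1] pos_functional_nonneg(1)[OF \<psi>, of x] by simp
    also have "\<dots> \<le> Re (\<psi> 1) + q x"
      using pos_functional_nonneg(1)[OF G, of x] by (simp add: q_def \<phi>_def)
    finally show ?thesis by (simp add: J_def)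
  qed
  define d where "d = (INF x. J x)"
  have bdd: "bdd_below (range J)" using J_low by (rule bdd_belowI2)
  have dle: "d \<le> J x" for x unfolding d_def by (rule cINF_lower[OF bdd]) simp
  have "\<exists>x. J x < d + 1 / real (Suc n)" for n
    using cINF_less_iff[OF _ bdd, of "d + 1 / real (Suc n)"] by (simp add: d_def)
  then obtain b where b: "\<And>n. J (b n) < d + 1 / real (Suc n)" by metis
  have inv0: "(\<lambda>n. c / real (Suc n)) \<longlonglongrightarrow> 0" for c
    using LIMSEQ_Suc[OF lim_const_over_n[of c]] by simp
  \<comment> \<open>J along b n + s x is a quadratic in s that never drops below d, while J (b n) is
    within 1/(n + 1) of d; the discriminant then bounds the linear coefficient.\<close>
  have re_part: "(Re (\<phi> (star x * b n) - \<psi> (star x)))\<^sup>2 \<le> q x / real (Suc n)" for x n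
  proof -
    define c where "c = Re (\<phi> (star x * b n) - \<psi> (star x))"
    have "Re (\<phi> (star (b n) * x)) = Re (\<phi> (star x * b n))" "Re (\<psi> x) = Re (\<psi> (star x))"
      using pos_functional_herm[OF \<phi>, of x "b n"] pos_functional_herm[OF \<psi>, of 1 x] by auto
    then have "J (b n + s *\<^sub>R x) = J (b n) + 2 * s * c + s\<^sup>2 * q x" for s
      by (simp add: J_def q_def c_def star_add star_scaleR algebra_simps power2_eq_square)
    then have "0 \<le> 1 / real (Suc n) + 2 * s * c + s\<^sup>2 * q x" for s
      using dle[of "b n + s *\<^sub>R x"] b[of n] by (smt (verit))
    then have "c\<^sup>2 \<le> 1 / real (Suc n) * q x" using q0 by (rule quadratic_nonneg_imp)
    then show ?thesis by (simp add: c_def)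
  qed
  have re_lim: "(\<lambda>n. Re (\<phi> (star x * b n) - \<psi> (star x))) \<longlonglongrightarrow> 0" for x
  proof -
    have "(\<lambda>n. (Re (\<phi> (star x * b n) - \<psi> (star x)))\<^sup>2) \<longlonglongrightarrow> 0"
      by (rule Lim_null_comparison[OF _ inv0[of "q x"]]) (use re_part in \<open>auto intro!: always_eventually\<close>)
    then show ?thesis by (simp add: power_tendsto_0_iff)
  qed
  show thesis
  proof (rule that)
    fix x
    \<comment> \<open>Replacing x by i x turns the imaginary part into a real part.\<close>
    have "(\<lambda>n. Im (\<phi> (star x * b n) - \<psi> (star x))) \<longlonglongrightarrow> 0"
      using re_lim[of "\<i> *\<^sub>C x"] by (simp add: star_scaleC mult_scaleC_left)
    then have "(\<lambda>n. \<phi> (star x * b n) - \<psi> (star x)) \<longlonglongrightarrow> Complex 0 0"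
      using re_lim[of x] by (intro tendsto_complex_iff[THEN iffD2]) simp
    then show "(\<lambda>n. \<phi> (star x * b n)) \<longlonglongrightarrow> \<psi> (star x)"
      by (simp add: LIM_zero_iff flip: zero_complex.code)
  next
    fix e :: real assume e: "e > 0"
    have "(\<lambda>n. 2 / real (Suc n)) \<longlonglongrightarrow> 0" by (rule inv0)
    from order_tendstoD(2)[OF this, of "e/2"] e obtain N where N: "\<And>n. n \<ge> N \<Longrightarrow> 2 / real (Suc n) < e / 2"
      by (auto simp: eventually_sequentially)
    have "Re (\<phi> (star (b n - b m) * (b n - b m))) < e" if "m \<ge> N" "n \<ge> N" for m n
    proof -
      \<comment> \<open>Parallelogram law: the midpoint also has J \<ge> d, so two near-minimisers
        are close.\<close>
      have "q (b n - b m) = 2 * J (b n) + 2 * J (b m) - 4 * J ((1/2) *\<^sub>R (b n + b m))"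
        by (simp add: J_def q_def star_add star_scaleR star_diff algebra_simps)
      also have "\<dots> < 2 * (d + 1 / real (Suc n)) + 2 * (d + 1 / real (Suc m)) - 4 * d"
        using b[of n] b[of m] dle[of "(1/2) *\<^sub>R (b n + b m)"] by simp
      also have "\<dots> < e" using N[OF that(1)] N[OF that(2)] by simp
      finally show ?thesis by (simp add: q_def)
    qed
    then show "\<exists>N. \<forall>m\<ge>N. \<forall>n\<ge>N. Re (\<phi> (star (b n - b m) * (b n - b m))) < e" by blast
  qed
qed

text \<open>A duality estimate: in its uses r is the squared seminorm of a vector y, z n the pairing
  of y with vectors within s of y, and l the limit of these pairings. One factor sqrt r
  cancels.\<close>

lemma sqrt_le_of_limit:
  fixes z :: "nat \<Rightarrow> complex"
  assumes "z \<longlonglongrightarrow> l" "\<And>n. n \<ge> N \<Longrightarrow> cmod (z n - of_real r) \<le> sqrt r * s" "cmod l \<le> sqrt r * t" "0 \<le> r" "0 \<le> s" "0 \<le> t"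
  shows "sqrt r \<le> s + t"
proof (cases "r = 0")
  case False
  have "cmod (l - of_real r) \<le> sqrt r * s"
    by (rule LIMSEQ_le_const2[of "\<lambda>n. cmod (z n - of_real r)"]) (use assms in \<open>auto intro!: tendsto_intros\<close>)
  then have "r \<le> sqrt r * s + sqrt r * t"
    using assms(3,4) norm_triangle_ineq2[of "of_real r" l] by (simp add: norm_minus_commute)
  then have "sqrt r * sqrt r \<le> sqrt r * (s + t)" using assms(4) by (simp add: algebra_simps)
  then show ?thesis by (rule mult_left_le_imp_le) (use False assms(4) in simp)
qed (use assms in simp)

text \<open>v stands for a contraction from the GNS space of \<psi> + G, b tends there to the
  projection of the cyclic vector of \<psi>, and \<Phi> is the image of the limit. It is used twice:
  with \<omega> \<le> \<psi> + G for the basic estimate, and with \<omega> = f + g for the purity of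
  vector states.\<close>

lemma ex_dominated_vector:
  fixes \<psi> G :: "'a::{c_star_algebra,real_normed_algebra_1} \<Rightarrow> complex"
    and v :: "'a \<Rightarrow> 'h::banach"
  assumes \<psi>: "pos_functional \<psi>" and G: "pos_functional G"
    and v: "\<And>x y. v (x - y) = v x - v y"
    and bd: "\<And>x. (norm (v x))\<^sup>2 \<le> Re (\<psi> (star x * x) + G (star x * x))"
  obtains \<Phi> b where "(\<lambda>n. v (b n)) \<longlonglongrightarrow> \<Phi>" "norm (v 1 - \<Phi>) \<le> sqrt (Re (G 1))"
    "\<And>c y. (\<lambda>n. v (c * b n)) \<longlonglongrightarrow> y \<Longrightarrow> norm y \<le> sqrt (Re (\<psi> (star c * c)))"
    "\<And>x. (\<lambda>n. \<psi> (star x * b n) + G (star x * b n)) \<longlonglongrightarrow> \<psi> (star x)"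
proof -
  define \<phi> where "\<phi> x = \<psi> x + G x" for x
  have \<phi>: "pos_functional \<phi>" using pos_functional_add[OF \<psi> G] by (simp add: \<phi>_def[abs_def])
  note [simp] = complex_functional_simps[OF pos_functional_clinear[OF \<phi>]]
  define q where "q x = Re (\<phi> (star x * x))" for x
  have q0: "0 \<le> q x" for x using pos_functional_nonneg[OF \<phi>] by (simp add: q_def)
  have qv: "norm (v x) \<le> sqrt (q x)" for x
    using real_sqrt_le_mono[OF bd[of x]] by (simp add: q_def \<phi>_def)
  have qc: "\<phi> (star x * x) = of_real (q x)" for x
    using pos_functional_nonneg[OF \<phi>, of x] by (simp add: q_def complex_eq_iff)
  have \<psi>q: "Re (\<psi> (star x * x)) \<le> q x" "Re (G (star x * x)) \<le> q x" for x
    using pos_functional_nonneg(1)[OF G, of x] pos_functional_nonneg(1)[OF \<psi>, of x] by (simp_all add: q_def \<phi>_def)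
  obtain b where lim: "\<And>x. (\<lambda>n. \<phi> (star x * b n)) \<longlonglongrightarrow> \<psi> (star x)"
    and Cau: "\<And>e. e > 0 \<Longrightarrow> \<exists>N. \<forall>m\<ge>N. \<forall>n\<ge>N. q (b n - b m) < e"
    using ex_representing_sequence[OF \<psi> G, of \<phi>] unfolding q_def \<phi>_def by blast
  have Cau2: "\<exists>N. \<forall>m\<ge>N. \<forall>n\<ge>N. sqrt (q (b n - b m)) < e" if "e > 0" for e
    using Cau[of "e\<^sup>2"] that by (metis real_sqrt_less_iff real_sqrt_abs abs_of_pos zero_less_power)
  have "Cauchy (\<lambda>n. v (b n))"
    unfolding Cauchy_def dist_norm
  proof (intro allI impI)
    fix e :: real assume "e > 0"
    from Cau2[OF this] show "\<exists>M. \<forall>m\<ge>M. \<forall>n\<ge>M. norm (v (b m) - v (b n)) < e"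
      using qv by (metis le_less_trans v)
  qed
  then obtain \<Phi> where \<Phi>: "(\<lambda>n. v (b n)) \<longlonglongrightarrow> \<Phi>" using Cauchy_convergent_iff convergent_def by blast
  show thesis
  proof (rule that[of b \<Phi>])
    show "(\<lambda>n. v (b n)) \<longlonglongrightarrow> \<Phi>" by (rule \<Phi>)
    show "(\<lambda>n. \<psi> (star x * b n) + G (star x * b n)) \<longlonglongrightarrow> \<psi> (star x)" for x
      using lim[of x] by (simp add: \<phi>_def)
    show "norm (v 1 - \<Phi>) \<le> sqrt (Re (G 1))"
    proof (rule field_le_epsilon)
      fix e :: real assume "e > 0"
      then obtain N where N: "\<And>m n. m \<ge> N \<Longrightarrow> n \<ge> N \<Longrightarrow> sqrt (q (b n - b m)) < e" using Cau2 by blast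
      have "norm (v 1 - v (b m)) \<le> e + sqrt (Re (G 1))" if m: "m \<ge> N" for m
      proof -
        \<comment> \<open>The pairing of 1 - b m with 1 - b n tends to \<phi> - \<psi> = G at
          \<open>star ?y\<close>, which Cauchy-Schwarz for G bounds through sqrt(G 1).\<close>
        let ?y = "1 - b m"
        have "(\<lambda>n. \<phi> (star ?y) - \<phi> (star ?y * b n)) \<longlonglongrightarrow> \<phi> (star ?y) - \<psi> (star ?y)"
          by (intro tendsto_intros lim)
        then have "(\<lambda>n. \<phi> (star ?y * (1 - b n))) \<longlonglongrightarrow> G (star ?y)"
        proof (rule back_subst[where P="\<lambda>f. f \<longlonglongrightarrow> _", OF back_subst[where P="\<lambda>l. _ \<longlonglongrightarrow> l"]])
          show "\<phi> (star ?y) - \<psi> (star ?y) = G (star ?y)" by (simp add: \<phi>_def)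
        qed (simp add: right_diff_distrib)
        moreover have "cmod (\<phi> (star ?y * (1 - b n)) - of_real (q ?y)) \<le> sqrt (q ?y) * e" if "n \<ge> N" for n
        proof -
          have "\<phi> (star ?y * (1 - b n)) - of_real (q ?y) = \<phi> (star ?y * (b m - b n))"
            unfolding qc[symmetric] by (simp flip: complex_functional_simps(5)[OF pos_functional_clinear[OF \<phi>]] right_diff_distrib)
          also have "cmod \<dots> \<le> sqrt (q ?y) * sqrt (q (b m - b n))"
            unfolding q_def by (rule pos_functional_cauchy_schwarz_sqrt[OF \<phi>])
          also have "\<dots> \<le> sqrt (q ?y) * e" using N[OF that m] q0 by (intro mult_left_mono) auto
          finally show ?thesis .
        qed
        moreover have "cmod (G (star ?y)) \<le> sqrt (q ?y) * sqrt (Re (G 1))"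
        proof -
          have "cmod (G (star ?y * 1)) \<le> sqrt (Re (G (star ?y * ?y))) * sqrt (Re (G (star 1 * 1)))"
            by (rule pos_functional_cauchy_schwarz_sqrt[OF G])
          also have "\<dots> \<le> sqrt (q ?y) * sqrt (Re (G 1))"
            using \<psi>q pos_functional_nonneg(1)[OF G, of 1] by (simp add: mult_right_mono)
          finally show ?thesis by simp
        qed
        ultimately have "sqrt (q ?y) \<le> e + sqrt (Re (G 1))"
          using \<open>e > 0\<close> q0 pos_functional_nonneg(1)[OF G, of 1] by (intro sqrt_le_of_limit) auto
        then show ?thesis using qv[of ?y] by (simp add: v)
      qed
      then show "norm (v 1 - \<Phi>) \<le> sqrt (Re (G 1)) + e"
        by (intro LIMSEQ_le_const2[of "\<lambda>m. norm (v 1 - v (b m))"])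
          (auto intro!: tendsto_intros \<Phi> simp: add.commute)
    qed
    fix c y assume y: "(\<lambda>n. v (c * b n)) \<longlonglongrightarrow> y"
    show "norm y \<le> sqrt (Re (\<psi> (star c * c)))"
    proof (rule field_le_epsilon)
      fix e0 :: real assume "e0 > 0"
      \<comment> \<open>The 1 in the denominator covers c = 0.\<close>
      define e where "e = e0 / (norm c + 1)"
      have e: "e > 0" "norm c * e \<le> e0"
        using \<open>e0 > 0\<close> by (auto simp: e_def add_nonneg_pos divide_simps intro: mult_left_mono)
      then obtain N where N: "\<And>m n. m \<ge> N \<Longrightarrow> n \<ge> N \<Longrightarrow> sqrt (q (b n - b m)) < e" using Cau2 by blast
      have "norm (v (c * b m)) \<le> e0 + sqrt (Re (\<psi> (star c * c)))" if m: "m \<ge> N" for m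
      proof -
        let ?y = "c * b m"
        have eq: "star ?y * (c * x) = star (star c * c * b m) * x" for x
          by (simp add: star_mult star_star mult.assoc)
        \<comment> \<open>Moving c to the left argument makes the limit of b applicable; this stands
          for commuting the projection with c.\<close>
        have "(\<lambda>n. \<phi> (star ?y * (c * b n))) \<longlonglongrightarrow> \<psi> (star ?y * c)"
          using lim[of "star c * c * b m"] by (simp add: star_mult star_star mult.assoc)
        moreover have "cmod (\<phi> (star ?y * (c * b n)) - of_real (q ?y)) \<le> sqrt (q ?y) * e0" if "n \<ge> N" for n
        proof -
          have "\<phi> (star ?y * (c * b n)) - of_real (q ?y) = \<phi> (star ?y * (c * (b n - b m)))"
            unfolding qc[symmetric] by (simp add: right_diff_distrib mult.assoc)
          also have "cmod \<dots> \<le> sqrt (q ?y) * sqrt (q (c * (b n - b m)))"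
            unfolding q_def by (rule pos_functional_cauchy_schwarz_sqrt[OF \<phi>])
          also have "sqrt (q (c * (b n - b m))) \<le> norm c * sqrt (q (b n - b m))"
            using real_sqrt_le_mono[OF pos_functional_mult_le[OF \<phi>, of c "b n - b m"]]
            by (simp add: q_def real_sqrt_mult)
          also have "\<dots> \<le> norm c * e" using N[OF m that] by (intro mult_left_mono) auto
          also have "\<dots> \<le> e0" by (rule e)
          finally show ?thesis using q0 by (simp add: mult_left_mono)
        qed
        moreover have "cmod (\<psi> (star ?y * c)) \<le> sqrt (q ?y) * sqrt (Re (\<psi> (star c * c)))"
        proof -
          have "cmod (\<psi> (star ?y * c)) \<le> sqrt (Re (\<psi> (star ?y * ?y))) * sqrt (Re (\<psi> (star c * c)))"
            by (rule pos_functional_cauchy_schwarz_sqrt[OF \<psi>])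
          also have "\<dots> \<le> sqrt (q ?y) * sqrt (Re (\<psi> (star c * c)))"
            using \<psi>q pos_functional_nonneg(1)[OF \<psi>, of c] by (simp add: mult_right_mono)
          finally show ?thesis by simp
        qed
        ultimately have "sqrt (q ?y) \<le> e0 + sqrt (Re (\<psi> (star c * c)))"
          using \<open>e0 > 0\<close> q0 pos_functional_nonneg(1)[OF \<psi>, of c] by (intro sqrt_le_of_limit) auto
        then show ?thesis using qv[of ?y] by simp
      qed
      then show "norm y \<le> sqrt (Re (\<psi> (star c * c))) + e0"
        by (intro LIMSEQ_le_const2[of "\<lambda>m. norm (v (c * b m))"])
          (auto intro!: tendsto_intros y simp: add.commute)
    qed
  qed
qed

section \<open>Complex Hilbert spaces\<close>

lemma norm_scaleC_hilbert: "norm (a *\<^sub>C x) = cmod a * norm (x::'h::complex_hilbert_space)"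
proof -
  have "complex_of_real ((norm (a *\<^sub>C x))\<^sup>2) = cnj a * a * complex_of_real ((norm x)\<^sup>2)"
    unfolding cinner_self[symmetric] by (simp add: cinner_scaleC_left cinner_scaleC_right)
  also have "cnj a * a = complex_of_real ((cmod a)\<^sup>2)"
    by (simp only: complex_norm_square mult.commute)
  finally have "complex_of_real ((norm (a *\<^sub>C x))\<^sup>2) = complex_of_real ((cmod a * norm x)\<^sup>2)"
    by (simp add: power_mult_distrib)
  then have "(norm (a *\<^sub>C x))\<^sup>2 = (cmod a * norm x)\<^sup>2"
    by (simp only: of_real_eq_iff)
  then show ?thesis by (simp add: power2_eq_iff_nonneg)
qed

lemma norm_cinner_le: "cmod (cinner x y) \<le> norm x * norm (y::'h::complex_hilbert_space)"
proof (cases "cinner x y = 0")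
  case False
  define c where "c = cinner x y"
  define a where "a = c / of_real (cmod c)"
  have "cmod a = 1" using False by (simp add: a_def c_def norm_divide)
  have "cinner (a *\<^sub>C x) y = cnj c * c / of_real (cmod c)"
    by (simp add: cinner_scaleC_left a_def c_def)
  also have "cnj c * c = of_real ((cmod c)\<^sup>2)" by (simp only: complex_norm_square mult.commute)
  finally have "Re (cinner (a *\<^sub>C x) y) = cmod c"
    using False by (simp add: c_def power2_eq_square)
  then have "cmod c = inner (a *\<^sub>C x) y" by (simp add: inner_eq_Re_cinner)
  also have "\<dots> \<le> norm (a *\<^sub>C x) * norm y" by (rule norm_cauchy_schwarz)
  finally show ?thesis using \<open>cmod a = 1\<close> by (simp add: c_def norm_scaleC_hilbert)
qed simp

lemma cinner_add_left: "cinner (x + y) z = cinner x z + cinner y (z::'h::complex_hilbert_space)"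
  by (metis cinner_add_right cinner_commute complex_cnj_add)

lemma bounded_bilinear_cinner: "bounded_bilinear (cinner :: 'h::complex_hilbert_space \<Rightarrow> _)"
proof
  show "\<exists>K. \<forall>a b. cmod (cinner a b) \<le> norm (a::'h) * norm b * K"
    using norm_cinner_le by (auto intro!: exI[of _ 1])
qed (simp_all add: cinner_add_left cinner_add_right scaleR_scaleC cinner_scaleC_left cinner_scaleC_right scaleC_complex_def)

interpretation cinner: bounded_bilinear "cinner :: 'h::complex_hilbert_space \<Rightarrow> _"
  by (rule bounded_bilinear_cinner)

lemmas cinner_simps = cinner.add_left cinner.add_right cinner.diff_left cinner.diff_right
  cinner.minus_left cinner.minus_right cinner_scaleC_left cinner_scaleC_right

lemma norm_sq_cinner: "(norm x)\<^sup>2 = Re (cinner x (x::'h::complex_hilbert_space))"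
  by (simp add: cinner_self)

lemma bounded_linear_scaleC_hilbert: "bounded_linear (\<lambda>x::'h::complex_hilbert_space. a *\<^sub>C x)"
  by (rule bounded_linear_intro[of _ "cmod a"])
    (simp_all add: scaleC_add_right scaleC_scaleR norm_scaleC_hilbert mult.commute)

lemma bounded_bilinear_scaleC:
  "bounded_bilinear (scaleC :: complex \<Rightarrow> 'h::complex_hilbert_space \<Rightarrow> 'h)"
proof
  show "\<exists>K. \<forall>a b. norm (a *\<^sub>C (b::'h)) \<le> norm a * norm b * K"
    by (auto intro!: exI[of _ 1] simp: norm_scaleC_hilbert)
qed (simp_all add: scaleC_add_left scaleC_add_right scaleC_scaleR scaleR_scaleC scaleC_scaleC scaleC_complex_def mult.commute)

interpretation scaleC_hilbert: bounded_bilinear "scaleC :: complex \<Rightarrow> 'h::complex_hilbert_space \<Rightarrow> 'h"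
  by (rule bounded_bilinear_scaleC)

lemma closure_range_sequential:
  fixes \<xi> :: "'v \<Rightarrow> 'h::metric_space"
  shows "x \<in> closure (range \<xi>) \<longleftrightarrow> (\<exists>a. (\<lambda>n. \<xi> (a n)) \<longlonglongrightarrow> x)"
proof
  assume "x \<in> closure (range \<xi>)"
  then obtain y where y: "\<And>n. y n \<in> range \<xi>" "y \<longlonglongrightarrow> x"
    using closure_sequential[of x "range \<xi>"] by auto
  have "\<forall>n. \<exists>a. y n = \<xi> a" using y(1) by auto
  then obtain a where "\<forall>n. y n = \<xi> (a n)" by metis
  then have "y = (\<lambda>n. \<xi> (a n))" by auto
  with y(2) show "\<exists>a. (\<lambda>n. \<xi> (a n)) \<longlonglongrightarrow> x" by auto
next
  assume "\<exists>a. (\<lambda>n. \<xi> (a n)) \<longlonglongrightarrow> x"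
  then obtain a where "(\<lambda>n. \<xi> (a n)) \<longlonglongrightarrow> x" by blast
  then show "x \<in> closure (range \<xi>)"
    unfolding closure_sequential by (intro exI[of _ "\<lambda>n. \<xi> (a n)"]) auto
qed

lemma dense_range_sequence:
  fixes \<xi> :: "'v \<Rightarrow> 'h::metric_space"
  assumes "closure (range \<xi>) = UNIV"
  obtains a where "(\<lambda>n. \<xi> (a n)) \<longlonglongrightarrow> x"
  using assms closure_range_sequential[of x \<xi>] by auto

text \<open>Extension by uniform continuity. The choice of preimages made by
  \<open>inv \<xi>\<close> is harmless, because the bound by C makes \<eta> constant on the fibres
  of \<xi>.\<close>

lemma ex_dense_extension:
  fixes \<xi> :: "'v::complex_vector \<Rightarrow> 'h::complex_hilbert_space"
    and \<eta> :: "'v \<Rightarrow> 'k::complex_hilbert_space"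
  assumes \<xi>: "clinear \<xi>" and \<eta>: "clinear \<eta>" and C: "\<And>v. norm (\<eta> v) \<le> C * norm (\<xi> v)"
    and dense: "closure (range \<xi>) = UNIV"
  obtains T :: "'h \<Rightarrow>\<^sub>L 'k" where "clinear (blinfun_apply T)" "\<And>v. T (\<xi> v) = \<eta> v"
proof -
  define f where "f x = \<eta> (inv \<xi> x)" for x
  have f\<xi>: "f (\<xi> v) = \<eta> v" for v
  proof -
    have "\<xi> (inv \<xi> (\<xi> v)) = \<xi> v" by (simp add: f_inv_into_f)
    then have "norm (\<eta> (inv \<xi> (\<xi> v) - v)) \<le> 0"
      using C[of "inv \<xi> (\<xi> v) - v"] by (simp add: clinear_simps[OF \<xi>])
    then show ?thesis by (simp add: f_def clinear_simps[OF \<eta>])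
  qed
  \<comment> \<open>The constant |C| + 1 is positive, so that e can be divided by it.\<close>
  have lip: "norm (f x - f y) \<le> (\<bar>C\<bar> + 1) * norm (x - y)" if xr: "x \<in> range \<xi>" and yr: "y \<in> range \<xi>" for x y
  proof -
    obtain v where v: "x = \<xi> v" using xr by (rule rangeE)
    obtain w where w: "y = \<xi> w" using yr by (rule rangeE)
    have "norm (\<eta> (v - w)) \<le> C * norm (\<xi> (v - w))" by (rule C)
    also have "\<dots> \<le> (\<bar>C\<bar> + 1) * norm (\<xi> (v - w))" by (rule mult_right_mono) auto
    finally show ?thesis by (simp add: v w f\<xi> clinear_simps[OF \<xi>] clinear_simps[OF \<eta>])
  qed
  have "uniformly_continuous_on (range \<xi>) f"
    unfolding uniformly_continuous_on_def dist_norm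
  proof (intro allI impI)
    fix e :: real assume "e > 0"
    show "\<exists>d>0. \<forall>x\<in>range \<xi>. \<forall>x'\<in>range \<xi>. norm (x' - x) < d \<longrightarrow> norm (f x' - f x) < e"
    proof (intro exI[of _ "e / (\<bar>C\<bar> + 1)"] conjI ballI impI)
      fix x x' assume x: "x \<in> range \<xi>" "x' \<in> range \<xi>" "norm (x' - x) < e / (\<bar>C\<bar> + 1)"
      have "norm (f x' - f x) \<le> (\<bar>C\<bar> + 1) * norm (x' - x)" using lip x by blast
      also have "\<dots> < e" using x(3) by (simp add: pos_less_divide_eq add_nonneg_pos mult.commute)
      finally show "norm (f x' - f x) < e" .
    qed (use \<open>e > 0\<close> in \<open>simp add: add_nonneg_pos\<close>)
  qed
  then obtain g where g: "uniformly_continuous_on (closure (range \<xi>)) g" "\<And>x. x \<in> range \<xi> \<Longrightarrow> f x = g x"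
    by (rule uniformly_continuous_on_extension_on_closure) blast
  have cont: "continuous_on UNIV g" using g(1) dense uniformly_continuous_imp_continuous by metis
  have lim: "(\<lambda>n. g (x n)) \<longlonglongrightarrow> g l" if "x \<longlonglongrightarrow> l" for x l
    using continuous_on_tendsto_compose[OF cont that] by simp
  have g\<xi>: "g (\<xi> v) = \<eta> v" for v using g(2)[of "\<xi> v"] f\<xi> by simp
  have add: "g (x + y) = g x + g y" for x y
  proof -
    obtain a b where a: "(\<lambda>n. \<xi> (a n)) \<longlonglongrightarrow> x" and b: "(\<lambda>n. \<xi> (b n)) \<longlonglongrightarrow> y"
      using dense_range_sequence[OF dense] by metis
    have "(\<lambda>n. g (\<xi> (a n) + \<xi> (b n))) \<longlonglongrightarrow> g (x + y)" by (intro lim tendsto_add a b)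
    moreover have "(\<lambda>n. g (\<xi> (a n)) + g (\<xi> (b n))) \<longlonglongrightarrow> g x + g y" by (intro lim tendsto_add a b)
    moreover have "g (\<xi> (a n) + \<xi> (b n)) = g (\<xi> (a n)) + g (\<xi> (b n))" for n
      using g\<xi>[of "a n + b n"] by (simp add: g\<xi> clinear_simps[OF \<xi>] clinear_simps[OF \<eta>])
    ultimately show ?thesis by (simp add: LIMSEQ_unique)
  qed
  have scale: "g (c *\<^sub>C x) = c *\<^sub>C g x" for c x
  proof -
    obtain a where a: "(\<lambda>n. \<xi> (a n)) \<longlonglongrightarrow> x" using dense_range_sequence[OF dense] by metis
    have "(\<lambda>n. g (c *\<^sub>C \<xi> (a n))) \<longlonglongrightarrow> g (c *\<^sub>C x)"
      by (intro lim bounded_linear.tendsto[OF bounded_linear_scaleC_hilbert] a)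
    moreover have "(\<lambda>n. c *\<^sub>C g (\<xi> (a n))) \<longlonglongrightarrow> c *\<^sub>C g x"
      by (intro lim bounded_linear.tendsto[OF bounded_linear_scaleC_hilbert] a)
    moreover have "g (c *\<^sub>C \<xi> (a n)) = c *\<^sub>C g (\<xi> (a n))" for n
      using g\<xi>[of "c *\<^sub>C a n"] by (simp add: g\<xi> clinear_simps[OF \<xi>] clinear_simps[OF \<eta>])
    ultimately show ?thesis by (simp add: LIMSEQ_unique)
  qed
  have bd: "norm (g x) \<le> norm x * C" for x
  proof -
    obtain a where a: "(\<lambda>n. \<xi> (a n)) \<longlonglongrightarrow> x" using dense_range_sequence[OF dense] by metis
    show ?thesis
    proof (rule LIMSEQ_le)
      show "(\<lambda>n. norm (g (\<xi> (a n)))) \<longlonglongrightarrow> norm (g x)" by (intro tendsto_norm lim a)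
      show "(\<lambda>n. norm (\<xi> (a n)) * C) \<longlonglongrightarrow> norm x * C" by (intro tendsto_intros a)
      show "\<exists>N. \<forall>n\<ge>N. norm (g (\<xi> (a n))) \<le> norm (\<xi> (a n)) * C" using C by (simp add: g\<xi> mult.commute)
    qed
  qed
  have "clinear g" by (simp add: clinear_def add scale)
  then have "bounded_linear g"
    by (intro bounded_linear_intro[of _ C]) (auto simp: clinear_simps bd)
  then have "blinfun_apply (Blinfun g) = g" by (simp add: bounded_linear_Blinfun_apply)
  then show thesis using that[of "Blinfun g"] \<open>clinear g\<close> g\<xi> by simp
qed

lemma dense_range_eqI:
  fixes \<xi> :: "'v \<Rightarrow> 'h::metric_space" and f g :: "'h \<Rightarrow> 'k::t2_space"
  assumes dense: "closure (range \<xi>) = UNIV" and "continuous_on UNIV f" "continuous_on UNIV g"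
    and eq: "\<And>v. f (\<xi> v) = g (\<xi> v)"
  shows "f x = g x"
proof -
  obtain a where a: "(\<lambda>n. \<xi> (a n)) \<longlonglongrightarrow> x" using dense_range_sequence[OF dense] by metis
  have "(\<lambda>n. f (\<xi> (a n))) \<longlonglongrightarrow> f x" "(\<lambda>n. g (\<xi> (a n))) \<longlonglongrightarrow> g x"
    using continuous_on_tendsto_compose[OF assms(2) a] continuous_on_tendsto_compose[OF assms(3) a] by auto
  then show ?thesis by (simp add: eq LIMSEQ_unique)
qed

section \<open>Irreducible representations\<close>

lemma representationD:
  assumes "representation \<pi>"
  shows "clinear (blinfun_apply (\<pi> B))" "\<pi> (A + B) = \<pi> A + \<pi> B" "\<pi> (a *\<^sub>C B) x = a *\<^sub>C \<pi> B x"
    "\<pi> (A * B) x = \<pi> A (\<pi> B x)" "cinner (\<pi> (star B) x) y = cinner x (\<pi> B y)"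
    "cinner (\<pi> B x) y = cinner x (\<pi> (star B) y)"
  using assms by (auto simp: representation_def) (metis star_star)

lemma representation_vec_clinear:
  assumes "representation \<pi>" shows "clinear (\<lambda>B. \<pi> B x)"
  using representationD[OF assms] by (simp add: clinear_def blinfun.add_left)

text \<open>For |B| \<le> 1 take Y with 2 Y = B* B + Y^2; informally, 1 - B* B is the square of 1 -
  Y. Then |x|^2 - |\<pi>(B) x|^2 = |x - \<pi>(Y) x|^2 \<ge> 0.\<close>

lemma representation_norm_le:
  assumes \<pi>: "representation \<pi>"
  shows "norm (\<pi> B x) \<le> norm B * norm x"
proof -
  note [simp] = representationD(4)[OF \<pi>] clinear_simps[OF representation_vec_clinear[OF \<pi>]]
  have 1: "norm (\<pi> B x) \<le> norm x" if "norm B \<le> 1" for B x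
  proof -
    have "norm (star B * B) \<le> 1" using that by (simp add: norm_star_mult power_le_one)
    moreover have "star (star B * B) = star B * B" by (simp add: star_mult star_star)
    ultimately obtain Y where Y: "2 *\<^sub>R Y = star B * B + Y * Y" "star Y = Y"
      by (rule sqrt_in_c_star_algebra) blast
    have sa: "cinner (\<pi> Y x) y = cinner x (\<pi> Y y)" for x y
      using representationD(6)[OF \<pi>, of Y] by (simp add: Y)
    have "\<pi> (2 *\<^sub>R Y) x = \<pi> (star B * B + Y * Y) x" by (simp only: Y(1))
    then have "cinner x (2 *\<^sub>R \<pi> Y x) = cinner x (\<pi> (star B) (\<pi> B x)) + cinner x (\<pi> Y (\<pi> Y x))"
      by (simp add: cinner.add_right)
    also have "\<dots> = cinner (\<pi> B x) (\<pi> B x) + cinner (\<pi> Y x) (\<pi> Y x)"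
      using representationD(6)[OF \<pi>, of B] by (simp add: sa)
    finally have "2 * Re (cinner x (\<pi> Y x)) = (norm (\<pi> B x))\<^sup>2 + (norm (\<pi> Y x))\<^sup>2"
      unfolding norm_sq_cinner by (simp only: cinner.scaleR_right plus_complex.simps flip: scaleR_complex.simps)
    moreover have "(norm (x - \<pi> Y x))\<^sup>2 = (norm x)\<^sup>2 - 2 * Re (cinner x (\<pi> Y x)) + (norm (\<pi> Y x))\<^sup>2"
      by (simp add: norm_sq_cinner cinner_simps sa)
    moreover have "0 \<le> (norm (x - \<pi> Y x))\<^sup>2" by simp
    ultimately have "(norm (\<pi> B x))\<^sup>2 \<le> (norm x)\<^sup>2" by linarith
    then show ?thesis by (simp add: power2_le_iff_abs_le)
  qed
  show ?thesis
  proof (cases "B = 0")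
    case False
    have "norm (\<pi> ((1 / norm B) *\<^sub>R B) x) \<le> norm x" by (rule 1) (use False in simp)
    then show ?thesis using False by (simp add: field_simps)
  qed simp
qed

lemma vector_functional_bounded:
  assumes \<pi>: "representation \<pi>"
  shows "bounded_linear (\<lambda>B. cinner x (\<pi> B y))"
proof (rule bounded_linear_intro[of _ "norm x * norm y"])
  fix A B and r :: real
  show "cinner x (\<pi> (A + B) y) = cinner x (\<pi> A y) + cinner x (\<pi> B y)"
    "cinner x (\<pi> (r *\<^sub>R B) y) = r *\<^sub>R cinner x (\<pi> B y)"
    by (simp_all add: clinear_simps[OF representation_vec_clinear[OF \<pi>]] cinner.add_right cinner.scaleR_right)
  have "cmod (cinner x (\<pi> B y)) \<le> norm x * (norm B * norm y)"
    by (rule order_trans[OF norm_cinner_le mult_left_mono[OF representation_norm_le[OF \<pi>]]]) simp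
  then show "cmod (cinner x (\<pi> B y)) \<le> norm B * (norm x * norm y)" by (simp add: mult_ac)
qed

lemma vector_state_apply:
  "representation \<pi> \<Longrightarrow> vector_state \<pi> x B = cinner x (\<pi> B x)"
  by (simp add: vector_state_def bounded_linear_Blinfun_apply vector_functional_bounded)

lemma irreducible_representation: "nonzero_irreducible_rep \<pi> \<Longrightarrow> representation \<pi>"
  by (simp add: nonzero_irreducible_rep_def)

lemma irreducible_subspace:
  assumes "nonzero_irreducible_rep \<pi>" "closed_csubspace S" "\<And>B x. x \<in> S \<Longrightarrow> \<pi> B x \<in> S"
  shows "S = {0} \<or> S = UNIV"
  using assms by (auto simp: nonzero_irreducible_rep_def)

lemma irreducible_dense:
  fixes \<pi> :: "'b::c_star_algebra \<Rightarrow> ('h::complex_hilbert_space \<Rightarrow>\<^sub>L 'h)"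
  assumes irr: "nonzero_irreducible_rep \<pi>" and "\<Omega> \<noteq> 0"
  shows "closure (range (\<lambda>B. \<pi> B \<Omega>)) = UNIV"
proof -
  have \<pi>: "representation \<pi>" using irr by (rule irreducible_representation)
  note lin = clinear_simps[OF representation_vec_clinear[OF \<pi>]]
    and lin' = clinear_simps[OF representationD(1)[OF \<pi>]]
  \<comment> \<open>The orbit closure might still be {0}. That is ruled out by the common kernel, an
    invariant subspace which is not everything because \<pi> is not zero.\<close>
  let ?K = "{x. \<forall>B. \<pi> B x = 0}"
  have "?K = {0} \<or> ?K = UNIV"
  proof (rule irreducible_subspace[OF irr])
    have "?K = (\<Inter>B. {x. \<pi> B x = 0})" by auto
    moreover have "closed {x. \<pi> B x = 0}" for B
      by (intro closed_Collect_eq continuous_intros)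
    ultimately have "closed ?K" by auto
    then show "closed_csubspace ?K" by (auto simp: closed_csubspace_def lin')
    show "\<pi> B x \<in> ?K" if "x \<in> ?K" for B x using that by (auto simp: lin')
  qed
  moreover have "?K \<noteq> UNIV"
  proof
    assume K: "?K = UNIV"
    have "\<pi> B = 0" for B by (rule blinfun_eqI) (use K in auto)
    then show False using irr by (simp add: nonzero_irreducible_rep_def)
  qed
  ultimately obtain B0 where B0: "\<pi> B0 \<Omega> \<noteq> 0" using \<open>\<Omega> \<noteq> 0\<close> by auto
  let ?R = "range (\<lambda>B. \<pi> B \<Omega>)"
  note seq = closure_range_sequential[where \<xi>="\<lambda>B. \<pi> B \<Omega>"]
  have "closure ?R = {0} \<or> closure ?R = UNIV"
  proof (rule irreducible_subspace[OF irr])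
    show "closed_csubspace (closure ?R)"
      unfolding closed_csubspace_def
    proof (intro conjI ballI allI)
      show "0 \<in> closure ?R" using closure_subset[of ?R] lin(3) by (metis rangeI subsetD)
      fix x y assume "x \<in> closure ?R" "y \<in> closure ?R"
      then obtain a b where "(\<lambda>n. \<pi> (a n) \<Omega>) \<longlonglongrightarrow> x" "(\<lambda>n. \<pi> (b n) \<Omega>) \<longlonglongrightarrow> y" unfolding seq by blast
      then have "(\<lambda>n. \<pi> (a n + b n) \<Omega>) \<longlonglongrightarrow> x + y" by (simp add: lin tendsto_add)
      then show "x + y \<in> closure ?R" unfolding seq by (rule exI[of _ "\<lambda>n. a n + b n"])
    next
      fix c x assume "x \<in> closure ?R"
      then obtain a where "(\<lambda>n. \<pi> (a n) \<Omega>) \<longlonglongrightarrow> x" unfolding seq by blast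
      then have "(\<lambda>n. \<pi> (c *\<^sub>C a n) \<Omega>) \<longlonglongrightarrow> c *\<^sub>C x"
        by (simp add: lin bounded_linear.tendsto[OF bounded_linear_scaleC_hilbert])
      then show "c *\<^sub>C x \<in> closure ?R" unfolding seq by (rule exI[of _ "\<lambda>n. c *\<^sub>C a n"])
    qed simp
    fix B x assume "x \<in> closure ?R"
    then obtain a where "(\<lambda>n. \<pi> (a n) \<Omega>) \<longlonglongrightarrow> x" unfolding seq by blast
    then have "(\<lambda>n. \<pi> (B * a n) \<Omega>) \<longlonglongrightarrow> \<pi> B x"
      by (simp add: representationD(4)[OF \<pi>] blinfun.tendsto)
    then show "\<pi> B x \<in> closure ?R" unfolding seq by (rule exI[of _ "\<lambda>n. B * a n"])
  qed
  moreover have "\<pi> B0 \<Omega> \<in> closure ?R" by (rule subsetD[OF closure_subset]) (rule rangeI)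
  ultimately show ?thesis using B0 by auto
qed

section \<open>Schur's lemma\<close>

definition self_adjoint_intertwiner where
  "self_adjoint_intertwiner \<pi> S \<longleftrightarrow> clinear (blinfun_apply S) \<and> (\<forall>x y. cinner (S x) y = cinner x (S y)) \<and>
    (\<forall>B x. S (\<pi> B x) = \<pi> B (S x))"

text \<open>With \<open>R\<close> the absolute value of \<open>T = S / M\<close> one has \<open>(R - T)(R + T) = 0\<close>, and the kernel of
  \<open>R - T\<close> is an invariant subspace.\<close>

lemma self_adjoint_intertwiner_definite:
  fixes S :: "'h::complex_hilbert_space \<Rightarrow>\<^sub>L 'h"
  assumes irr: "nonzero_irreducible_rep \<pi>" and S: "self_adjoint_intertwiner \<pi> S"
  shows "(\<forall>x. 0 \<le> Re (cinner x (S x))) \<or> (\<forall>x. Re (cinner x (S x)) \<le> 0)"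
proof -
  have \<pi>: "representation \<pi>" using irr by (rule irreducible_representation)
  note lin' = clinear_simps[OF representationD(1)[OF \<pi>]]
  have S1: "clinear (blinfun_apply S)" and sa: "\<And>x y. cinner (S x) y = cinner x (S y)"
    and comm: "\<And>B x. S (\<pi> B x) = \<pi> B (S x)"
    using S by (auto simp: self_adjoint_intertwiner_def)
  \<comment> \<open>Scaling makes T a contraction, as the square root iteration requires; the 1
    covers S = 0.\<close>
  define M where "M = norm S + 1"
  have M: "M > 0" by (simp add: M_def add_nonneg_pos)
  define T where "T = (1/M) *\<^sub>R S"
  have T: "T x = (1/M) *\<^sub>R S x" for x by (simp add: T_def blinfun.scaleR_left)
  have normT: "norm (T x) \<le> norm x" for x
  proof -
    have "norm (S x) \<le> M * norm x"
      using norm_blinfun[of S x] by (simp add: M_def distrib_right add_increasing2)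
    then show ?thesis using M by (simp add: T field_simps)
  qed
  have Tsa: "cinner (T x) y = cinner x (T y)" for x y
    by (simp add: T cinner.scaleR_left cinner.scaleR_right sa)
  have Tcl: "clinear (blinfun_apply T)"
    using S1 by (auto simp: clinear_def T scaleR_add_right scaleC_scaleR)
  have Tcomm: "T (\<pi> B x) = \<pi> B (T x)" for B x by (simp add: T comm blinfun.scaleR_right)
  \<comment> \<open>With 2 Y = A + Y^2, the operator R = 1 - Y below satisfies R^2 = 1 - A =
    T^2.\<close>
  define A where "A = id_blinfun - (T o\<^sub>L T)"
  have A: "A x = x - T (T x)" for x by (simp add: A_def blinfun.diff_left)
  have "norm A \<le> 1"
  proof (rule norm_blinfun_bound)
    fix x
    have "(norm (A x))\<^sup>2 = (norm x)\<^sup>2 - 2 * (norm (T x))\<^sup>2 + (norm (T (T x)))\<^sup>2"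
      by (simp add: A norm_sq_cinner cinner_simps Tsa)
    also have "\<dots> \<le> (norm x)\<^sup>2"
    proof -
      have "(norm (T (T x)))\<^sup>2 \<le> (norm (T x))\<^sup>2" by (rule power_mono[OF normT]) simp
      moreover have "0 \<le> (norm (T x))\<^sup>2" by simp
      ultimately show ?thesis by linarith
    qed
    finally show "norm (A x) \<le> 1 * norm x" by (simp add: power2_le_iff_abs_le)
  qed simp
  have bb: "bounded_bilinear ((o\<^sub>L) :: ('h \<Rightarrow>\<^sub>L 'h) \<Rightarrow> _)" by (rule bounded_bilinear_blinfun_compose)
  obtain Y where Y: "norm Y \<le> 1" "2 *\<^sub>R Y = A + (Y o\<^sub>L Y)"
    and closed: "\<And>W. closed W \<Longrightarrow> 0 \<in> W \<Longrightarrow> (\<And>Z. Z \<in> W \<Longrightarrow> (1/2) *\<^sub>R (A + (Z o\<^sub>L Z)) \<in> W) \<Longrightarrow> Y \<in> W"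
    using sqrt_iteration[OF bb norm_blinfun_compose \<open>norm A \<le> 1\<close>] by metis
  have apply_half: "blinfun_apply ((1/2) *\<^sub>R (A + (Z o\<^sub>L Z))) = (\<lambda>x. (1/2) *\<^sub>R (A x + Z (Z x)))" for Z
    by (auto simp: blinfun.scaleR_left blinfun.add_left)
  \<comment> \<open>Whatever commutes with A commutes with Y. N is just a bounded linear map, so
    this covers multiplication by complex scalars, T and every \<pi>(B) alike.\<close>
  have Yc: "Y (N x) = N (Y x)" if N: "\<And>x. A (N x) = N (A x)" "bounded_linear N" for N x
  proof -
    have "Y \<in> (\<Inter>x. {Z :: 'h \<Rightarrow>\<^sub>L 'h. Z (N x) = N (Z x)})"
    proof (rule closed)
      have "continuous_on UNIV (\<lambda>Z :: 'h \<Rightarrow>\<^sub>L 'h. N (Z x))" for x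
        by (intro bounded_linear.continuous_on[OF N(2)] continuous_intros)
      then show "closed (\<Inter>x. {Z :: 'h \<Rightarrow>\<^sub>L 'h. Z (N x) = N (Z x)})"
        by (intro closed_INT ballI closed_Collect_eq continuous_intros)
      show "0 \<in> (\<Inter>x. {Z :: 'h \<Rightarrow>\<^sub>L 'h. Z (N x) = N (Z x)})"
        using N(2) by (auto simp: linear_0 bounded_linear.linear)
      show "(1/2) *\<^sub>R (A + (Z o\<^sub>L Z)) \<in> (\<Inter>x. {Z :: 'h \<Rightarrow>\<^sub>L 'h. Z (N x) = N (Z x)})"
        if "Z \<in> (\<Inter>x. {Z :: 'h \<Rightarrow>\<^sub>L 'h. Z (N x) = N (Z x)})" for Z
        using that N(1) by (auto simp: blinfun.scaleR_left blinfun.add_left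
            linear_scale[OF bounded_linear.linear[OF N(2)]] linear_add[OF bounded_linear.linear[OF N(2)]])
    qed
    then show ?thesis by auto
  qed
  have Ysa: "cinner (Y x) y = cinner x (Y y)" for x y
  proof -
    have "Y \<in> (\<Inter>x. \<Inter>y. {Z :: 'h \<Rightarrow>\<^sub>L 'h. cinner (Z x) y = cinner x (Z y)})"
    proof (rule closed)
      show "closed (\<Inter>x. \<Inter>y. {Z :: 'h \<Rightarrow>\<^sub>L 'h. cinner (Z x) y = cinner x (Z y)})"
        by (intro closed_INT ballI closed_Collect_eq cinner.continuous_on continuous_intros)
    qed (auto simp: apply_half cinner_simps cinner.scaleR_left cinner.scaleR_right
        cinner.zero_left cinner.zero_right A Tsa)
    then show ?thesis by auto
  qed
  have Ycl: "Y (c *\<^sub>C x) = c *\<^sub>C Y x" for c x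
    by (rule Yc[OF _ bounded_linear_scaleC_hilbert]) (simp add: A clinear_simps[OF Tcl] scaleC_diff_right)
  have YT: "Y (T x) = T (Y x)" for x
    by (rule Yc) (auto simp: A blinfun.bounded_linear_right blinfun.diff_right)
  have Y\<pi>: "Y (\<pi> B x) = \<pi> B (Y x)" for B x
    by (rule Yc) (auto simp: A Tcomm blinfun.diff_right blinfun.bounded_linear_right)
  define R where "R x = x - Y x" for x
  have RR: "R (R x) = T (T x)" for x
  proof -
    have "R (R x) = x - blinfun_apply (2 *\<^sub>R Y) x + Y (Y x)"
      by (simp add: R_def blinfun.diff_right blinfun.scaleR_left scaleR_2[where 'a='h])
    then show ?thesis by (simp only: Y(2)) (simp add: blinfun.add_left A)
  qed
  have RT: "R (T x) = T (R x)" for x by (simp add: R_def YT blinfun.diff_right)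
  have Rpos: "0 \<le> Re (cinner x (R x))" for x
  proof -
    have "Re (cinner x (Y x)) \<le> norm x * norm (Y x)"
      using complex_Re_le_cmod norm_cinner_le order_trans by blast
    also have "\<dots> \<le> norm x * norm x"
      using norm_blinfun[of Y x] Y(1) mult_right_mono[OF Y(1), of "norm x"] by (intro mult_left_mono) auto
    finally show ?thesis by (simp add: R_def cinner.diff_right cinner_self power2_eq_square)
  qed
  have Radd: "R (x + y) = R x + R y" "R (c *\<^sub>C x) = c *\<^sub>C R x" for x y c
    by (simp_all add: R_def blinfun.add_right Ycl scaleC_diff_right)
  let ?K = "{x. R x = T x}"
  have "?K = {0} \<or> ?K = UNIV"
  proof (rule irreducible_subspace[OF irr])
    have "closed ?K" unfolding R_def by (intro closed_Collect_eq continuous_intros)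
    then show "closed_csubspace ?K"
      by (auto simp: closed_csubspace_def Radd clinear_simps[OF Tcl]) (simp add: R_def)
    show "\<pi> B x \<in> ?K" if "x \<in> ?K" for B x
      using that by (auto simp: R_def Y\<pi> Tcomm simp flip: lin')
  qed
  then show ?thesis
  proof
    assume K: "?K = {0}"
    have "R x + T x \<in> ?K" for x by (simp add: Radd RR RT blinfun.add_right)
    then have "T x = - R x" for x using K by (metis singletonD add_eq_0_iff)
    then have "Re (cinner x (T x)) \<le> 0" for x using Rpos[of x] by (simp add: cinner.minus_right)
    then show ?thesis using M by (simp add: T cinner.scaleR_right mult_le_0_iff divide_le_0_iff)
  next
    assume K: "?K = UNIV"
    have "x \<in> ?K" for x unfolding K by simp
    then have "T x = R x" for x by simp
    then have "0 \<le> Re (cinner x (T x))" for x using Rpos[of x] by simp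
    then show ?thesis using M by (simp add: T cinner.scaleR_right zero_le_divide_iff)
  qed
qed

text \<open>Every shift S - t is semidefinite. At a fixed x0 its sign changes at the Rayleigh
  quotient c, so S - t is \<le> 0 everywhere for t > c and \<ge> 0 everywhere for t < c, and the
  quadratic form of S - c vanishes.\<close>

lemma Schur_self_adjoint:
  fixes S :: "'h::complex_hilbert_space \<Rightarrow>\<^sub>L 'h"
  assumes irr: "nonzero_irreducible_rep \<pi>" and S: "self_adjoint_intertwiner \<pi> S"
  obtains c :: real where "\<And>x. S x = c *\<^sub>R x"
proof -
  have \<pi>: "representation \<pi>" using irr by (rule irreducible_representation)
  obtain x0 :: 'h where x0: "x0 \<noteq> 0"
  proof -
    obtain B where "\<pi> B \<noteq> 0" using irr by (auto simp: nonzero_irreducible_rep_def)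
    then obtain x where "\<pi> B x \<noteq> 0" by (metis blinfun_eqI zero_blinfun.rep_eq)
    then show thesis by (rule that)
  qed
  define c where "c = Re (cinner x0 (S x0)) / (norm x0)\<^sup>2"
  define W where "W t = S - t *\<^sub>R id_blinfun" for t :: real
  have W: "W t x = S x - t *\<^sub>R x" for t x by (simp add: W_def blinfun.diff_left blinfun.scaleR_left)
  have sW: "self_adjoint_intertwiner \<pi> (W t)" for t
    using S by (auto simp: self_adjoint_intertwiner_def clinear_def W scaleR_add_right scaleC_diff_right
        scaleC_scaleR cinner_simps cinner.scaleR_left cinner.scaleR_right blinfun.diff_right blinfun.scaleR_right)
  have ReW: "Re (cinner x (W t x)) = Re (cinner x (S x)) - t * (norm x)\<^sup>2" for x t
    by (simp add: W cinner_simps cinner.scaleR_right norm_sq_cinner)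
  have x0W: "Re (cinner x0 (W t x0)) = (c - t) * (norm x0)\<^sup>2" for t
    using x0 by (simp add: ReW c_def field_simps)
  have up: "Re (cinner x (S x)) \<le> t * (norm x)\<^sup>2" if "t > c" for t x
  proof -
    have "Re (cinner x0 (W t x0)) < 0" using that x0 by (simp add: x0W mult_neg_pos)
    then have "Re (cinner x (W t x)) \<le> 0"
      using self_adjoint_intertwiner_definite[OF irr sW, of t] by (meson not_le)
    then show ?thesis by (simp add: ReW)
  qed
  have low: "t * (norm x)\<^sup>2 \<le> Re (cinner x (S x))" if "t < c" for t x
  proof -
    have "0 < Re (cinner x0 (W t x0))" using that x0 by (simp add: x0W)
    then have "0 \<le> Re (cinner x (W t x))"
      using self_adjoint_intertwiner_definite[OF irr sW, of t] by (meson not_le)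
    then show ?thesis by (simp add: ReW)
  qed
  have zero: "Re (cinner x (W c x)) = 0" for x
  proof (cases "x = 0")
    case False
    have "Re (cinner x (S x)) / (norm x)\<^sup>2 \<le> c"
      by (rule dense_ge) (use up[of _ x] False in \<open>simp add: divide_le_eq\<close>)
    moreover have "c \<le> Re (cinner x (S x)) / (norm x)\<^sup>2"
      by (rule dense_le) (use low[of _ x] False in \<open>simp add: le_divide_eq\<close>)
    ultimately show ?thesis using False by (simp add: ReW field_simps)
  qed (simp add: cinner.zero_left)
  have "W c x = 0" for x
  proof -
    let ?y = "W c x"
    have sa: "cinner (W c u) v = cinner u (W c v)" for u v using sW by (simp add: self_adjoint_intertwiner_def)
    \<comment> \<open>A self-adjoint operator with vanishing form is zero: at x + ?y only the mixed
      terms remain, and they give 2 |?y|^2 = 0.\<close>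
    have "Re (cinner (x + ?y) (W c (x + ?y))) =
      Re (cinner x ?y) + Re (cinner x (W c ?y)) + Re (cinner ?y ?y) + Re (cinner ?y (W c ?y))"
      by (simp add: blinfun.add_right cinner_simps)
    also have "cinner x (W c ?y) = cinner ?y ?y" by (simp add: sa)
    finally have "Re (cinner ?y ?y) = 0" using zero[of "x + ?y"] zero[of x] zero[of ?y] by simp
    then show ?thesis by (simp add: cinner_self)
  qed
  then have "S x = c *\<^sub>R x" for x by (simp add: W)
  then show thesis by (rule that)
qed

section \<open>Pure states and vector states\<close>

definition ext_rep :: "('b::c_star_algebra \<Rightarrow> ('h::complex_hilbert_space \<Rightarrow>\<^sub>L 'h)) \<Rightarrow> 'b unitization \<Rightarrow> 'h \<Rightarrow> 'h" where
  "ext_rep \<pi> x h = \<pi> (ipart x) h + spart x *\<^sub>C h"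

lemma ext_rep_simps:
  assumes \<pi>: "representation \<pi>"
  shows "ext_rep \<pi> (x * y) h = ext_rep \<pi> x (ext_rep \<pi> y h)"
    "cinner (ext_rep \<pi> x h) k = cinner h (ext_rep \<pi> (star x) k)"
    "ext_rep \<pi> (x - y) h = ext_rep \<pi> x h - ext_rep \<pi> y h"
    "ext_rep \<pi> (emb b) h = \<pi> b h" "ext_rep \<pi> 1 h = h"
  using representationD(4,6)[OF \<pi>] clinear_simps[OF representationD(1)[OF \<pi>]]
  by (simp_all add: ext_rep_def clinear_simps[OF representation_vec_clinear[OF \<pi>]] cinner_simps
      scaleC_add_right scaleC_scaleC scaleC_diff_left scaleC_one)

lemma tendsto_ext_rep: "f \<longlonglongrightarrow> l \<Longrightarrow> (\<lambda>n. ext_rep \<pi> x (f n)) \<longlonglongrightarrow> ext_rep \<pi> x l"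
  unfolding ext_rep_def by (intro tendsto_intros bounded_linear.tendsto[OF bounded_linear_scaleC_hilbert])

lemma vector_state_square:
  assumes \<pi>: "representation \<pi>"
  shows "vector_state \<pi> x (star A * B) = cinner (\<pi> A x) (\<pi> B x)"
  using representationD[OF \<pi>] by (simp add: vector_state_apply[OF \<pi>])

lemma pos_functional_vector_state:
  assumes \<pi>: "representation \<pi>"
  shows "pos_functional (vector_state \<pi> x)"
  unfolding pos_functional_def
  by (auto simp: clinear_def vector_state_apply[OF \<pi>] vector_state_square[OF \<pi>] cinner_self less_eq_complex_def
      clinear_simps[OF representation_vec_clinear[OF \<pi>]] cinner_simps scaleC_complex_def
      simp del: vector_state_apply)
    (simp_all add: representationD[OF \<pi>] cinner_self flip: representationD(6)[OF \<pi>])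

lemma vector_state_scaleC:
  assumes \<pi>: "representation \<pi>"
  shows "vector_state \<pi> (a *\<^sub>C x) = (cmod a)\<^sup>2 *\<^sub>R vector_state \<pi> x"
proof (rule blinfun_eqI)
  fix B
  have "vector_state \<pi> (a *\<^sub>C x) B = (a * cnj a) * cinner x (\<pi> B x)"
    by (simp add: vector_state_apply[OF \<pi>] clinear_simps[OF representationD(1)[OF \<pi>]] cinner_simps)
  also have "a * cnj a = of_real ((cmod a)\<^sup>2)" by (simp only: complex_norm_square)
  finally show "vector_state \<pi> (a *\<^sub>C x) B = ((cmod a)\<^sup>2 *\<^sub>R vector_state \<pi> x) B"
    by (simp add: vector_state_apply[OF \<pi>] blinfun.scaleR_left scaleR_conv_of_real)
qed

text \<open>The lower bound uses |\<omega>(B)|^2 \<le> |\<omega>| \<omega>(B* B) along B with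
  \<pi>(B) \<Omega> tending to \<Omega>; density of the orbit takes the place of a unit.\<close>

lemma norm_vector_state:
  assumes irr: "nonzero_irreducible_rep \<pi>"
  shows "norm (vector_state \<pi> \<Omega>) = (norm \<Omega>)\<^sup>2"
proof (rule antisym)
  have \<pi>: "representation \<pi>" using irr by (rule irreducible_representation)
  show "norm (vector_state \<pi> \<Omega>) \<le> (norm \<Omega>)\<^sup>2"
  proof (rule norm_blinfun_bound)
    fix B
    have "norm (vector_state \<pi> \<Omega> B) \<le> norm \<Omega> * norm (\<pi> B \<Omega>)"
      by (simp add: vector_state_apply[OF \<pi>] norm_cinner_le)
    also have "\<dots> \<le> norm \<Omega> * (norm B * norm \<Omega>)"
      by (intro mult_left_mono representation_norm_le[OF \<pi>]) simp
    finally show "norm (vector_state \<pi> \<Omega> B) \<le> (norm \<Omega>)\<^sup>2 * norm B" by (simp add: power2_eq_square mult_ac)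
  qed simp
  show "(norm \<Omega>)\<^sup>2 \<le> norm (vector_state \<pi> \<Omega>)"
  proof (cases "\<Omega> = 0")
    case False
    obtain a where a: "(\<lambda>n. \<pi> (a n) \<Omega>) \<longlonglongrightarrow> \<Omega>"
      using dense_range_sequence[OF irreducible_dense[OF irr False]] by blast
    have "(cmod (cinner \<Omega> \<Omega>))\<^sup>2 \<le> norm (vector_state \<pi> \<Omega>) * (norm \<Omega>)\<^sup>2"
    proof (rule LIMSEQ_le)
      show "(\<lambda>n. (cmod (cinner \<Omega> (\<pi> (a n) \<Omega>)))\<^sup>2) \<longlonglongrightarrow> (cmod (cinner \<Omega> \<Omega>))\<^sup>2"
        by (intro tendsto_intros cinner.tendsto a)
      show "(\<lambda>n. norm (vector_state \<pi> \<Omega>) * (norm (\<pi> (a n) \<Omega>))\<^sup>2) \<longlonglongrightarrow> norm (vector_state \<pi> \<Omega>) * (norm \<Omega>)\<^sup>2"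
        by (intro tendsto_intros a)
      show "\<exists>N. \<forall>n\<ge>N. (cmod (cinner \<Omega> (\<pi> (a n) \<Omega>)))\<^sup>2 \<le> norm (vector_state \<pi> \<Omega>) * (norm (\<pi> (a n) \<Omega>))\<^sup>2"
        using pos_functional_norm_bound[OF pos_functional_vector_state[OF \<pi>, of \<Omega>]]
        by (auto simp: vector_state_square[OF \<pi>] norm_sq_cinner) (simp add: vector_state_apply[OF \<pi>])
    qed
    then have "(norm \<Omega>)\<^sup>2 * (norm \<Omega>)\<^sup>2 \<le> norm (vector_state \<pi> \<Omega>) * (norm \<Omega>)\<^sup>2"
      by (simp add: cinner_self power2_eq_square norm_mult)
    then show ?thesis by (rule mult_right_le_imp_le) (use False in simp)
  qed simp
qed

lemma extend_vector_state:
  assumes irr: "nonzero_irreducible_rep \<pi>"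
  shows "extend (vector_state \<pi> \<Omega>) (star x * y) = cinner (ext_rep \<pi> x \<Omega>) (ext_rep \<pi> y \<Omega>)"
proof -
  have \<pi>: "representation \<pi>" using irr by (rule irreducible_representation)
  have "extend (vector_state \<pi> \<Omega>) z = cinner \<Omega> (ext_rep \<pi> z \<Omega>)" for z
    by (simp add: extend_def norm_vector_state[OF irr] vector_state_apply[OF \<pi>] ext_rep_def cinner_simps cinner_self)
  then show ?thesis by (simp add: ext_rep_simps[OF \<pi>])
qed

lemma irreducible_nondegenerate:
  assumes irr: "nonzero_irreducible_rep \<pi>" and 0: "\<And>B. \<pi> B x = 0"
  shows "x = 0"
proof (rule ccontr)
  assume "x \<noteq> 0"
  then have "x \<in> closure (range (\<lambda>B. \<pi> B x))"
    using irreducible_dense[OF irr] by simp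
  then show False using \<open>x \<noteq> 0\<close> by (simp add: 0)
qed

lemma states_iff:
  fixes \<omega> :: "'b::c_star_algebra \<Rightarrow>\<^sub>L complex"
  shows "\<omega> \<in> states \<longleftrightarrow> pos_functional \<omega> \<and> norm \<omega> = 1"
  by (auto simp: states_def pos_functional_def)

text \<open>A Radon-Nikodym argument. f is represented by a vector \<Phi>; the map \<pi>(B) \<Omega>
  |-> \<pi>(B) \<Phi> extends to a self-adjoint S in the commutant with f(A* B) = <\<pi>(A)
  \<Omega>, S \<pi>(B) \<Omega>>; and Schur's lemma makes S a scalar.\<close>

lemma vector_functional_dominated:
  fixes \<pi> :: "'b::c_star_algebra \<Rightarrow> ('h::complex_hilbert_space \<Rightarrow>\<^sub>L 'h)"
    and f g :: "'b \<Rightarrow>\<^sub>L complex"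
  assumes irr: "nonzero_irreducible_rep \<pi>" and f: "pos_functional f" and g: "pos_functional g"
    and fg: "vector_state \<pi> \<Omega> = f + g" and \<Omega>: "norm \<Omega> = 1"
  shows "f = norm f *\<^sub>R vector_state \<pi> \<Omega>"
proof -
  have \<pi>: "representation \<pi>" using irr by (rule irreducible_representation)
  have "\<Omega> \<noteq> 0" using \<Omega> by auto
  note dense = irreducible_dense[OF irr this]
  define \<xi> where "\<xi> B = \<pi> B \<Omega>" for B
  have ex: "extend f x + extend g x = extend (vector_state \<pi> \<Omega>) x" for x
    by (simp add: fg norm_add_pos_functional[OF f g] extend_def blinfun.add_left algebra_simps)
  obtain \<Phi> b where b: "(\<lambda>n. ext_rep \<pi> (b n) \<Omega>) \<longlonglongrightarrow> \<Phi>"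
    and bd: "\<And>c y. (\<lambda>n. ext_rep \<pi> (c * b n) \<Omega>) \<longlonglongrightarrow> y \<Longrightarrow> norm y \<le> sqrt (Re (extend f (star c * c)))"
    and lim: "\<And>x. (\<lambda>n. extend f (star x * b n) + extend g (star x * b n)) \<longlonglongrightarrow> extend f (star x)"
  proof (rule ex_dominated_vector[OF pos_functional_extend[OF f] pos_functional_extend[OF g], of "\<lambda>x. ext_rep \<pi> x \<Omega>"])
    show "ext_rep \<pi> (x - y) \<Omega> = ext_rep \<pi> x \<Omega> - ext_rep \<pi> y \<Omega>" for x y by (simp add: ext_rep_simps[OF \<pi>])
    show "(norm (ext_rep \<pi> x \<Omega>))\<^sup>2 \<le> Re (extend f (star x * x) + extend g (star x * x))" for x
      by (simp add: ex extend_vector_state[OF irr] norm_sq_cinner del: plus_complex.simps)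
  qed blast
  have fB: "cinner (\<pi> B \<Omega>) \<Phi> = f (star B)" for B
  proof (rule LIMSEQ_unique)
    show "(\<lambda>n. cinner (\<pi> B \<Omega>) (ext_rep \<pi> (b n) \<Omega>)) \<longlonglongrightarrow> cinner (\<pi> B \<Omega>) \<Phi>"
      by (intro cinner.tendsto tendsto_const b)
    show "(\<lambda>n. cinner (\<pi> B \<Omega>) (ext_rep \<pi> (b n) \<Omega>)) \<longlonglongrightarrow> f (star B)"
      using lim[of "emb B"] unfolding ex extend_vector_state[OF irr]
      by (simp add: ext_rep_simps[OF \<pi>] flip: emb_star)
  qed
  have norm\<Phi>: "norm (\<pi> B \<Phi>) \<le> 1 * norm (\<pi> B \<Omega>)" for B
  proof -
    have "(\<lambda>n. ext_rep \<pi> (emb B * b n) \<Omega>) \<longlonglongrightarrow> \<pi> B \<Phi>"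
      using tendsto_ext_rep[OF b, of \<pi> "emb B"] by (simp add: ext_rep_simps[OF \<pi>])
    from bd[OF this] have "norm (\<pi> B \<Phi>) \<le> sqrt (Re (f (star B * B)))"
      by (simp flip: emb_star emb_simps)
    also have "\<dots> \<le> sqrt (Re (vector_state \<pi> \<Omega> (star B * B)))"
      using pos_functional_nonneg(1)[OF g, of B] by (simp add: fg blinfun.add_left)
    also have "\<dots> = norm (\<pi> B \<Omega>)" by (simp add: vector_state_square[OF \<pi>] flip: norm_sq_cinner)
    finally show ?thesis by simp
  qed
  obtain S :: "'h \<Rightarrow>\<^sub>L 'h" where S: "clinear (blinfun_apply S)" "\<And>B. S (\<pi> B \<Omega>) = \<pi> B \<Phi>"
    using ex_dense_extension[OF representation_vec_clinear[OF \<pi>] representation_vec_clinear[OF \<pi>] norm\<Phi> dense] by blast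
  have fAB: "cinner (\<pi> A \<Omega>) (S (\<pi> B \<Omega>)) = f (star A * B)" for A B
  proof -
    have "cinner (\<pi> A \<Omega>) (\<pi> B \<Phi>) = cinner (\<pi> (star B * A) \<Omega>) \<Phi>"
      by (simp add: representationD[OF \<pi>] star_star)
    then show ?thesis by (simp add: S fB star_mult star_star)
  qed
  have "self_adjoint_intertwiner \<pi> S"
    unfolding self_adjoint_intertwiner_def
  proof (intro conjI allI S(1))
    have 1: "cinner (S (\<pi> A \<Omega>)) (\<pi> B \<Omega>) = cinner (\<pi> A \<Omega>) (S (\<pi> B \<Omega>))" for A B
      using fAB[of A B] fAB[of B A] pos_functional_herm[OF f, of A B]
        cinner_commute[of "S (\<pi> A \<Omega>)" "\<pi> B \<Omega>"] by simp
    have 2: "cinner (S x) (\<pi> B \<Omega>) = cinner x (S (\<pi> B \<Omega>))" for x B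
      by (rule dense_range_eqI[OF dense, where f="\<lambda>x. cinner (S x) _" and g="\<lambda>x. cinner x _"])
        (use 1 in \<open>auto intro!: cinner.continuous_on continuous_intros\<close>)
    show "cinner (S x) y = cinner x (S y)" for x y
      by (rule dense_range_eqI[OF dense, where f="\<lambda>y. cinner _ y" and g="\<lambda>y. cinner x (S y)"])
        (use 2 in \<open>auto intro!: cinner.continuous_on continuous_intros\<close>)
    have "S (\<pi> B (\<pi> A \<Omega>)) = \<pi> B (S (\<pi> A \<Omega>))" for A B
      using S(2)[of "B * A"] by (simp add: S(2) representationD[OF \<pi>])
    then show "S (\<pi> B x) = \<pi> B (S x)" for B x
      by (rule dense_range_eqI[OF dense, rotated 2]) (intro continuous_intros)+
  qed
  then obtain c where c: "\<And>x. S x = c *\<^sub>R x" using Schur_self_adjoint[OF irr] by blast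
  have fc: "f (star A * B) = c *\<^sub>R vector_state \<pi> \<Omega> (star A * B)" for A B
    using fAB[of A B] by (simp add: c cinner.scaleR_right vector_state_square[OF \<pi>])
  \<comment> \<open>So far f is known on products; the approximate unit extends this to all
    B.\<close>
  have fB: "f B = c *\<^sub>R vector_state \<pi> \<Omega> B" for B
  proof (rule tendsto_unique[OF approx_unit_neq_bot])
    show "((\<lambda>u. f (u * B)) \<longlongrightarrow> f B) approx_unit" by (intro tendsto_intros approx_unit_left)
    have "((\<lambda>u. c *\<^sub>R vector_state \<pi> \<Omega> (u * B)) \<longlongrightarrow> c *\<^sub>R vector_state \<pi> \<Omega> B) approx_unit"
      by (intro tendsto_intros approx_unit_left)
    moreover have "eventually (\<lambda>u. c *\<^sub>R vector_state \<pi> \<Omega> (u * B) = f (u * B)) approx_unit"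
      using eventually_unit_interval
      by eventually_elim (metis fc unit_interval_sa)
    ultimately show "((\<lambda>u. f (u * B)) \<longlongrightarrow> c *\<^sub>R vector_state \<pi> \<Omega> B) approx_unit"
      by (rule Lim_transform_eventually)
  qed
  have "norm f = c"
  proof (rule tendsto_unique[OF approx_unit_neq_bot])
    show "((\<lambda>u. Re (f u)) \<longlongrightarrow> norm f) approx_unit" by (rule pos_functional_approx_unit[OF f])
    have "((\<lambda>u. c * Re (vector_state \<pi> \<Omega> u)) \<longlongrightarrow> c * norm (vector_state \<pi> \<Omega>)) approx_unit"
      by (intro tendsto_intros pos_functional_approx_unit pos_functional_vector_state[OF \<pi>])
    then show "((\<lambda>u. Re (f u)) \<longlongrightarrow> c) approx_unit" by (simp add: fB norm_vector_state[OF irr] \<Omega>)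
  qed
  then show ?thesis by (intro blinfun_eqI) (simp add: fB blinfun.scaleR_left)
qed

lemma pos_functional_scaleR:
  fixes f :: "'b::c_star_algebra \<Rightarrow>\<^sub>L complex"
  assumes "pos_functional f" "0 \<le> r" shows "pos_functional (r *\<^sub>R f)"
  using assms
  by (auto simp: pos_functional_def clinear_def blinfun.scaleR_left scaleR_add_right scaleC_complex_def less_eq_complex_def)

lemma vector_state_pure:
  assumes irr: "nonzero_irreducible_rep \<pi>" and \<Omega>: "norm \<Omega> = 1"
  shows "vector_state \<pi> \<Omega> \<in> pure_states"
  unfolding pure_states_def extreme_point_of_def mem_Collect_eq
proof (intro conjI ballI)
  have \<pi>: "representation \<pi>" using irr by (rule irreducible_representation)
  let ?\<omega> = "vector_state \<pi> \<Omega>"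
  show "?\<omega> \<in> states"
    by (simp add: states_iff pos_functional_vector_state[OF \<pi>] norm_vector_state[OF irr] \<Omega>)
  fix a b :: "'a \<Rightarrow>\<^sub>L complex" assume ab: "a \<in> states" "b \<in> states"
  show "?\<omega> \<notin> open_segment a b"
  proof
    assume "?\<omega> \<in> open_segment a b"
    then obtain u where u: "a \<noteq> b" "0 < u" "u < 1" "?\<omega> = (1 - u) *\<^sub>R a + u *\<^sub>R b"
      by (auto simp: in_segment)
    have p: "pos_functional ((1 - u) *\<^sub>R a)" "pos_functional (u *\<^sub>R b)"
      using ab u by (auto simp: states_iff intro!: pos_functional_scaleR)
    have "(1 - u) *\<^sub>R a = (1 - u) *\<^sub>R ?\<omega>"
      using vector_functional_dominated[OF irr p u(4) \<Omega>] ab u by (simp add: states_iff)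
    then have "a = ?\<omega>" using u(3) by simp
    have "?\<omega> = u *\<^sub>R b + (1 - u) *\<^sub>R a" using u(4) by (simp only: add.commute)
    from vector_functional_dominated[OF irr p(2,1) this \<Omega>] have "u *\<^sub>R b = u *\<^sub>R ?\<omega>"
      using ab u(2) by (simp add: states_iff)
    then have "b = ?\<omega>" using u(2) by simp
    then show False using u(1) \<open>a = ?\<omega>\<close> by simp
  qed
qed

text \<open>Domination makes g = \<psi> - f positive, and norms of positive functionals add, so the
  masses of f and g sum to 1. If g is not 0, then \<psi> is a convex combination of the normalised f
  and g, and purity makes both equal to \<psi>.\<close>

lemma dominated_vector_state:
  fixes \<pi> :: "'b::c_star_algebra \<Rightarrow> ('h::complex_hilbert_space \<Rightarrow>\<^sub>L 'h)"
    and \<psi> :: "'b \<Rightarrow>\<^sub>L complex"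
  assumes irr: "nonzero_irreducible_rep \<pi>" and \<psi>: "\<psi> \<in> pure_states" and "\<Phi> \<noteq> 0"
    and dom: "\<And>B. (norm (\<pi> B \<Phi>))\<^sup>2 \<le> Re (\<psi> (star B * B))"
  shows "vector_state \<pi> \<Phi> = (norm \<Phi>)\<^sup>2 *\<^sub>R \<psi>"
proof -
  have \<pi>: "representation \<pi>" using irr by (rule irreducible_representation)
  have \<psi>s: "pos_functional \<psi>" "norm \<psi> = 1" and ext: "\<And>a b. a \<in> states \<Longrightarrow> b \<in> states \<Longrightarrow> \<psi> \<notin> open_segment a b"
    using \<psi> by (auto simp: pure_states_def extreme_point_of_def states_iff)
  define f where "f = vector_state \<pi> \<Phi>"
  define g where "g = \<psi> - f"
  define l where "l = (norm \<Phi>)\<^sup>2"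
  have f: "pos_functional f" "norm f = l" and l: "l > 0"
    using \<open>\<Phi> \<noteq> 0\<close> by (simp_all add: f_def l_def pos_functional_vector_state[OF \<pi>] norm_vector_state[OF irr])
  have g: "pos_functional g"
    unfolding pos_functional_def
  proof (intro conjI allI)
    show "clinear (blinfun_apply g)"
      using pos_functional_clinear[OF f(1)] pos_functional_clinear[OF \<psi>s(1)]
      by (simp add: clinear_def g_def blinfun.diff_left scaleC_complex_def algebra_simps)
    show "0 \<le> g (star B * B)" for B
      using dom[of B] pos_functional_nonneg(2)[OF \<psi>s(1), of B] pos_functional_nonneg(2)[OF f(1), of B]
      by (simp add: g_def blinfun.diff_left less_eq_complex_def)
        (simp add: f_def vector_state_square[OF \<pi>] norm_sq_cinner)
  qed
  have fg: "\<psi> = f + g" by (simp add: g_def)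
  then have lg: "1 = l + norm g" using norm_add_pos_functional[OF f(1) g] \<psi>s(2) f(2) by simp
  have "f = l *\<^sub>R \<psi>"
  proof (cases "norm g = 0")
    case True
    then show ?thesis using lg fg by simp
  next
    case False
    define a where "a = (1/l) *\<^sub>R f"
    define b where "b = (1/norm g) *\<^sub>R g"
    have "a \<in> states" "b \<in> states"
      using f g l False by (auto simp: states_iff a_def b_def pos_functional_scaleR)
    then have "\<psi> \<notin> open_segment a b" by (rule ext)
    moreover have "1 - norm g = l" using lg by simp
    then have eq: "\<psi> = (1 - norm g) *\<^sub>R a + norm g *\<^sub>R b"
      using l False by (simp add: a_def b_def fg)
    have "\<psi> \<in> open_segment a b" if "a \<noteq> b"
      unfolding in_segment using that eq False lg l by (intro conjI exI[of _ "norm g"]) auto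
    ultimately have "a = b" by blast
    then have "\<psi> = a" using eq by (simp flip: scaleR_add_left)
    then show ?thesis using l by (simp add: a_def)
  qed
  then show ?thesis by (simp add: f_def l_def)
qed

text \<open>Half the distance bounds the mass of the positive part of \<open>\<omega> - \<psi>\<close>, hence of a positive
  functional \<open>G\<close> with \<open>\<omega> \<le> \<psi> + G\<close>.\<close>

lemma pure_state_near_vector_state:
  fixes \<pi> :: "'b::c_star_algebra \<Rightarrow> ('h::complex_hilbert_space \<Rightarrow>\<^sub>L 'h)"
    and \<psi> :: "'b \<Rightarrow>\<^sub>L complex"
  assumes irr: "nonzero_irreducible_rep \<pi>" and \<psi>: "\<psi> \<in> pure_states" and \<Omega>: "norm \<Omega> = 1"
    and near: "norm (\<psi> - vector_state \<pi> \<Omega>) < 2"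
  obtains \<Phi> where "\<Phi> \<noteq> 0" "(norm (\<Omega> - \<Phi>))\<^sup>2 \<le> norm (\<psi> - vector_state \<pi> \<Omega>) / 2"
    "vector_state \<pi> \<Phi> = (norm \<Phi>)\<^sup>2 *\<^sub>R \<psi>"
proof -
  have \<pi>: "representation \<pi>" using irr by (rule irreducible_representation)
  let ?\<omega> = "vector_state \<pi> \<Omega>"
  define \<theta> where "\<theta> = norm (\<psi> - ?\<omega>) / 2"
  have \<theta>: "0 \<le> \<theta>" "\<theta> < 1" using near by (auto simp: \<theta>_def)
  have \<psi>s: "pos_functional \<psi>" "norm \<psi> = 1"
    using \<psi> by (auto simp: pure_states_def extreme_point_of_def states_iff)
  have \<omega>s: "pos_functional ?\<omega>" "norm ?\<omega> = 1"
    using \<Omega> by (simp_all add: pos_functional_vector_state[OF \<pi>] norm_vector_state[OF irr])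
  define f where "f x = Re (extend ?\<omega> x - extend \<psi> x)" for x
  note ce = complex_functional_simps[OF pos_functional_clinear[OF pos_functional_extend[OF \<omega>s(1)]]]
    complex_functional_simps[OF pos_functional_clinear[OF pos_functional_extend[OF \<psi>s(1)]]]
  have f_lin: "linear f" by (rule linearI) (simp_all add: f_def ce algebra_simps)
  have f1: "f 1 = 0" by (simp add: f_def \<psi>s \<omega>s)
  have fbd: "f x \<le> 2 * \<theta> * norm x" for x
  proof -
    have "f x \<le> cmod (extend ?\<omega> x - extend \<psi> x)" unfolding f_def by (rule complex_Re_le_cmod)
    also have "\<dots> \<le> norm (?\<omega> - \<psi>) * norm x" by (rule extend_diff_bound) (simp_all add: \<psi>s \<omega>s)
    finally show ?thesis by (simp add: \<theta>_def norm_minus_commute)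
  qed
  \<comment> \<open>This is where the distance is halved: f vanishes at 1, so f(k) = f(2 k - |k|) /
    2, and |2 k - |k|| \<le> |k| for positive k.\<close>
  have "f k \<le> \<theta> * norm k" if k: "pos k" for k
  proof (cases "k = 0")
    case False
    have "norm (2 *\<^sub>R k - of_real (norm k)) \<le> norm k"
      using False by (intro pos_le_norm(1) k pos_norm_minus pos_star[OF k]) auto
    then have "f (2 *\<^sub>R k - norm k *\<^sub>R 1) \<le> 2 * \<theta> * norm k"
      using fbd[of "2 *\<^sub>R k - norm k *\<^sub>R 1"] \<theta> mult_left_mono[of _ "norm k" "2 * \<theta>"]
      by (smt (verit) of_real_def)
    then show ?thesis by (simp add: linear_diff[OF f_lin] linear_scale[OF f_lin] f1)
  qed (simp add: linear_0[OF f_lin])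
  then obtain G where G: "pos_functional G" "\<And>x. f (star x * x) \<le> Re (G (star x * x))" "Re (G 1) \<le> \<theta>"
    using ex_dominating_pos_functional[OF f_lin _ \<theta>(1)] by blast
  obtain \<Phi> b where b: "(\<lambda>n. ext_rep \<pi> (b n) \<Omega>) \<longlonglongrightarrow> \<Phi>" and n: "norm (ext_rep \<pi> 1 \<Omega> - \<Phi>) \<le> sqrt (Re (G 1))"
    and bd: "\<And>c y. (\<lambda>n. ext_rep \<pi> (c * b n) \<Omega>) \<longlonglongrightarrow> y \<Longrightarrow> norm y \<le> sqrt (Re (extend \<psi> (star c * c)))"
  proof (rule ex_dominated_vector[OF pos_functional_extend[OF \<psi>s(1)] G(1), of "\<lambda>x. ext_rep \<pi> x \<Omega>"])
    show "ext_rep \<pi> (x - y) \<Omega> = ext_rep \<pi> x \<Omega> - ext_rep \<pi> y \<Omega>" for x y by (simp add: ext_rep_simps[OF \<pi>])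
    show "(norm (ext_rep \<pi> x \<Omega>))\<^sup>2 \<le> Re (extend \<psi> (star x * x) + G (star x * x))" for x
      using G(2)[of x] by (simp add: f_def extend_vector_state[OF irr] norm_sq_cinner)
  qed blast
  have "norm (\<Omega> - \<Phi>) \<le> sqrt \<theta>" using n G(3) by (simp add: ext_rep_simps[OF \<pi>] order_trans)
  then have near\<Phi>: "(norm (\<Omega> - \<Phi>))\<^sup>2 \<le> \<theta>"
    using \<theta> power_mono[of "norm (\<Omega> - \<Phi>)" "sqrt \<theta>" 2] by simp
  \<comment> \<open>Otherwise 1 = |\<Omega>|^2 \<le> \<theta> < 1; the radius 2 of the ball enters
    here.\<close>
  have "\<Phi> \<noteq> 0" using near\<Phi> \<Omega> \<theta> by auto
  have "(norm (\<pi> B \<Phi>))\<^sup>2 \<le> Re (\<psi> (star B * B))" for B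
  proof -
    have "(\<lambda>n. ext_rep \<pi> (emb B * b n) \<Omega>) \<longlonglongrightarrow> \<pi> B \<Phi>"
      using tendsto_ext_rep[OF b, of \<pi> "emb B"] by (simp add: ext_rep_simps[OF \<pi>])
    from bd[OF this] have "norm (\<pi> B \<Phi>) \<le> sqrt (Re (\<psi> (star B * B)))"
      by (simp flip: emb_star emb_simps)
    then show ?thesis
      using power_mono[of "norm (\<pi> B \<Phi>)" "sqrt (Re (\<psi> (star B * B)))" 2] pos_functional_nonneg(1)[OF \<psi>s(1), of B] by simp
  qed
  then have "vector_state \<pi> \<Phi> = (norm \<Phi>)\<^sup>2 *\<^sub>R \<psi>"
    by (rule dominated_vector_state[OF irr \<psi> \<open>\<Phi> \<noteq> 0\<close>])
  then show thesis using that \<open>\<Phi> \<noteq> 0\<close> near\<Phi> by (simp add: \<theta>_def)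
qed

section \<open>Intertwining unitaries, and vectors with the same state\<close>

lemma norm_eq_imp_cinner_eq:
  fixes V :: "'h::complex_hilbert_space \<Rightarrow> 'k::complex_hilbert_space"
  assumes V: "clinear V" and norm: "\<And>x. norm (V x) = norm x"
  shows "cinner (V x) (V y) = cinner x y"
proof -
  note [simp] = clinear_simps[OF V]
  have Re: "Re (cinner (V x) (V y)) = Re (cinner x y)" for x y
  proof -
    have "(norm (V (x + y)))\<^sup>2 = (norm (x + y))\<^sup>2" by (simp only: norm)
    moreover have "Re (cinner (V y) (V x)) = Re (cinner (V x) (V y))" "Re (cinner y x) = Re (cinner x y)"
      using cinner_commute[of "V y" "V x"] cinner_commute[of y x] by auto
    moreover have "Re (cinner (V x) (V x)) = Re (cinner x x)" for x
      using norm[of x] by (metis norm_sq_cinner)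
    ultimately show ?thesis by (simp add: norm_sq_cinner cinner_simps)
  qed
  have "Im (cinner (V x) (V y)) = Im (cinner x y)"
    using Re[of "\<i> *\<^sub>C x" y] by (simp add: cinner_simps)
  with Re[of x y] show ?thesis by (simp add: complex_eq_iff)
qed

text \<open>Uniqueness of the GNS representation: equal vector states make \<pi>(B) \<Omega> |->
  \<sigma>(B) \<Phi> isometric between dense orbits. The inverse W comes from the same construction
  with the roles exchanged.\<close>

lemma ex_intertwining_unitary:
  fixes \<pi> :: "'b::c_star_algebra \<Rightarrow> ('h::complex_hilbert_space \<Rightarrow>\<^sub>L 'h)"
    and \<sigma> :: "'b \<Rightarrow> ('k::complex_hilbert_space \<Rightarrow>\<^sub>L 'k)"
  assumes irr: "nonzero_irreducible_rep \<pi>" "nonzero_irreducible_rep \<sigma>"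
    and nz: "\<Omega> \<noteq> 0" "\<Phi> \<noteq> 0" and eq: "vector_state \<pi> \<Omega> = vector_state \<sigma> \<Phi>"
  obtains V W where "V \<in> unitaries" "clinear (blinfun_apply W)" "\<And>x. V (W x) = x" "\<And>x. W (V x) = x"
    "\<And>B. V (\<pi> B \<Omega>) = \<sigma> B \<Phi>" "\<And>B x. V (\<pi> B x) = \<sigma> B (V x)"
proof -
  have \<pi>: "representation \<pi>" and \<sigma>: "representation \<sigma>" using irr by (auto intro: irreducible_representation)
  note dense = irreducible_dense[OF irr(1) nz(1)] irreducible_dense[OF irr(2) nz(2)]
  have n: "norm (\<sigma> B \<Phi>) = norm (\<pi> B \<Omega>)" for B
  proof -
    have "(norm (\<sigma> B \<Phi>))\<^sup>2 = (norm (\<pi> B \<Omega>))\<^sup>2"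
      unfolding norm_sq_cinner vector_state_square[OF \<pi>, symmetric] vector_state_square[OF \<sigma>, symmetric] eq ..
    then show ?thesis by simp
  qed
  obtain V :: "'h \<Rightarrow>\<^sub>L 'k" where V: "clinear (blinfun_apply V)" "\<And>B. V (\<pi> B \<Omega>) = \<sigma> B \<Phi>"
    using ex_dense_extension[OF representation_vec_clinear[OF \<pi>] representation_vec_clinear[OF \<sigma>] _ dense(1), of \<Phi> 1] n by auto
  obtain W :: "'k \<Rightarrow>\<^sub>L 'h" where W: "clinear (blinfun_apply W)" "\<And>B. W (\<sigma> B \<Phi>) = \<pi> B \<Omega>"
    using ex_dense_extension[OF representation_vec_clinear[OF \<sigma>] representation_vec_clinear[OF \<pi>] _ dense(2), of \<Omega> 1] n by auto
  have VW: "V (W x) = x" for x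
    by (rule dense_range_eqI[OF dense(2)]) (auto intro!: continuous_intros simp: V W)
  have WV: "W (V x) = x" for x
    by (rule dense_range_eqI[OF dense(1)]) (auto intro!: continuous_intros simp: V W)
  have "norm (V x) = norm x" for x
    by (rule dense_range_eqI[OF dense(1)]) (auto intro!: continuous_intros simp: V n)
  moreover have "surj (blinfun_apply V)" by (rule surjI[of _ W]) (rule VW)
  ultimately have "V \<in> unitaries"
    unfolding unitaries_def using V(1) norm_eq_imp_cinner_eq[OF V(1)] by blast
  moreover have "V (\<pi> B x) = \<sigma> B (V x)" for B x
  proof (rule dense_range_eqI[OF dense(1)])
    show "V (\<pi> B (\<pi> A \<Omega>)) = \<sigma> B (V (\<pi> A \<Omega>))" for A
      using V(2)[of "B * A"] by (simp add: V(2) representationD[OF \<pi>] representationD[OF \<sigma>])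
  qed (intro continuous_intros)+
  ultimately show thesis using that[of V W] V W VW WV by blast
qed

text \<open>The intertwining unitary V commutes with \<pi>. Its inverse W is its adjoint, so V + W
  and i (V - W) are self-adjoint; Schur's lemma makes both real scalars, and V is recovered from
  them as a complex scalar.\<close>

lemma vector_state_eq_imp_parallel:
  fixes \<pi> :: "'b::c_star_algebra \<Rightarrow> ('h::complex_hilbert_space \<Rightarrow>\<^sub>L 'h)"
  assumes irr: "nonzero_irreducible_rep \<pi>"
    and nz: "\<Omega> \<noteq> 0" "\<Phi> \<noteq> 0" and eq: "vector_state \<pi> \<Omega> = vector_state \<pi> \<Phi>"
  obtains c where "\<Phi> = c *\<^sub>C \<Omega>"
proof -
  have \<pi>: "representation \<pi>" using irr by (rule irreducible_representation)
  obtain V W where V: "V \<in> unitaries" "\<And>B. V (\<pi> B \<Omega>) = \<pi> B \<Phi>" "\<And>B x. V (\<pi> B x) = \<pi> B (V x)"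
    and W: "clinear (blinfun_apply W)" "\<And>x. V (W x) = x" "\<And>x. W (V x) = x"
    using ex_intertwining_unitary[OF irr irr nz eq] by metis
  have Vc: "clinear (blinfun_apply V)" and Vi: "\<And>x y. cinner (V x) (V y) = cinner x y"
    using V(1) by (auto simp: unitaries_def)
  have adj: "cinner (V x) y = cinner x (W y)" "cinner (W x) y = cinner x (V y)" for x y
    using Vi[of x "W y"] Vi[of "W x" y] by (simp_all add: W)
  have Wcomm: "W (\<pi> B x) = \<pi> B (W x)" for B x by (metis V(3) W(2,3))
  have bl: "bounded_linear (\<lambda>x. \<i> *\<^sub>C (V x - W x))"
    by (intro bounded_linear_compose[OF bounded_linear_scaleC_hilbert] bounded_linear_sub blinfun.bounded_linear_right)
  have "self_adjoint_intertwiner \<pi> (V + W)"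
    using clinear_simps[OF Vc] clinear_simps[OF W(1)]
    by (simp add: self_adjoint_intertwiner_def clinear_def blinfun.add_left blinfun.add_right
        scaleC_add_right V(3) Wcomm adj cinner_simps)
  then obtain c where c: "\<And>x. (V + W) x = c *\<^sub>R x" using Schur_self_adjoint[OF irr] by blast
  have "self_adjoint_intertwiner \<pi> (Blinfun (\<lambda>x. \<i> *\<^sub>C (V x - W x)))"
    using clinear_simps[OF Vc] clinear_simps[OF W(1)] clinear_simps[OF representationD(1)[OF \<pi>]]
    by (simp add: self_adjoint_intertwiner_def bounded_linear_Blinfun_apply[OF bl])
      (simp add: clinear_def scaleC_add_right scaleC_diff_right scaleC_scaleC mult.commute V(3) Wcomm adj cinner_simps)
  then obtain d where d: "\<And>x. \<i> *\<^sub>C (V x - W x) = d *\<^sub>R x"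
    using Schur_self_adjoint[OF irr] by (metis bounded_linear_Blinfun_apply[OF bl])
  define z where "z = (of_real c - \<i> * of_real d) / 2"
  have Vz: "V x = z *\<^sub>C x" for x
  proof -
    have "V x - W x = (- \<i>) *\<^sub>C (d *\<^sub>R x)" by (simp add: scaleC_scaleC scaleC_one flip: d)
    moreover have "V x + W x = c *\<^sub>R x" using c[of x] by (simp add: blinfun.add_left)
    moreover have "2 * z = of_real c - \<i> * of_real d" by (simp add: z_def)
    ultimately have "(V x + W x) + (V x - W x) = (2 * z) *\<^sub>C x"
      by (simp add: scaleR_scaleC scaleC_scaleC scaleC_diff_left)
    then have "(2::complex) *\<^sub>C V x = (2 * z) *\<^sub>C x"
      using scaleR_scaleC[of 2 "V x"] by (simp add: scaleR_2)
    then have "(1/2) *\<^sub>C ((2::complex) *\<^sub>C V x) = (1/2) *\<^sub>C ((2 * z) *\<^sub>C x)" by simp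
    then show ?thesis by (simp add: scaleC_scaleC scaleC_one)
  qed
  \<comment> \<open>V is known on the orbit of \<Omega>, so V \<Omega> = \<Phi> has to be reached
    through nondegeneracy.\<close>
  have "\<pi> B (\<Phi> - z *\<^sub>C \<Omega>) = 0" for B
    using V(2)[of B] by (simp add: clinear_simps[OF representationD(1)[OF \<pi>]] Vz)
  then have "\<Phi> - z *\<^sub>C \<Omega> = 0" by (rule irreducible_nondegenerate[OF irr])
  then show thesis using that by simp
qed

text \<open>By division by zero, this is the zero vector if \<open>\<Phi>\<close> is orthogonal to \<open>\<Psi>\<close>.\<close>

definition aligned :: "'h::complex_hilbert_space \<Rightarrow> 'h \<Rightarrow> 'h" where
  "aligned \<Psi> \<Phi> = (cnj (cinner \<Psi> \<Phi>) / of_real (cmod (cinner \<Psi> \<Phi>) * norm \<Phi>)) *\<^sub>C \<Phi>"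

lemma aligned:
  assumes "cinner \<Psi> \<Phi> \<noteq> 0"
  shows "norm (aligned \<Psi> \<Phi>) = 1" "0 < cinner \<Psi> (aligned \<Psi> \<Phi>)"
proof -
  have nz: "\<Phi> \<noteq> 0" using assms by (auto simp: cinner.zero_right)
  then show "norm (aligned \<Psi> \<Phi>) = 1"
    using assms by (simp add: aligned_def norm_scaleC_hilbert norm_divide norm_mult)
  have "cinner \<Psi> (aligned \<Psi> \<Phi>) = (cinner \<Psi> \<Phi> * cnj (cinner \<Psi> \<Phi>)) / of_real (cmod (cinner \<Psi> \<Phi>) * norm \<Phi>)"
    by (simp add: aligned_def cinner_simps)
  also have "cinner \<Psi> \<Phi> * cnj (cinner \<Psi> \<Phi>) = of_real ((cmod (cinner \<Psi> \<Phi>))\<^sup>2)" by (simp only: complex_norm_square)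
  also have "of_real ((cmod (cinner \<Psi> \<Phi>))\<^sup>2) / of_real (cmod (cinner \<Psi> \<Phi>) * norm \<Phi>) =
      complex_of_real ((cmod (cinner \<Psi> \<Phi>))\<^sup>2 / (cmod (cinner \<Psi> \<Phi>) * norm \<Phi>))"
    by (simp only: of_real_divide)
  finally show "0 < cinner \<Psi> (aligned \<Psi> \<Phi>)"
    using assms nz by (simp add: less_complex_def)
qed

lemma vector_state_aligned:
  assumes "representation \<pi>" "cinner \<Psi> \<Phi> \<noteq> 0" "vector_state \<pi> \<Phi> = (norm \<Phi>)\<^sup>2 *\<^sub>R \<omega>"
  shows "vector_state \<pi> (aligned \<Psi> \<Phi>) = \<omega>"
proof -
  have "\<Phi> \<noteq> 0" using assms(2) by (auto simp: cinner.zero_right)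
  then show ?thesis
    using assms(2,3) unfolding aligned_def vector_state_scaleC[OF assms(1)]
    by (simp add: norm_divide norm_mult power_divide power_mult_distrib)
qed

text \<open>Vectors that represent one pure state are parallel, and the sign condition fixes the
  phase left after normalising; hence any nonzero representing vector computes the section.
  Orthogonality to \<Psi> is excluded on the vector \<Phi>' of the basic estimate, where |\<Psi> -
  \<Phi>'|^2 = 1 + |\<Phi>'|^2 would contradict the bound below 1.\<close>

lemma state_ball_vector:
  fixes \<pi> :: "'b::c_star_algebra \<Rightarrow> ('h::complex_hilbert_space \<Rightarrow>\<^sub>L 'h)"
  assumes irr: "nonzero_irreducible_rep \<pi>" and \<Psi>: "norm \<Psi> = 1" and \<omega>: "\<omega> \<in> state_ball (vector_state \<pi> \<Psi>)"
    and \<Phi>: "\<Phi> \<noteq> 0" "vector_state \<pi> \<Phi> = (norm \<Phi>)\<^sup>2 *\<^sub>R \<omega>"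
  shows "cinner \<Psi> \<Phi> \<noteq> 0" "pos_section \<pi> \<Psi> \<omega> = aligned \<Psi> \<Phi>"
proof -
  have \<pi>: "representation \<pi>" using irr by (rule irreducible_representation)
  obtain \<Phi>' where \<Phi>': "\<Phi>' \<noteq> 0" "(norm (\<Psi> - \<Phi>'))\<^sup>2 \<le> norm (\<omega> - vector_state \<pi> \<Psi>) / 2"
    "vector_state \<pi> \<Phi>' = (norm \<Phi>')\<^sup>2 *\<^sub>R \<omega>"
    using \<omega> by (auto simp: state_ball_def intro: pure_state_near_vector_state[OF irr _ \<Psi>, of \<omega>])
  have c': "cinner \<Psi> \<Phi>' \<noteq> 0"
  proof
    assume 0: "cinner \<Psi> \<Phi>' = 0"
    moreover have "cinner \<Phi>' \<Psi> = 0" using 0 cinner_commute[of \<Phi>' \<Psi>] by simp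
    ultimately have "(norm (\<Psi> - \<Phi>'))\<^sup>2 = 1 + (norm \<Phi>')\<^sup>2"
      using \<Psi> by (simp add: norm_sq_cinner cinner_simps) (simp add: cinner_self)
    then show False using \<Phi>'(2) \<omega> zero_le_power2[of "norm \<Phi>'"] by (simp add: state_ball_def)
  qed
  have vs_norm: "vector_state \<pi> (complex_of_real (1 / norm x) *\<^sub>C x) = \<omega>"
    if "x \<noteq> 0" "vector_state \<pi> x = (norm x)\<^sup>2 *\<^sub>R \<omega>" for x
    using that by (simp add: vector_state_scaleC[OF \<pi>] norm_divide power_divide del: of_real_divide)
  have par: "\<exists>d. y = d *\<^sub>C x" if x: "x \<noteq> 0" "vector_state \<pi> x = (norm x)\<^sup>2 *\<^sub>R \<omega>"
    and y: "y \<noteq> 0" "vector_state \<pi> y = (norm y)\<^sup>2 *\<^sub>R \<omega>" for x y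
  proof -
    have "complex_of_real (1 / norm z) *\<^sub>C z \<noteq> 0" if "z \<noteq> 0" for z :: 'h
    proof -
      have "norm (complex_of_real (1 / norm z) *\<^sub>C z) = 1"
        using that by (simp add: norm_scaleC_hilbert norm_divide del: of_real_divide)
      then show ?thesis by auto
    qed
    then obtain c where "complex_of_real (1 / norm y) *\<^sub>C y = c *\<^sub>C (complex_of_real (1 / norm x) *\<^sub>C x)"
      using vector_state_eq_imp_parallel[OF irr] vs_norm[OF x] vs_norm[OF y] x(1) y(1) by metis
    then have "complex_of_real (norm y) *\<^sub>C (complex_of_real (1 / norm y) *\<^sub>C y) =
      complex_of_real (norm y) *\<^sub>C (c *\<^sub>C (complex_of_real (1 / norm x) *\<^sub>C x))" by simp
    then show ?thesis using y(1) by (auto simp: scaleC_scaleC scaleC_one)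
  qed
  obtain d where d: "\<Phi> = d *\<^sub>C \<Phi>'" using par[OF \<Phi>'(1,3) \<Phi>] by blast
  then show c: "cinner \<Psi> \<Phi> \<noteq> 0" using c' \<Phi>(1) by (auto simp: cinner_simps)
  have al: "vector_state \<pi> (aligned \<Psi> \<Phi>) = \<omega>" by (rule vector_state_aligned[OF \<pi> c \<Phi>(2)])
  have "(THE \<Theta>. \<Theta> \<in> sphere 0 1 \<and> ray_state \<pi> (ray \<Theta>) = \<omega> \<and> 0 < cinner \<Psi> \<Theta>) = aligned \<Psi> \<Phi>"
  proof (rule the_equality)
    show "aligned \<Psi> \<Phi> \<in> sphere 0 1 \<and> ray_state \<pi> (ray (aligned \<Psi> \<Phi>)) = \<omega> \<and> 0 < cinner \<Psi> (aligned \<Psi> \<Phi>)"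
      using aligned[OF c] al by (simp add: ray_state_ray[OF irr])
    fix \<Theta> assume \<Theta>: "\<Theta> \<in> sphere 0 1 \<and> ray_state \<pi> (ray \<Theta>) = \<omega> \<and> 0 < cinner \<Psi> \<Theta>"
    then have n: "norm \<Theta> = 1" by simp
    then have v: "vector_state \<pi> \<Theta> = (norm \<Theta>)\<^sup>2 *\<^sub>R \<omega>" using \<Theta> by (simp add: ray_state_ray[OF irr])
    have "\<Theta> \<noteq> 0" using n by auto
    have "aligned \<Psi> \<Phi> \<noteq> 0" using aligned(1)[OF c] by auto
    then obtain e where e: "\<Theta> = e *\<^sub>C aligned \<Psi> \<Phi>"
      using par[of "aligned \<Psi> \<Phi>" \<Theta>] al v \<open>\<Theta> \<noteq> 0\<close> aligned(1)[OF c] by auto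
    have "cmod e = 1" using n aligned(1)[OF c] by (simp add: e norm_scaleC_hilbert)
    moreover have "0 < e * cinner \<Psi> (aligned \<Psi> \<Phi>)" using \<Theta> by (simp add: e cinner_simps)
    ultimately have "e = 1"
      using aligned(2)[OF c]
      by (auto simp: less_complex_def complex_eq_iff cmod_def zero_less_mult_iff power2_eq_1_iff)
    then show "\<Theta> = aligned \<Psi> \<Phi>" by (simp add: e scaleC_one)
  qed
  then show "pos_section \<pi> \<Psi> \<omega> = aligned \<Psi> \<Phi>"
    using \<omega> by (simp add: pos_section_def ray_state_ray[OF irr \<Psi>])
qed

section \<open>Distances between vector states\<close>

lemma vector_state_diff_apply:
  assumes \<pi>: "representation \<pi>"
  shows "2 * (vector_state \<pi> x - vector_state \<pi> y) B =
    cinner (x - y) (\<pi> B (x + y)) + cinner (x + y) (\<pi> B (x - y))"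
  by (simp add: blinfun.diff_left vector_state_apply[OF \<pi>] clinear_simps[OF representationD(1)[OF \<pi>]] cinner_simps)

text \<open>Keeping the product of |x - y| and |x + y| matters: for unit vectors with positive inner
  product it stays below 2, which the cruder 2 |x - y| may exceed.\<close>

lemma norm_vector_state_diff:
  assumes \<pi>: "representation \<pi>"
  shows "norm (vector_state \<pi> x - vector_state \<pi> y) \<le> norm (x - y) * norm (x + y)"
proof (rule norm_blinfun_bound)
  fix B
  have b: "cmod (cinner u (\<pi> B v)) \<le> norm u * norm v * norm B" for u v
    using norm_cinner_le[of u "\<pi> B v"] mult_left_mono[OF representation_norm_le[OF \<pi>, of B v], of "norm u"]
    by (simp add: mult_ac)
  have "2 * norm ((vector_state \<pi> x - vector_state \<pi> y) B) =
    cmod (cinner (x - y) (\<pi> B (x + y)) + cinner (x + y) (\<pi> B (x - y)))"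
    unfolding vector_state_diff_apply[OF \<pi>, symmetric] by (simp add: norm_mult)
  also have "\<dots> \<le> norm (x - y) * norm (x + y) * norm B + norm (x + y) * norm (x - y) * norm B"
    by (intro norm_triangle_le add_mono b)
  finally show "norm ((vector_state \<pi> x - vector_state \<pi> y) B) \<le> norm (x - y) * norm (x + y) * norm B"
    by (simp add: mult_ac)
qed simp

lemma norm_vector_state_diff_unit:
  assumes "representation \<pi>" "norm x = 1" "norm y = 1"
  shows "norm (vector_state \<pi> x - vector_state \<pi> y) \<le> 2 * norm (x - y)"
proof -
  have "norm (x - y) * norm (x + y) \<le> norm (x - y) * 2"
    using norm_triangle_ineq[of x y] assms by (intro mult_left_mono) auto
  then show ?thesis using norm_vector_state_diff[OF assms(1), of x y] by simp
qed

text \<open>Turn y by a phase into z so that the inner product with x becomes some r > 0. Then |z -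
  x|^2 |z + x|^2 = (2 - 2 r) (2 + 2 r) = 4 - 4 r^2 < 4.\<close>

lemma vector_states_near:
  assumes \<pi>: "representation \<pi>" and x: "norm x = 1" and y: "norm y = 1" and nz: "cinner x y \<noteq> 0"
  shows "norm (vector_state \<pi> y - vector_state \<pi> x) < 2"
proof -
  define z where "z = aligned x y"
  have z: "norm z = 1" "0 < cinner x z" using aligned[OF nz] by (auto simp: z_def)
  have vz: "vector_state \<pi> z = vector_state \<pi> y"
    unfolding z_def by (rule vector_state_aligned[OF \<pi> nz]) (simp add: y)
  define r where "r = Re (cinner x z)"
  have r: "r > 0" using z by (simp add: r_def less_complex_def)
  have "Re (cinner z x) = r" using cinner_commute[of z x] by (simp add: r_def)
  then have sq: "(norm (z - x))\<^sup>2 = 2 - 2 * r" "(norm (z + x))\<^sup>2 = 2 + 2 * r"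
    using x z by (simp_all add: norm_sq_cinner cinner_simps r_def) (simp_all add: cinner_self)
  have "(norm (z - x) * norm (z + x))\<^sup>2 = 4 - 4 * r\<^sup>2"
    unfolding power_mult_distrib sq by (simp add: algebra_simps power2_eq_square)
  also have "\<dots> < 2\<^sup>2" using r by simp
  finally have "norm (z - x) * norm (z + x) < 2" by (rule power2_less_imp_less) simp
  then show ?thesis using norm_vector_state_diff[OF \<pi>, of z x] by (simp add: vz)
qed

lemma vector_states_orthogonal:
  assumes irr: "nonzero_irreducible_rep \<pi>" and x: "norm x = 1" and y: "norm y = 1" and "cinner x y = 0"
  shows "2 \<le> norm (vector_state \<pi> y - vector_state \<pi> x)"
proof (rule ccontr)
  assume "\<not> ?thesis"
  then have "vector_state \<pi> y \<in> state_ball (vector_state \<pi> x)"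
    using vector_state_pure[OF irr y] by (simp add: state_ball_def)
  moreover have "y \<noteq> 0" using y by auto
  ultimately have "cinner x y \<noteq> 0" by (rule state_ball_vector(1)[OF irr x]) (simp add: y)
  then show False using assms by simp
qed

text \<open>For unit vectors \<open>y\<close> orthogonal to \<open>\<Omega>\<close>, polarisation writes the difference of the
  vector states of \<open>(\<Omega> \<plusminus> y) / \<surd>2\<close> as \<open>\<langle>\<Omega>, \<pi>(B) y\<rangle> + \<langle>y, \<pi>(B) \<Omega>\<rangle>\<close>.\<close>

lemma norm_le_of_vector_functional_bound:
  fixes \<pi> :: "'b::c_star_algebra \<Rightarrow> ('h::complex_hilbert_space \<Rightarrow>\<^sub>L 'h)"
  assumes irr: "nonzero_irreducible_rep \<pi>" and \<Omega>: "norm \<Omega> = 1"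
    and bd: "\<And>B. cmod (cinner \<zeta> (\<pi> B \<Omega>)) \<le> c * norm B"
  shows "norm \<zeta> \<le> 3 * c"
proof -
  have \<pi>: "representation \<pi>" using irr by (rule irreducible_representation)
  define l where "l = cinner \<Omega> \<zeta>"
  let ?\<omega> = "vector_state \<pi> \<Omega>"
  have c: "0 \<le> c"
  proof -
    obtain B :: 'b where "B \<noteq> 0"
      using irr clinear_simps(3)[OF representation_vec_clinear[OF \<pi>]]
      by (metis \<Omega> irreducible_nondegenerate[OF irr] norm_zero zero_neq_one)
    then show ?thesis using order_trans[OF norm_ge_zero bd[of B]] by (simp add: zero_le_mult_iff)
  qed
  \<comment> \<open>The component along \<Omega> is tested on approximate units u: |\<Omega> -
    \<pi>(u) \<Omega>|^2 \<le> 1 - \<omega>(u) tends to 0, so <\<zeta>, \<Omega>> is a limit of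
    values bounded by c.\<close>
  have l: "cmod l \<le> c"
  proof -
    have "((\<lambda>u. c + norm \<zeta> * sqrt (1 - Re (?\<omega> u))) \<longlongrightarrow> c + norm \<zeta> * sqrt (1 - norm ?\<omega>)) approx_unit"
      by (intro tendsto_intros pos_functional_approx_unit pos_functional_vector_state[OF \<pi>])
    then have "((\<lambda>u. c + norm \<zeta> * sqrt (1 - Re (?\<omega> u))) \<longlongrightarrow> c) approx_unit"
      by (simp add: norm_vector_state[OF irr] \<Omega>)
    then show ?thesis
    proof (rule tendsto_lowerbound)
      show "eventually (\<lambda>u. cmod l \<le> c + norm \<zeta> * sqrt (1 - Re (?\<omega> u))) approx_unit"
        using eventually_unit_interval
      proof eventually_elim
        case (elim u)
        have sa: "star u = u" by (rule unit_interval_sa[OF elim])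
        have uu: "Re (?\<omega> (star u * u)) \<le> Re (?\<omega> u)"
          by (rule pos_functional_unit_interval(1)[OF pos_functional_vector_state[OF \<pi>] elim])
        have "cinner (\<pi> u \<Omega>) \<Omega> = ?\<omega> u" using representationD(5)[OF \<pi>, of u \<Omega> \<Omega>] by (simp add: sa vector_state_apply[OF \<pi>])
        then have "(norm (\<Omega> - \<pi> u \<Omega>))\<^sup>2 = 1 - 2 * Re (?\<omega> u) + Re (?\<omega> (star u * u))"
          using \<Omega> unfolding norm_sq_cinner vector_state_square[OF \<pi>]
          by (simp add: cinner_simps vector_state_apply[OF \<pi>]) (simp add: cinner_self)
        then have "norm (\<Omega> - \<pi> u \<Omega>) \<le> sqrt (1 - Re (?\<omega> u))" using uu by (simp add: real_le_rsqrt)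
        have "cmod l = cmod (cinner \<zeta> \<Omega>)" unfolding l_def by (metis cinner_commute complex_mod_cnj)
        also have "cinner \<zeta> \<Omega> = cinner \<zeta> (\<pi> u \<Omega>) + cinner \<zeta> (\<Omega> - \<pi> u \<Omega>)" by (simp add: cinner_simps)
        also have "cmod \<dots> \<le> c * norm u + norm \<zeta> * norm (\<Omega> - \<pi> u \<Omega>)"
          by (intro norm_triangle_le add_mono bd norm_cinner_le)
        also have "\<dots> \<le> c * 1 + norm \<zeta> * sqrt (1 - Re (?\<omega> u))"
          by (intro add_mono mult_left_mono c unit_interval_norm[OF elim] norm_ge_zero) fact
        finally show ?case by simp
      qed
    qed simp
  qed
  define \<eta> where "\<eta> = \<zeta> - l *\<^sub>C \<Omega>"
  \<comment> \<open>The functional of \<eta> has bound 2 c, one c from \<zeta> and one from l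
    \<Omega>. For y = \<eta> / |\<eta>| the two states are then at distance at most 4 c / |\<eta>|,
    which must be at least 2. Adding l \<Omega> back makes the constant 3.\<close>
  have "norm \<eta> \<le> 2 * c"
  proof (cases "\<eta> = 0")
    case False
    define y where "y = (1 / norm \<eta>) *\<^sub>R \<eta>"
    have y: "norm y = 1" using False by (simp add: y_def)
    have "cinner \<Omega> \<eta> = 0" using \<Omega> by (simp add: \<eta>_def cinner_simps l_def cinner_self)
    then have oy: "cinner \<Omega> y = 0" by (simp add: y_def cinner.scaleR_right)
    then have yo: "cinner y \<Omega> = 0" using cinner_commute[of y \<Omega>] by simp
    have \<eta>B: "cmod (cinner y (\<pi> B \<Omega>)) \<le> 2 * c / norm \<eta> * norm B" for B
    proof -
      have "cinner \<eta> (\<pi> B \<Omega>) = cinner \<zeta> (\<pi> B \<Omega>) - cnj l * cinner \<Omega> (\<pi> B \<Omega>)"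
        by (simp add: \<eta>_def cinner_simps)
      also have "cmod \<dots> \<le> c * norm B + c * norm B"
      proof (rule order_trans[OF norm_triangle_ineq4 add_mono[OF bd]])
        have "cmod (cinner \<Omega> (\<pi> B \<Omega>)) \<le> norm B"
          using norm_cinner_le[of \<Omega> "\<pi> B \<Omega>"] representation_norm_le[OF \<pi>, of B \<Omega>] by (simp add: \<Omega>)
        then show "cmod (cnj l * cinner \<Omega> (\<pi> B \<Omega>)) \<le> c * norm B"
          using l c by (simp add: norm_mult mult_mono)
      qed
      finally show ?thesis using False by (simp add: y_def cinner.scaleR_left divide_simps)
    qed
    define s where "s = 1 / sqrt 2"
    have ss: "s * s = 1/2" by (simp add: s_def)
    define p where "p = s *\<^sub>R (\<Omega> + y)"
    define m where "m = s *\<^sub>R (\<Omega> - y)"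
    have "(norm p)\<^sup>2 = 1" "(norm m)\<^sup>2 = 1"
      unfolding norm_sq_cinner p_def m_def cinner.scaleR_left cinner.scaleR_right scaleR_scaleR ss
      using \<Omega> y by (simp_all add: cinner_simps oy yo) (simp_all add: cinner_self)
    moreover have "norm u = 1" if "(norm u)\<^sup>2 = 1" for u :: 'h
      using that power2_eq_iff_nonneg[of "norm u" 1] by simp
    ultimately have pm: "norm p = 1" "norm m = 1" by blast+
    have "cinner m p = 0"
      unfolding p_def m_def cinner.scaleR_left cinner.scaleR_right
      using \<Omega> y by (simp add: cinner_simps oy yo cinner_self)
    then have "2 \<le> norm (vector_state \<pi> p - vector_state \<pi> m)"
      by (rule vector_states_orthogonal[OF irr pm(2,1)])
    also have "\<dots> \<le> 4 * c / norm \<eta>"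
    proof (rule norm_blinfun_bound)
      fix B
      have "(vector_state \<pi> p - vector_state \<pi> m) B = (2 * (s * s)) *\<^sub>R (cinner \<Omega> (\<pi> B y) + cinner y (\<pi> B \<Omega>))"
        by (simp add: p_def m_def blinfun.diff_left vector_state_apply[OF \<pi>] clinear_simps[OF representationD(1)[OF \<pi>]]
            cinner_simps cinner.scaleR_left cinner.scaleR_right scaleR_conv_of_real algebra_simps)
      also have "\<dots> = cinner \<Omega> (\<pi> B y) + cinner y (\<pi> B \<Omega>)" by (simp add: ss)
      also have "cmod \<dots> \<le> 2 * c / norm \<eta> * norm (star B) + 2 * c / norm \<eta> * norm B"
      proof (intro norm_triangle_le add_mono \<eta>B)
        have "cmod (cinner \<Omega> (\<pi> B y)) = cmod (cinner y (\<pi> (star B) \<Omega>))"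
          by (metis representationD(5)[OF \<pi>] cinner_commute complex_mod_cnj)
        also have "\<dots> \<le> 2 * c / norm \<eta> * norm (star B)" by (rule \<eta>B)
        finally show "cmod (cinner \<Omega> (\<pi> B y)) \<le> 2 * c / norm \<eta> * norm (star B)" .
      qed
      finally show "norm ((vector_state \<pi> p - vector_state \<pi> m) B) \<le> 4 * c / norm \<eta> * norm B" by simp
    qed (use c in simp)
    finally show ?thesis using False by (simp add: field_simps)
  qed (use c in simp)
  moreover have "norm \<zeta> \<le> norm \<eta> + cmod l * norm \<Omega>"
    using norm_triangle_ineq[of \<eta> "l *\<^sub>C \<Omega>"] by (simp add: \<eta>_def norm_scaleC_hilbert)
  ultimately show ?thesis using l \<Omega> by simp
qed

text \<open>The bound is by |B| and not by |\<pi>(B) \<Omega>|, so density of the orbit does not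
  turn it into an operator bound. Passing to adjoints does: for \<zeta> the difference of the
  inverses of V and V' at y, it says that B |-> <\<zeta>, \<pi>(B) \<Omega>> is small, and
  \<open>norm_le_of_vector_functional_bound\<close> then makes \<zeta> small.\<close>

lemma unitaries_near:
  fixes V V' :: "'h::complex_hilbert_space \<Rightarrow>\<^sub>L 'k::complex_hilbert_space"
  assumes irr: "nonzero_irreducible_rep \<pi>" and \<Omega>: "norm \<Omega> = 1" and V: "V \<in> unitaries" and V': "V' \<in> unitaries"
    and bd: "\<And>B. norm (V (\<pi> B \<Omega>) - V' (\<pi> B \<Omega>)) \<le> e * norm B"
  shows "norm (V - V') \<le> 3 * e"
proof (rule norm_blinfun_bound)
  have adj: "cinner (inv (blinfun_apply T) y) x = cinner y (T x)" if "T \<in> unitaries" for T :: "'h \<Rightarrow>\<^sub>L 'k" and x y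
  proof -
    have "T (inv (blinfun_apply T) y) = y" using that by (simp add: unitaries_def surj_f_inv_f)
    moreover have "cinner (T (inv (blinfun_apply T) y)) (T x) = cinner (inv (blinfun_apply T) y) x"
      using that by (simp add: unitaries_def)
    ultimately show ?thesis by simp
  qed
  have W: "norm (inv (blinfun_apply V) y - inv (blinfun_apply V') y) \<le> 3 * (norm y * e)" for y
  proof (rule norm_le_of_vector_functional_bound[OF irr \<Omega>])
    fix B
    have "cinner (inv (blinfun_apply V) y - inv (blinfun_apply V') y) (\<pi> B \<Omega>) = cinner y (V (\<pi> B \<Omega>) - V' (\<pi> B \<Omega>))"
      by (simp add: cinner_simps adj[OF V] adj[OF V'])
    also have "cmod \<dots> \<le> norm y * (e * norm B)"
      by (rule order_trans[OF norm_cinner_le mult_left_mono[OF bd]]) simp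
    finally show "cmod (cinner (inv (blinfun_apply V) y - inv (blinfun_apply V') y) (\<pi> B \<Omega>)) \<le> norm y * e * norm B"
      by (simp add: mult.assoc)
  qed
  show e: "0 \<le> 3 * e"
  proof -
    obtain y :: 'h where "y \<noteq> 0" using \<Omega> by (metis norm_zero zero_neq_one)
    then have "V y \<noteq> 0"
      using V by (auto simp: unitaries_def) (metis cinner.zero_left cinner_self norm_eq_zero of_real_eq_0_iff power_eq_0_iff)
    moreover have "0 \<le> 3 * (norm (V y) * e)" using W[of "V y"] norm_ge_zero order_trans by blast
    ultimately show ?thesis by (simp add: zero_le_mult_iff)
  qed
  fix x
  let ?y = "(V - V') x"
  have "cinner ?y ?y = cinner (inv (blinfun_apply V) ?y - inv (blinfun_apply V') ?y) x"
    by (simp add: cinner_simps adj[OF V] adj[OF V'] blinfun.diff_left)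
  then have "(norm ?y)\<^sup>2 = cmod (cinner (inv (blinfun_apply V) ?y - inv (blinfun_apply V') ?y) x)"
    by (metis cinner_self norm_of_real abs_of_nonneg zero_le_power2)
  also have "\<dots> \<le> 3 * (norm ?y * e) * norm x"
    by (rule order_trans[OF norm_cinner_le mult_right_mono[OF W]]) simp
  finally have "norm ?y * norm ?y \<le> norm ?y * (3 * e * norm x)" by (simp add: power2_eq_square mult_ac)
  then show "norm ?y \<le> 3 * e * norm x"
    using e by (cases "?y = 0") (auto intro: mult_nonneg_nonneg)
qed

section \<open>Transport by \<open>*\<close>-isomorphisms\<close>

text \<open>Adjoining units on both sides makes the homomorphism unital, as
  \<open>star_hom_contractive\<close> requires.\<close>

lemma star_hom_norm_le:
  fixes f :: "'a::c_star_algebra \<Rightarrow> 'b::c_star_algebra"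
  assumes f: "clinear f" "\<And>x y. f (x * y) = f x * f y" "\<And>x. f (star x) = star (f x)"
  shows "norm (f x) \<le> norm x"
proof -
  define F where "F z = Adj (f (ipart z)) (spart z)" for z :: "'a unitization"
  note [simp] = clinear_simps[OF f(1)] f(2,3)
  have "norm (F (emb x)) \<le> norm (emb x)"
    by (rule star_hom_contractive)
      (auto simp: clinear_def F_def intro!: unitization_eqI)
  moreover have "F (emb x) = emb (f x)" by (simp add: F_def emb_def)
  ultimately show ?thesis by simp
qed

lemma star_isosD:
  assumes "\<alpha> \<in> star_isos"
  shows "clinear (blinfun_apply \<alpha>)" "bij (blinfun_apply \<alpha>)" "\<alpha> (x * y) = \<alpha> x * \<alpha> y" "\<alpha> (star x) = star (\<alpha> x)"
    "inv (blinfun_apply \<alpha>) (\<alpha> x) = x" "\<alpha> (inv (blinfun_apply \<alpha>) z) = z"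
  using assms by (auto simp: star_isos_def bij_is_inj bij_is_surj surj_f_inv_f)

lemma star_isos_inv:
  assumes \<alpha>: "\<alpha> \<in> star_isos"
  shows "clinear (inv (blinfun_apply \<alpha>))" "inv (blinfun_apply \<alpha>) (x * y) = inv (blinfun_apply \<alpha>) x * inv (blinfun_apply \<alpha>) y"
    "inv (blinfun_apply \<alpha>) (star x) = star (inv (blinfun_apply \<alpha>) x)"
proof -
  note D = star_isosD[OF \<alpha>] and lin = clinear_simps[OF star_isosD(1)[OF \<alpha>]]
  have eq: "inv (blinfun_apply \<alpha>) a = b" if "a = \<alpha> b" for a b using that D(5) by simp
  show "clinear (inv (blinfun_apply \<alpha>))"
    unfolding clinear_def by (auto intro!: eq simp: lin D)
  show "inv (blinfun_apply \<alpha>) (x * y) = inv (blinfun_apply \<alpha>) x * inv (blinfun_apply \<alpha>) y"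
    "inv (blinfun_apply \<alpha>) (star x) = star (inv (blinfun_apply \<alpha>) x)"
    by (auto intro!: eq simp: D)
qed

lemma star_isos_norm_le:
  assumes \<alpha>: "\<alpha> \<in> star_isos"
  shows "norm (\<alpha> x) \<le> norm x" "norm (inv (blinfun_apply \<alpha>) y) \<le> norm y"
  by (rule star_hom_norm_le; simp add: star_isosD[OF \<alpha>] star_isos_inv[OF \<alpha>])+

lemma irreducible_comp:
  fixes f :: "'c::c_star_algebra \<Rightarrow> 'b::c_star_algebra"
  assumes irr: "nonzero_irreducible_rep \<pi>" and f: "clinear f" "\<And>x y. f (x * y) = f x * f y" "\<And>x. f (star x) = star (f x)" "surj f"
  shows "nonzero_irreducible_rep (\<lambda>C. \<pi> (f C))"
proof -
  have \<pi>: "representation \<pi>" using irr by (rule irreducible_representation)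
  have "representation (\<lambda>C. \<pi> (f C))"
    using \<pi> f by (simp add: representation_def clinear_simps[OF f(1)])
  moreover have "\<exists>C. \<pi> (f C) \<noteq> 0" using irr f(4) unfolding nonzero_irreducible_rep_def by (metis surjD)
  moreover have "S = {0} \<or> S = UNIV" if "closed_csubspace S" "\<forall>C. \<forall>x\<in>S. \<pi> (f C) x \<in> S" for S
    using irreducible_subspace[OF irr that(1)] that(2) f(4) by (metis surjD)
  ultimately show ?thesis by (simp add: nonzero_irreducible_rep_def)
qed

text \<open>Moves \<alpha> from the state to the representation: a pushed vector state is again a
  vector state, now of an irreducible representation of the target algebra on the same Hilbert
  space.\<close>

definition transport :: "('b::c_star_algebra \<Rightarrow> 'x) \<Rightarrow> ('b \<Rightarrow>\<^sub>L 'c::c_star_algebra) \<Rightarrow> 'c \<Rightarrow> 'x" where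
  "transport \<pi> \<alpha> = (\<lambda>C. \<pi> (inv (blinfun_apply \<alpha>) C))"

lemma irreducible_transport:
  assumes "nonzero_irreducible_rep \<pi>" "\<alpha> \<in> star_isos"
  shows "nonzero_irreducible_rep (transport \<pi> \<alpha>)"
  unfolding transport_def
  by (rule irreducible_comp[OF assms(1), where f="inv (blinfun_apply \<alpha>)"])
    (simp_all add: star_isos_inv[OF assms(2)] bij_is_surj bij_imp_bij_inv star_isosD(2)[OF assms(2)])

lemma push_vector_state:
  assumes "nonzero_irreducible_rep \<pi>" "norm \<Omega> = 1"
  shows "push_state \<alpha> (ray_state \<pi> (ray \<Omega>)) = vector_state (transport \<pi> \<alpha>) \<Omega>"
proof -
  have "blinfun_apply (vector_state \<pi> \<Omega>) \<circ> inv (blinfun_apply \<alpha>) = (\<lambda>C. cinner \<Omega> (transport \<pi> \<alpha> C \<Omega>))"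
    by (simp add: fun_eq_iff transport_def vector_state_apply[OF irreducible_representation[OF assms(1)]])
  then show ?thesis by (simp add: push_state_def ray_state_ray[OF assms] vector_state_def)
qed

section \<open>The set of near triples\<close>

lemma near_triples_iff:
  fixes \<pi> :: "'b::c_star_algebra \<Rightarrow> ('h::complex_hilbert_space \<Rightarrow>\<^sub>L 'h)"
    and \<rho> :: "'c::c_star_algebra \<Rightarrow> ('k::complex_hilbert_space \<Rightarrow>\<^sub>L 'k)"
  assumes irr: "nonzero_irreducible_rep \<pi>" "nonzero_irreducible_rep \<rho>"
  shows "(\<alpha>, \<Omega>, \<Psi>) \<in> near_triples \<pi> \<rho> \<longleftrightarrow> \<alpha> \<in> star_isos \<and> norm \<Omega> = 1 \<and> norm \<Psi> = 1 \<and>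
    norm (vector_state (transport \<pi> \<alpha>) \<Omega> - vector_state \<rho> \<Psi>) < 2"
  using vector_state_pure[OF irreducible_transport[OF irr(1)]]
  by (auto simp: near_triples_def state_ball_def push_vector_state[OF irr(1)] ray_state_ray[OF irr(2)])

lemma norm_transport_diff:
  assumes irr: "nonzero_irreducible_rep \<pi>" and \<alpha>: "\<alpha> \<in> star_isos" and \<beta>: "\<beta> \<in> star_isos"
    and n: "norm \<Omega> = 1" "norm \<Omega>' = 1"
  shows "norm (vector_state (transport \<pi> \<alpha>) \<Omega> - vector_state (transport \<pi> \<beta>) \<Omega>') \<le> norm (\<alpha> - \<beta>) + 2 * norm (\<Omega> - \<Omega>')"
proof -
  have \<pi>: "representation \<pi>" using irr by (rule irreducible_representation)
  have \<pi>\<alpha>: "representation (transport \<pi> \<alpha>)" and \<pi>\<beta>: "representation (transport \<pi> \<beta>)"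
    using irreducible_transport[OF irr] \<alpha> \<beta> by (auto intro: irreducible_representation)
  have "norm (vector_state (transport \<pi> \<alpha>) \<Omega> - vector_state (transport \<pi> \<beta>) \<Omega>) \<le> norm (\<alpha> - \<beta>)"
  proof (rule norm_blinfun_bound)
    fix C
    let ?a = "inv (blinfun_apply \<alpha>)" and ?b = "inv (blinfun_apply \<beta>)"
    \<comment> \<open>A resolvent-type identity; since the inverses are contractive, it makes
      inversion 1-Lipschitz on isomorphisms.\<close>
    have "?a C - ?b C = ?a ((\<beta> - \<alpha>) (?b C))"
      by (simp add: clinear_simps[OF star_isos_inv(1)[OF \<alpha>]] blinfun.diff_left star_isosD[OF \<alpha>] star_isosD[OF \<beta>])
    then have "norm (?a C - ?b C) \<le> norm ((\<beta> - \<alpha>) (?b C))" by (simp add: star_isos_norm_le[OF \<alpha>])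
    also have "\<dots> \<le> norm (\<beta> - \<alpha>) * norm (?b C)" by (rule norm_blinfun)
    also have "\<dots> \<le> norm (\<beta> - \<alpha>) * norm C" by (intro mult_left_mono star_isos_norm_le[OF \<beta>]) simp
    finally have ab: "norm (?a C - ?b C) \<le> norm (\<alpha> - \<beta>) * norm C" by (simp add: norm_minus_commute)
    have "(vector_state (transport \<pi> \<alpha>) \<Omega> - vector_state (transport \<pi> \<beta>) \<Omega>) C = cinner \<Omega> (\<pi> (?a C - ?b C) \<Omega>)"
      by (simp add: blinfun.diff_left vector_state_apply[OF \<pi>\<alpha>] vector_state_apply[OF \<pi>\<beta>])
        (simp add: transport_def cinner_simps clinear_simps[OF representation_vec_clinear[OF \<pi>]])
    also have "cmod \<dots> \<le> norm (?a C - ?b C)"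
      using norm_cinner_le[of \<Omega> "\<pi> (?a C - ?b C) \<Omega>"] representation_norm_le[OF \<pi>, of "?a C - ?b C" \<Omega>] by (simp add: n)
    finally show "norm ((vector_state (transport \<pi> \<alpha>) \<Omega> - vector_state (transport \<pi> \<beta>) \<Omega>) C) \<le> norm (\<alpha> - \<beta>) * norm C"
      using ab by simp
  qed simp
  moreover have "norm (vector_state (transport \<pi> \<beta>) \<Omega> - vector_state (transport \<pi> \<beta>) \<Omega>') \<le> 2 * norm (\<Omega> - \<Omega>')"
    by (rule norm_vector_state_diff_unit[OF \<pi>\<beta> n])
  ultimately show ?thesis by (rule norm_diff_triangle_le)
qed

lemma tendsto_transport:
  assumes irr: "nonzero_irreducible_rep \<pi>" and \<alpha>: "\<And>n. \<alpha> n \<in> star_isos" "\<alpha>0 \<in> star_isos" "\<alpha> \<longlonglongrightarrow> \<alpha>0"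
    and \<Omega>: "\<And>n. norm (\<Omega> n) = 1" "norm \<Omega>0 = 1" "\<Omega> \<longlonglongrightarrow> \<Omega>0"
  shows "(\<lambda>n. vector_state (transport \<pi> (\<alpha> n)) (\<Omega> n)) \<longlonglongrightarrow> vector_state (transport \<pi> \<alpha>0) \<Omega>0"
proof -
  have "(\<lambda>n. norm (\<alpha> n - \<alpha>0) + 2 * norm (\<Omega> n - \<Omega>0)) \<longlonglongrightarrow> norm (\<alpha>0 - \<alpha>0) + 2 * norm (\<Omega>0 - \<Omega>0)"
    by (intro tendsto_intros \<alpha>(3) \<Omega>(3))
  then have "(\<lambda>n. norm (\<alpha> n - \<alpha>0) + 2 * norm (\<Omega> n - \<Omega>0)) \<longlonglongrightarrow> 0" by simp
  then have "(\<lambda>n. vector_state (transport \<pi> (\<alpha> n)) (\<Omega> n) - vector_state (transport \<pi> \<alpha>0) \<Omega>0) \<longlonglongrightarrow> 0"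
    by (rule Lim_null_comparison[OF always_eventually, rotated])
      (intro allI norm_transport_diff[OF irr] \<alpha> \<Omega>)
  then show ?thesis by (simp add: LIM_zero_iff)
qed

lemma tendsto_vector_state:
  assumes \<pi>: "representation \<pi>" and \<Omega>: "\<And>n. norm (\<Omega> n) = 1" "norm \<Omega>0 = 1" "\<Omega> \<longlonglongrightarrow> \<Omega>0"
  shows "(\<lambda>n. vector_state \<pi> (\<Omega> n)) \<longlonglongrightarrow> vector_state \<pi> \<Omega>0"
proof -
  have "(\<lambda>n. 2 * norm (\<Omega> n - \<Omega>0)) \<longlonglongrightarrow> 2 * norm (\<Omega>0 - \<Omega>0)"
    by (intro tendsto_intros \<Omega>(3))
  then have "(\<lambda>n. 2 * norm (\<Omega> n - \<Omega>0)) \<longlonglongrightarrow> 0" by simp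
  then have "(\<lambda>n. vector_state \<pi> (\<Omega> n) - vector_state \<pi> \<Omega>0) \<longlonglongrightarrow> 0"
    by (rule Lim_null_comparison[OF always_eventually, rotated])
      (intro allI norm_vector_state_diff_unit[OF \<pi>] \<Omega>)
  then show ?thesis by (simp add: LIM_zero_iff)
qed

text \<open>The set is the preimage of the numbers below 2 under the distance of the two states,
  which is jointly continuous in the triple.\<close>

lemma openin_near_triples:
  fixes \<pi> :: "'b::c_star_algebra \<Rightarrow> ('h::complex_hilbert_space \<Rightarrow>\<^sub>L 'h)"
    and \<rho> :: "'c::c_star_algebra \<Rightarrow> ('k::complex_hilbert_space \<Rightarrow>\<^sub>L 'k)"
  assumes irr: "nonzero_irreducible_rep \<pi>" "nonzero_irreducible_rep \<rho>"
  shows "openin (top_of_set (star_isos \<times> sphere 0 1 \<times> sphere 0 1)) (near_triples \<pi> \<rho>)"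
proof -
  let ?X = "star_isos \<times> sphere 0 1 \<times> sphere 0 1 :: (('b \<Rightarrow>\<^sub>L 'c) \<times> 'h \<times> 'k) set"
  define F where "F = (\<lambda>(\<alpha>, \<Omega>, \<Psi>). norm (vector_state (transport \<pi> \<alpha>) \<Omega> - vector_state \<rho> \<Psi>))"
  have "continuous_on ?X F"
    unfolding continuous_on_sequentially
  proof (intro ballI allI impI)
    fix x0 x assume x0: "x0 \<in> ?X" and x: "(\<forall>n::nat. x n \<in> ?X) \<and> x \<longlonglongrightarrow> x0"
    have lims: "(\<lambda>n. fst (x n)) \<longlonglongrightarrow> fst x0" "(\<lambda>n. fst (snd (x n))) \<longlonglongrightarrow> fst (snd x0)"
      "(\<lambda>n. snd (snd (x n))) \<longlonglongrightarrow> snd (snd x0)"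
      using x tendsto_fst[of x x0] tendsto_fst[OF tendsto_snd[of x x0]] tendsto_snd[OF tendsto_snd[of x x0]]
      by auto
    have mem: "fst (x n) \<in> star_isos" "norm (fst (snd (x n))) = 1" "norm (snd (snd (x n))) = 1" for n
      using x by (metis mem_Times_iff mem_sphere_0)+
    have mem0: "fst x0 \<in> star_isos" "norm (fst (snd x0)) = 1" "norm (snd (snd x0)) = 1"
      using x0 by (auto simp: mem_Times_iff)
    have "(\<lambda>n. norm (vector_state (transport \<pi> (fst (x n))) (fst (snd (x n))) - vector_state \<rho> (snd (snd (x n)))))
      \<longlonglongrightarrow> norm (vector_state (transport \<pi> (fst x0)) (fst (snd x0)) - vector_state \<rho> (snd (snd x0)))"
      by (intro tendsto_norm tendsto_diff tendsto_transport[OF irr(1)] tendsto_vector_state[OF irreducible_representation[OF irr(2)]]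
          mem mem0 lims)
    then show "(F \<circ> x) \<longlonglongrightarrow> F x0" by (simp add: F_def o_def case_prod_unfold)
  qed
  then have "openin (top_of_set ?X) (?X \<inter> F -` {..<2})"
    by (rule continuous_openin_preimage_gen) simp
  also have "?X \<inter> F -` {..<2} = near_triples \<pi> \<rho>"
    by (auto simp: near_triples_iff[OF irr] F_def)
  finally show ?thesis .
qed

section \<open>The lifted vector and its continuity\<close>

lemma lift_map_eq:
  fixes \<pi> :: "'b::c_star_algebra \<Rightarrow> ('h::complex_hilbert_space \<Rightarrow>\<^sub>L 'h)"
    and \<rho> :: "'c::c_star_algebra \<Rightarrow> ('k::complex_hilbert_space \<Rightarrow>\<^sub>L 'k)"
  assumes irr: "nonzero_irreducible_rep \<pi>" "nonzero_irreducible_rep \<rho>"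
    and x: "(\<alpha>, \<Omega>, \<Psi>) \<in> near_triples \<pi> \<rho>"
    and \<Phi>: "\<Phi> \<noteq> 0" "vector_state \<rho> \<Phi> = (norm \<Phi>)\<^sup>2 *\<^sub>R vector_state (transport \<pi> \<alpha>) \<Omega>"
  shows "lift_map \<pi> \<rho> (\<alpha>, \<Omega>, \<Psi>) = aligned \<Psi> \<Phi>" "cinner \<Psi> \<Phi> \<noteq> 0"
proof -
  have ball: "vector_state (transport \<pi> \<alpha>) \<Omega> \<in> state_ball (vector_state \<rho> \<Psi>)" and n: "norm \<Omega> = 1" "norm \<Psi> = 1"
    using x vector_state_pure[OF irreducible_transport[OF irr(1)]]
    by (auto simp: near_triples_iff[OF irr] state_ball_def)
  show "lift_map \<pi> \<rho> (\<alpha>, \<Omega>, \<Psi>) = aligned \<Psi> \<Phi>" "cinner \<Psi> \<Phi> \<noteq> 0"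
    using state_ball_vector[OF irr(2) n(2) ball \<Phi>] by (auto simp: lift_map_def push_vector_state[OF irr(1) n(1)])
qed

lemma lift_map:
  fixes \<pi> :: "'b::c_star_algebra \<Rightarrow> ('h::complex_hilbert_space \<Rightarrow>\<^sub>L 'h)"
    and \<rho> :: "'c::c_star_algebra \<Rightarrow> ('k::complex_hilbert_space \<Rightarrow>\<^sub>L 'k)"
  assumes irr: "nonzero_irreducible_rep \<pi>" "nonzero_irreducible_rep \<rho>"
    and x: "(\<alpha>, \<Omega>, \<Psi>) \<in> near_triples \<pi> \<rho>"
  shows "norm (lift_map \<pi> \<rho> (\<alpha>, \<Omega>, \<Psi>)) = 1"
    "vector_state \<rho> (lift_map \<pi> \<rho> (\<alpha>, \<Omega>, \<Psi>)) = vector_state (transport \<pi> \<alpha>) \<Omega>"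
proof -
  have \<alpha>: "\<alpha> \<in> star_isos" and n: "norm \<Omega> = 1" "norm \<Psi> = 1"
    and near: "norm (vector_state (transport \<pi> \<alpha>) \<Omega> - vector_state \<rho> \<Psi>) < 2"
    using x by (auto simp: near_triples_iff[OF irr])
  obtain \<Phi> where \<Phi>: "\<Phi> \<noteq> 0" "vector_state \<rho> \<Phi> = (norm \<Phi>)\<^sup>2 *\<^sub>R vector_state (transport \<pi> \<alpha>) \<Omega>"
    by (rule pure_state_near_vector_state[OF irr(2) vector_state_pure[OF irreducible_transport[OF irr(1) \<alpha>] n(1)] n(2) near]) blast
  note l = lift_map_eq[OF irr x \<Phi>]
  show "norm (lift_map \<pi> \<rho> (\<alpha>, \<Omega>, \<Psi>)) = 1" using l by (simp add: aligned)
  show "vector_state \<rho> (lift_map \<pi> \<rho> (\<alpha>, \<Omega>, \<Psi>)) = vector_state (transport \<pi> \<alpha>) \<Omega>"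
    using l vector_state_aligned[OF irreducible_representation[OF irr(2)] l(2) \<Phi>(2)] by simp
qed

lemma tendsto_aligned:
  assumes "\<Psi> \<longlonglongrightarrow> \<Psi>0" "\<Phi> \<longlonglongrightarrow> \<Phi>0" "cinner \<Psi>0 \<Phi>0 \<noteq> 0"
  shows "(\<lambda>n. aligned (\<Psi> n) (\<Phi> n)) \<longlonglongrightarrow> aligned \<Psi>0 \<Phi>0"
proof -
  have "\<Phi>0 \<noteq> 0" using assms(3) by (auto simp: cinner.zero_right)
  then show ?thesis
    unfolding aligned_def using assms
    by (intro scaleC_hilbert.tendsto tendsto_intros cinner.tendsto) auto
qed

text \<open>The basic estimate is applied with the limit vector \<Phi>0, and not \<Psi>0, as base
  point: the states tend to that of \<Phi>0, so they are represented by vectors \<Phi> n that tend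
  to \<Phi>0. Aligning \<Phi> n with \<Psi> n gives the values of the section, and alignment is
  continuous away from orthogonal pairs.\<close>

lemma continuous_on_lift_map:
  fixes \<pi> :: "'b::c_star_algebra \<Rightarrow> ('h::complex_hilbert_space \<Rightarrow>\<^sub>L 'h)"
    and \<rho> :: "'c::c_star_algebra \<Rightarrow> ('k::complex_hilbert_space \<Rightarrow>\<^sub>L 'k)"
  assumes irr: "nonzero_irreducible_rep \<pi>" "nonzero_irreducible_rep \<rho>"
  shows "continuous_on (near_triples \<pi> \<rho>) (lift_map \<pi> \<rho>)"
  unfolding continuous_on_sequentially
proof (intro ballI allI impI)
  fix x0 x assume x0: "x0 \<in> near_triples \<pi> \<rho>" and x: "(\<forall>n::nat. x n \<in> near_triples \<pi> \<rho>) \<and> x \<longlonglongrightarrow> x0"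
  obtain \<alpha>0 \<Omega>0 \<Psi>0 where x0_eq: "x0 = (\<alpha>0, \<Omega>0, \<Psi>0)" by (cases x0)
  define \<alpha> \<Omega> \<Psi> where "\<alpha> n = fst (x n)" "\<Omega> n = fst (snd (x n))" "\<Psi> n = snd (snd (x n))" for n
  have x_eq: "x n = (\<alpha> n, \<Omega> n, \<Psi> n)" for n by (simp add: \<alpha>_\<Omega>_\<Psi>_def)
  have lims: "\<alpha> \<longlonglongrightarrow> \<alpha>0" "\<Omega> \<longlonglongrightarrow> \<Omega>0" "\<Psi> \<longlonglongrightarrow> \<Psi>0"
    using x tendsto_fst[of x x0] tendsto_fst[OF tendsto_snd[of x x0]] tendsto_snd[OF tendsto_snd[of x x0]]
    by (auto simp: \<alpha>_\<Omega>_\<Psi>_def[abs_def] x0_eq)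
  have mem: "(\<alpha> n, \<Omega> n, \<Psi> n) \<in> near_triples \<pi> \<rho>" for n using x by (simp flip: x_eq)
  have mem0: "(\<alpha>0, \<Omega>0, \<Psi>0) \<in> near_triples \<pi> \<rho>" using x0 by (simp add: x0_eq)
  have D: "\<alpha> n \<in> star_isos" "norm (\<Omega> n) = 1" "norm (\<Psi> n) = 1" for n using mem[of n] by (auto simp: near_triples_iff[OF irr])
  have D0: "\<alpha>0 \<in> star_isos" "norm \<Omega>0 = 1" "norm \<Psi>0 = 1" using mem0 by (auto simp: near_triples_iff[OF irr])
  define \<Phi>0 where "\<Phi>0 = lift_map \<pi> \<rho> x0"
  define \<omega> where "\<omega> n = vector_state (transport \<pi> (\<alpha> n)) (\<Omega> n)" for n
  have \<Phi>0: "norm \<Phi>0 = 1" "vector_state \<rho> \<Phi>0 = vector_state (transport \<pi> \<alpha>0) \<Omega>0"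
    using lift_map[OF irr mem0] by (simp_all add: \<Phi>0_def x0_eq)
  have "\<Phi>0 \<noteq> 0" using \<Phi>0 by auto
  note al0 = lift_map_eq[OF irr mem0 this, unfolded \<Phi>0, simplified]
  have "\<omega> \<longlonglongrightarrow> vector_state \<rho> \<Phi>0"
    unfolding \<omega>_def[abs_def] \<Phi>0(2) by (intro tendsto_transport irr D D0 lims)
  then have lim0: "(\<lambda>n. norm (\<omega> n - vector_state \<rho> \<Phi>0)) \<longlonglongrightarrow> 0"
    by (simp add: LIM_zero_iff tendsto_norm_zero_iff)
  \<comment> \<open>The estimate is available once the distance is below 2; the implication allows a
    choice of \<Phi> n for all n at once.\<close>
  have "\<exists>\<Phi>. norm (\<omega> n - vector_state \<rho> \<Phi>0) < 2 \<longrightarrow>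
      \<Phi> \<noteq> 0 \<and> (norm (\<Phi>0 - \<Phi>))\<^sup>2 \<le> norm (\<omega> n - vector_state \<rho> \<Phi>0) / 2 \<and> vector_state \<rho> \<Phi> = (norm \<Phi>)\<^sup>2 *\<^sub>R \<omega> n" for n
    using pure_state_near_vector_state[OF irr(2) vector_state_pure[OF irreducible_transport[OF irr(1) D(1)] D(2)] \<Phi>0(1)]
    unfolding \<omega>_def by metis
  then obtain \<Phi> where \<Phi>: "\<And>n. norm (\<omega> n - vector_state \<rho> \<Phi>0) < 2 \<Longrightarrow>
      \<Phi> n \<noteq> 0 \<and> (norm (\<Phi>0 - \<Phi> n))\<^sup>2 \<le> norm (\<omega> n - vector_state \<rho> \<Phi>0) / 2 \<and> vector_state \<rho> (\<Phi> n) = (norm (\<Phi> n))\<^sup>2 *\<^sub>R \<omega> n"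
    by metis
  have ev: "eventually (\<lambda>n. norm (\<omega> n - vector_state \<rho> \<Phi>0) < 2) sequentially"
    by (rule order_tendstoD(2)[OF lim0]) simp
  have "(\<lambda>n. (norm (\<Phi>0 - \<Phi> n))\<^sup>2) \<longlonglongrightarrow> 0"
  proof (rule Lim_null_comparison)
    show "(\<lambda>n. norm (\<omega> n - vector_state \<rho> \<Phi>0) / 2) \<longlonglongrightarrow> 0" using tendsto_divide[OF lim0 tendsto_const[of 2]] by simp
    show "eventually (\<lambda>n. norm ((norm (\<Phi>0 - \<Phi> n))\<^sup>2) \<le> norm (\<omega> n - vector_state \<rho> \<Phi>0) / 2) sequentially"
      using ev by eventually_elim (use \<Phi> in simp)
  qed
  then have "(\<lambda>n. norm (\<Phi>0 - \<Phi> n)) \<longlonglongrightarrow> 0" by simp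
  then have "(\<lambda>n. \<Phi>0 - (\<Phi>0 - \<Phi> n)) \<longlonglongrightarrow> \<Phi>0 - 0"
    by (intro tendsto_diff tendsto_const) (simp add: tendsto_norm_zero_iff)
  then have "\<Phi> \<longlonglongrightarrow> \<Phi>0" by simp
  then have "(\<lambda>n. aligned (\<Psi> n) (\<Phi> n)) \<longlonglongrightarrow> aligned \<Psi>0 \<Phi>0"
    by (intro tendsto_aligned lims al0)
  moreover have "eventually (\<lambda>n. aligned (\<Psi> n) (\<Phi> n) = lift_map \<pi> \<rho> (x n)) sequentially"
    using ev
  proof eventually_elim
    case (elim n)
    then show ?case using \<Phi>[OF elim] lift_map_eq(1)[OF irr mem, of "\<Phi> n" n] by (simp add: x_eq \<omega>_def)
  qed
  ultimately have "(\<lambda>n. lift_map \<pi> \<rho> (x n)) \<longlonglongrightarrow> aligned \<Psi>0 \<Phi>0" by (rule Lim_transform_eventually)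
  then show "(lift_map \<pi> \<rho> \<circ> x) \<longlonglongrightarrow> lift_map \<pi> \<rho> x0" by (simp add: o_def x0_eq al0)
qed

section \<open>The intertwining unitary and its continuity\<close>

text \<open>In the representation \<rho> composed with \<alpha> the lifted vector has the state that
  \<Omega> has in \<pi>, so uniqueness of the GNS representation supplies the unitary.\<close>

lemma ex_lift_unitary:
  fixes \<pi> :: "'b::c_star_algebra \<Rightarrow> ('h::complex_hilbert_space \<Rightarrow>\<^sub>L 'h)"
    and \<rho> :: "'c::c_star_algebra \<Rightarrow> ('k::complex_hilbert_space \<Rightarrow>\<^sub>L 'k)"
  assumes irr: "nonzero_irreducible_rep \<pi>" "nonzero_irreducible_rep \<rho>"
    and x: "(\<alpha>, \<Omega>, \<Psi>) \<in> near_triples \<pi> \<rho>"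
  shows "\<exists>V\<in>unitaries. blinfun_apply V \<circ> orbit_map \<pi> \<Omega> = orbit_map \<rho> (lift_map \<pi> \<rho> (\<alpha>, \<Omega>, \<Psi>)) \<circ> blinfun_apply \<alpha>"
proof -
  have \<alpha>: "\<alpha> \<in> star_isos" and n: "norm \<Omega> = 1" using x by (auto simp: near_triples_iff[OF irr])
  note l = lift_map[OF irr x]
  define \<Phi> where "\<Phi> = lift_map \<pi> \<rho> (\<alpha>, \<Omega>, \<Psi>)"
  have irr': "nonzero_irreducible_rep (\<lambda>B. \<rho> (\<alpha> B))"
    using star_isosD[OF \<alpha>] by (intro irreducible_comp[OF irr(2)]) (auto simp: bij_is_surj)
  have "vector_state \<pi> \<Omega> = vector_state (\<lambda>B. \<rho> (\<alpha> B)) \<Phi>"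
  proof (rule blinfun_eqI)
    fix B
    have "vector_state \<rho> \<Phi> (\<alpha> B) = vector_state (transport \<pi> \<alpha>) \<Omega> (\<alpha> B)" by (simp add: l \<Phi>_def)
    then show "vector_state \<pi> \<Omega> B = vector_state (\<lambda>B. \<rho> (\<alpha> B)) \<Phi> B"
      using irreducible_representation[OF irr(1)] irreducible_representation[OF irr(2)]
        irreducible_representation[OF irr'] irreducible_representation[OF irreducible_transport[OF irr(1) \<alpha>]]
      by (simp add: vector_state_apply star_isosD[OF \<alpha>] transport_def)
  qed
  moreover have "\<Omega> \<noteq> 0" "\<Phi> \<noteq> 0" using n l(1) by (auto simp: \<Phi>_def)
  ultimately obtain V where "V \<in> unitaries" "\<And>B. V (\<pi> B \<Omega>) = \<rho> (\<alpha> B) \<Phi>"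
    using ex_intertwining_unitary[OF irr(1) irr'] by metis
  then show ?thesis by (intro bexI[of _ V]) (auto simp: orbit_map_def \<Phi>_def fun_eq_iff)
qed

lemma intertwinesD:
  assumes "intertwines \<pi> \<rho> U" "(\<alpha>, \<Omega>, \<Psi>) \<in> near_triples \<pi> \<rho>"
  shows "U (\<alpha>, \<Omega>, \<Psi>) (\<pi> B \<Omega>) = \<rho> (\<alpha> B) (lift_map \<pi> \<rho> (\<alpha>, \<Omega>, \<Psi>))"
  using assms by (fastforce simp: intertwines_def orbit_map_def fun_eq_iff)

text \<open>U enters through unitarity and the intertwining equation alone. These bound the
  difference of two values of U on the orbit of the fixed vector \<Omega>0, and
  \<open>unitaries_near\<close> upgrades this to the operator norm.\<close>

lemma continuous_on_intertwiner:
  fixes \<pi> :: "'b::c_star_algebra \<Rightarrow> ('h::complex_hilbert_space \<Rightarrow>\<^sub>L 'h)"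
    and \<rho> :: "'c::c_star_algebra \<Rightarrow> ('k::complex_hilbert_space \<Rightarrow>\<^sub>L 'k)"
  assumes irr: "nonzero_irreducible_rep \<pi>" "nonzero_irreducible_rep \<rho>"
    and U: "U \<in> near_triples \<pi> \<rho> \<rightarrow> unitaries" "intertwines \<pi> \<rho> U"
  shows "continuous_on (near_triples \<pi> \<rho>) U"
  unfolding continuous_on_sequentially
proof (intro ballI allI impI)
  fix x0 x assume x0: "x0 \<in> near_triples \<pi> \<rho>" and x: "(\<forall>n::nat. x n \<in> near_triples \<pi> \<rho>) \<and> x \<longlonglongrightarrow> x0"
  have \<rho>: "representation \<rho>" using irr(2) by (rule irreducible_representation)
  obtain \<alpha>0 \<Omega>0 \<Psi>0 where x0_eq: "x0 = (\<alpha>0, \<Omega>0, \<Psi>0)" by (cases x0)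
  define \<alpha> \<Omega> \<Psi> where "\<alpha> n = fst (x n)" "\<Omega> n = fst (snd (x n))" "\<Psi> n = snd (snd (x n))" for n
  have x_eq: "x n = (\<alpha> n, \<Omega> n, \<Psi> n)" for n by (simp add: \<alpha>_\<Omega>_\<Psi>_def)
  have lims: "\<alpha> \<longlonglongrightarrow> \<alpha>0" "\<Omega> \<longlonglongrightarrow> \<Omega>0"
    using x tendsto_fst[of x x0] tendsto_fst[OF tendsto_snd[of x x0]] by (auto simp: \<alpha>_\<Omega>_\<Psi>_def[abs_def] x0_eq)
  have mem: "(\<alpha> n, \<Omega> n, \<Psi> n) \<in> near_triples \<pi> \<rho>" for n using x by (simp flip: x_eq)
  have mem0: "(\<alpha>0, \<Omega>0, \<Psi>0) \<in> near_triples \<pi> \<rho>" using x0 by (simp add: x0_eq)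
  have D0: "\<alpha>0 \<in> star_isos" "norm \<Omega>0 = 1" using mem0 by (auto simp: near_triples_iff[OF irr])
  define \<Phi> where "\<Phi> n = lift_map \<pi> \<rho> (x n)" for n
  define \<Phi>0 where "\<Phi>0 = lift_map \<pi> \<rho> x0"
  have \<Phi>n: "norm (\<Phi> n) = 1" for n using lift_map(1)[OF irr mem] by (simp add: \<Phi>_def x_eq)
  have \<Phi>lim: "\<Phi> \<longlonglongrightarrow> \<Phi>0"
    using continuous_on_lift_map[OF irr] x0 x unfolding continuous_on_sequentially \<Phi>_def[abs_def] \<Phi>0_def by (auto simp: o_def)
  have un: "U (x n) \<in> unitaries" "U x0 \<in> unitaries" for n using U(1) x x0 by auto
  have iso: "norm (V y) = norm y" if "V \<in> unitaries" for V :: "'h \<Rightarrow>\<^sub>L 'k" and y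
  proof -
    have "(norm (V y))\<^sup>2 = (norm y)\<^sup>2" using that by (simp add: norm_sq_cinner unitaries_def)
    then show ?thesis by simp
  qed
  define e where "e n = norm (\<Omega>0 - \<Omega> n) + norm (\<alpha> n - \<alpha>0) + norm (\<Phi> n - \<Phi>0)" for n
  have bd: "norm (U (x n) - U x0) \<le> 3 * e n" for n
  proof (rule unitaries_near[OF irr(1) D0(2) un])
    fix B
    have U0: "U x0 (\<pi> B \<Omega>0) = \<rho> (\<alpha>0 B) \<Phi>0" using intertwinesD[OF U(2) mem0] by (simp add: \<Phi>0_def x0_eq)
    have Un: "U (x n) (\<pi> B (\<Omega> n)) = \<rho> (\<alpha> n B) (\<Phi> n)" using intertwinesD[OF U(2) mem] by (simp add: \<Phi>_def x_eq)
    \<comment> \<open>One of \<Omega>, \<alpha>, \<Phi> is changed at a time; the three terms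
      account for the summands of e n.\<close>
    have "U (x n) (\<pi> B \<Omega>0) - U x0 (\<pi> B \<Omega>0) =
      U (x n) (\<pi> B (\<Omega>0 - \<Omega> n)) + \<rho> ((\<alpha> n - \<alpha>0) B) (\<Phi> n) + \<rho> (\<alpha>0 B) (\<Phi> n - \<Phi>0)"
      by (simp add: blinfun.diff_right U0 Un blinfun.diff_left clinear_simps[OF representation_vec_clinear[OF \<rho>]])
    also have "norm \<dots> \<le> norm B * norm (\<Omega>0 - \<Omega> n) + norm (\<alpha> n - \<alpha>0) * norm B * 1 + norm B * norm (\<Phi> n - \<Phi>0)"
    proof (intro norm_triangle_le add_mono)
      show "norm (U (x n) (\<pi> B (\<Omega>0 - \<Omega> n))) \<le> norm B * norm (\<Omega>0 - \<Omega> n)"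
        by (simp add: iso[OF un(1)] representation_norm_le[OF irreducible_representation[OF irr(1)]])
      show "norm (\<rho> ((\<alpha> n - \<alpha>0) B) (\<Phi> n)) \<le> norm (\<alpha> n - \<alpha>0) * norm B * 1"
        using order_trans[OF representation_norm_le[OF \<rho>, of "(\<alpha> n - \<alpha>0) B" "\<Phi> n"]] norm_blinfun[of "\<alpha> n - \<alpha>0" B] by (simp add: \<Phi>n)
      show "norm (\<rho> (\<alpha>0 B) (\<Phi> n - \<Phi>0)) \<le> norm B * norm (\<Phi> n - \<Phi>0)"
        by (rule order_trans[OF representation_norm_le[OF \<rho>] mult_right_mono[OF star_isos_norm_le(1)[OF D0(1)]]]) simp
    qed
    finally show "norm (U (x n) (\<pi> B \<Omega>0) - U x0 (\<pi> B \<Omega>0)) \<le> e n * norm B" by (simp add: e_def algebra_simps)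
  qed
  have "(\<lambda>n. 3 * e n) \<longlonglongrightarrow> 3 * (norm (\<Omega>0 - \<Omega>0) + norm (\<alpha>0 - \<alpha>0) + norm (\<Phi>0 - \<Phi>0))"
    unfolding e_def by (intro tendsto_intros lims \<Phi>lim)
  then have "(\<lambda>n. 3 * e n) \<longlonglongrightarrow> 0" by simp
  then have "(\<lambda>n. U (x n) - U x0) \<longlonglongrightarrow> 0"
    by (rule Lim_null_comparison[OF always_eventually, rotated]) (intro allI bd)
  then show "(U \<circ> x) \<longlonglongrightarrow> U x0" by (simp add: LIM_zero_iff o_def)
qed

section \<open>Automorphisms from unitaries of the unitization\<close>

text \<open>The algebra is an ideal in its unitization, so conjugation by U maps it onto itself
  although U may lie outside.\<close>

lemma ex_conjugation_automorphism:
  fixes U :: "'b::c_star_algebra unitization"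
  assumes U: "star U * U = 1" "U * star U = 1"
  obtains \<alpha> :: "'b \<Rightarrow>\<^sub>L 'b" where "\<alpha> \<in> star_isos" "\<And>b. inv (blinfun_apply \<alpha>) b = ipart (star U * emb b * U)"
proof -
  define f where "f b = ipart (U * emb b * star U)" for b
  define g where "g b = ipart (star U * emb b * U)" for b
  have embf: "emb (f b) = U * emb b * star U" and embg: "emb (g b) = star U * emb b * U" for b
    unfolding f_def g_def by (intro emb_ipart; simp)+
  have emb_inj: "a = b" if "emb a = emb b" for a b :: 'b using that by (metis emb_sel(1))
  have fg: "f (g b) = b" for b
    by (rule emb_inj) (simp add: embf embg, metis U(2) mult.assoc mult.right_neutral mult_1)
  have gf: "g (f b) = b" for b
    by (rule emb_inj) (simp add: embf embg, metis U(1) mult.assoc mult.right_neutral mult_1)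
  have cl: "clinear f"
    unfolding clinear_def
    by (auto intro!: emb_inj simp: embf emb_simps algebra_simps mult_scaleC_left mult_scaleC_right
        simp del: unitization_sel unitization_mult_sel)
  have nf: "norm (f b) \<le> norm b * (norm U * norm (star U))" for b
  proof -
    have "norm (f b) = norm (U * emb b * star U)" by (metis embf norm_emb)
    also have "\<dots> \<le> norm U * norm (emb b) * norm (star U)"
      by (rule order_trans[OF norm_mult_ineq mult_right_mono[OF norm_mult_ineq]]) simp
    finally show ?thesis by (simp add: mult_ac)
  qed
  have "bounded_linear f"
    by (rule bounded_linear_intro[OF _ _ nf]) (simp_all add: clinear_simps[OF cl])
  then have app: "blinfun_apply (Blinfun f) = f" by (rule bounded_linear_Blinfun_apply)
  have "bij f" by (rule bij_betw_byWitness[of _ g]) (auto simp: fg gf)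
  moreover have "f (x * y) = f x * f y" for x y
  proof (rule emb_inj)
    have "emb (f x) * emb (f y) = U * emb x * (star U * U) * emb y * star U" by (simp only: embf mult.assoc)
    then show "emb (f (x * y)) = emb (f x * f y)" by (simp add: embf emb_simps U mult.assoc)
  qed
  moreover have "f (star x) = star (f x)" for x
    by (rule emb_inj) (simp add: embf emb_star star_mult star_star mult.assoc)
  ultimately have "Blinfun f \<in> star_isos" by (simp add: star_isos_def app cl)
  moreover have "inv (blinfun_apply (Blinfun f)) b = g b" for b
    unfolding app using \<open>bij f\<close> by (metis bij_inv_eq_iff fg)
  ultimately show thesis using that[of "Blinfun f"] by (simp add: g_def)
qed

lemma ex_near_automorphism:
  fixes \<pi> :: "'b::c_star_algebra \<Rightarrow> ('h::complex_hilbert_space \<Rightarrow>\<^sub>L 'h)"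
  assumes irr: "nonzero_irreducible_rep \<pi>" and n: "norm \<Omega> = 1" "norm \<Psi> = 1"
  shows "\<exists>\<alpha>\<in>star_isos. (\<alpha>, \<Omega>, \<Psi>) \<in> near_triples \<pi> \<pi>"
proof -
  have \<pi>: "representation \<pi>" using irr by (rule irreducible_representation)
  note linB = clinear_simps[OF representation_vec_clinear[OF \<pi>]]
  \<comment> \<open>Otherwise, on splitting B into self-adjoint parts, \<Psi> would be orthogonal to
    the whole orbit of \<Omega>, which is dense.\<close>
  have "\<exists>a. star a = a \<and> cinner \<Psi> (\<pi> a \<Omega>) \<noteq> 0"
  proof (rule ccontr)
    assume "\<not> ?thesis"
    then have 0: "cinner \<Psi> (\<pi> a \<Omega>) = 0" if "star a = a" for a using that by blast
    have "cinner \<Psi> (\<pi> B \<Omega>) = 0" for B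
    proof -
      define R where "R = (1/2) *\<^sub>R (B + star B)"
      define I where "I = (\<i>/2) *\<^sub>C (star B - B)"
      have "star R = R" by (simp add: R_def star_scaleR star_add star_star add.commute)
      moreover have "star I = I" by (simp add: I_def star_scaleC star_diff star_star) (simp add: scaleC_diff_right)
      moreover have "B = R + \<i> *\<^sub>C I"
      proof -
        have "\<i> *\<^sub>C I = (1/2) *\<^sub>R (B - star B)" by (simp add: I_def scaleC_scaleC scaleR_scaleC scaleC_diff_right)
        then have "R + \<i> *\<^sub>C I = (1/2) *\<^sub>R (B + B)" by (simp add: R_def flip: scaleR_add_right)
        then show ?thesis by (simp flip: scaleR_2)
      qed
      ultimately show ?thesis using 0[of R] 0[of I] by (simp add: linB cinner_simps)
    qed
    moreover have "\<Omega> \<noteq> 0" using n by auto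
    moreover have "continuous_on UNIV (\<lambda>x. cinner \<Psi> x)"
      by (intro cinner.continuous_on continuous_intros)
    ultimately have "cinner \<Psi> x = 0" for x
      using dense_range_eqI[OF irreducible_dense[OF irr], of \<Omega> "cinner \<Psi>" "\<lambda>_. 0" x] by simp
    from this[of \<Psi>] show False using n by (simp add: cinner_self)
  qed
  then obtain a where a: "star a = a" "cinner \<Psi> (\<pi> a \<Omega>) \<noteq> 0" by blast
  show ?thesis
  proof (cases "cinner \<Psi> \<Omega> = 0")
    case False
    \<comment> \<open>Vectors that are not orthogonal already have states at distance below 2, so
      the identity will do.\<close>
    have id: "blinfun_apply (id_blinfun :: 'b \<Rightarrow>\<^sub>L 'b) = (\<lambda>x. x)" by auto
    have "id_blinfun \<in> (star_isos :: ('b \<Rightarrow>\<^sub>L 'b) set)"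
      by (simp add: star_isos_def id clinear_def) (simp add: bij_def inj_def surj_def)
    moreover have "inv (\<lambda>x::'b. x) = (\<lambda>x. x)" using inv_id by (simp add: id_def)
    then have "transport \<pi> id_blinfun = \<pi>" by (simp add: id transport_def)
    ultimately show ?thesis
      using vector_states_near[OF \<pi> n(2,1) False] n
      by (intro bexI[of _ id_blinfun]) (auto simp: near_triples_iff[OF irr irr])
  next
    case True
    define k where "k = cmod (cinner \<Psi> (\<pi> a \<Omega>))"
    have k: "k > 0" using a by (simp add: k_def)
    have ka: "k \<le> norm a"
      using norm_cinner_le[of \<Psi> "\<pi> a \<Omega>"] representation_norm_le[OF \<pi>, of a \<Omega>] by (simp add: k_def n)
    then have na: "norm a > 0" using k by linarith
    \<comment> \<open>As \<Psi> and \<Omega> are orthogonal, <\<Psi>, U \<Omega>> is i t <\<Psi>,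
      \<pi>(a) \<Omega>> minus <\<Psi>, \<pi>(Y) \<Omega>> for the U below. The first term has
      modulus t k, the second at most |Y| \<le> t^2 |a|^2, and this t makes that bound t k /
      2.\<close>
    define t where "t = k / (2 * (norm a)\<^sup>2)"
    have t: "t > 0" using k na by (simp add: t_def)
    define c where "c = t *\<^sub>R a"
    have nc: "norm c \<le> 1"
      using t na k ka by (simp add: c_def) (simp add: t_def power2_eq_square divide_le_eq)
    have sc: "star c = c" by (simp add: c_def star_scaleR a)
    have "norm (c * c) \<le> 1" using nc by (simp add: norm_sa_square[OF sc] power_le_one)
    moreover have "star (c * c) = c * c" by (simp add: star_mult sc)
    ultimately obtain Y where Y: "norm Y \<le> norm (c * c)" "2 *\<^sub>R Y = c * c + Y * Y" "star Y = Y"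
      "\<And>b. c * c * b = b * (c * c) \<Longrightarrow> Y * b = b * Y"
      by (rule sqrt_in_c_star_algebra) blast
    have Yc: "Y * c = c * Y" by (rule Y(4)) (simp add: mult.assoc)
    \<comment> \<open>1 - Y is the square root of 1 - c^2 and commutes with c, so U is
      unitary.\<close>
    define U where "U = 1 - emb Y + \<i> *\<^sub>C emb c"
    have sU: "star U = 1 - emb Y - \<i> *\<^sub>C emb c"
      by (simp add: U_def star_add star_diff star_scaleC Y(3) sc flip: emb_star)
    have comm: "emb c * emb Y = emb Y * emb c" by (simp add: Yc flip: emb_simps)
    have sq: "emb Y + emb Y = emb c * emb c + emb Y * emb Y"
      using Y(2) by (simp add: scaleR_2 flip: emb_simps)
    have UU: "star U * U = 1" "U * star U = 1"
      unfolding sU unfolding U_def using sq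
      by (simp_all add: algebra_simps mult_scaleC_left mult_scaleC_right scaleC_scaleC scaleC_one
          scaleC_add_right scaleC_diff_right comm)
    obtain \<alpha> :: "'b \<Rightarrow>\<^sub>L 'b" where \<alpha>: "\<alpha> \<in> star_isos" "\<And>b. inv (blinfun_apply \<alpha>) b = ipart (star U * emb b * U)"
      using ex_conjugation_automorphism[OF UU] by blast
    define \<Theta> where "\<Theta> = ext_rep \<pi> U \<Omega>"
    have "cinner \<Theta> \<Theta> = cinner \<Omega> \<Omega>"
      unfolding \<Theta>_def by (simp add: ext_rep_simps(2)[OF \<pi>] UU ext_rep_simps(5)[OF \<pi>] flip: ext_rep_simps(1)[OF \<pi>])
    then have "(norm \<Theta>)\<^sup>2 = (norm \<Omega>)\<^sup>2" by (simp only: norm_sq_cinner)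
    then have "norm \<Theta> = norm \<Omega>" by simp
    then have n\<Theta>: "norm \<Theta> = 1" by (simp only: n)
    have "vector_state (transport \<pi> \<alpha>) \<Omega> = vector_state \<pi> \<Theta>"
    proof (rule blinfun_eqI)
      fix C
      have "emb (inv (blinfun_apply \<alpha>) C) = star U * emb C * U" unfolding \<alpha>(2) by (rule emb_ipart) simp
      then have "\<pi> (inv (blinfun_apply \<alpha>) C) \<Omega> = ext_rep \<pi> (star U * emb C * U) \<Omega>"
        by (metis ext_rep_simps(4)[OF \<pi>])
      then have "cinner \<Omega> (\<pi> (inv (blinfun_apply \<alpha>) C) \<Omega>) = cinner \<Theta> (\<pi> C \<Theta>)"
        by (simp add: \<Theta>_def ext_rep_simps(1,2,4)[OF \<pi>] mult.assoc)
      then show "vector_state (transport \<pi> \<alpha>) \<Omega> C = vector_state \<pi> \<Theta> C"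
        by (simp add: vector_state_apply[OF \<pi>]
            vector_state_apply[OF irreducible_representation[OF irreducible_transport[OF irr \<alpha>(1)]]])
          (simp add: transport_def)
    qed
    moreover have "cinner \<Psi> \<Theta> \<noteq> 0"
    proof
      assume "cinner \<Psi> \<Theta> = 0"
      then have eq: "cinner \<Psi> (\<pi> Y \<Omega>) = \<i> * of_real t * cinner \<Psi> (\<pi> a \<Omega>)"
        using True by (simp add: \<Theta>_def U_def ext_rep_def linB cinner_simps scaleC_one c_def
            cinner.scaleR_right scaleR_conv_of_real mult.assoc)
      then have "cmod (cinner \<Psi> (\<pi> Y \<Omega>)) = t * k"
        using t by (simp add: norm_mult k_def)
      moreover have "cmod (cinner \<Psi> (\<pi> Y \<Omega>)) \<le> norm Y"
        using norm_cinner_le[of \<Psi> "\<pi> Y \<Omega>"] representation_norm_le[OF \<pi>, of Y \<Omega>] by (simp add: n)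
      moreover have "norm Y \<le> t\<^sup>2 * (norm a)\<^sup>2"
        using Y(1) unfolding norm_sa_square[OF sc] by (simp add: c_def power_mult_distrib)
      moreover have "t\<^sup>2 * (norm a)\<^sup>2 = t * k / 2" using na by (simp add: t_def power2_eq_square)
      moreover have "t * k > 0" using t k by simp
      ultimately show False by linarith
    qed
    ultimately show ?thesis
      using vector_states_near[OF \<pi> n(2) n\<Theta>] \<alpha>(1) n by (auto simp: near_triples_iff[OF irr irr] intro!: bexI[of _ \<alpha>])
  qed
qed

theorem proposition4p3:
  fixes \<pi> :: "'b::c_star_algebra \<Rightarrow> ('h::complex_hilbert_space \<Rightarrow>\<^sub>L 'h)"
    and \<rho> :: "'c::c_star_algebra \<Rightarrow> ('k::complex_hilbert_space \<Rightarrow>\<^sub>L 'k)"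
  assumes "nonzero_irreducible_rep \<pi>" and "nonzero_irreducible_rep \<rho>"
  shows "(\<forall>\<Omega>\<in>sphere 0 1. \<forall>\<Psi>\<in>sphere 0 1. \<exists>\<alpha>\<in>star_isos. (\<alpha>, \<Omega>, \<Psi>) \<in> near_triples \<pi> \<pi>) \<and>
    openin (top_of_set (star_isos \<times> sphere 0 1 \<times> sphere 0 1)) (near_triples \<pi> \<rho>) \<and>
    (lift_map \<pi> \<rho> \<in> near_triples \<pi> \<rho> \<rightarrow> sphere 0 1 \<and>
     continuous_on (near_triples \<pi> \<rho>) (lift_map \<pi> \<rho>)) \<and>
    ((\<exists>!U. U \<in> near_triples \<pi> \<rho> \<rightarrow>\<^sub>E unitaries \<and> intertwines \<pi> \<rho> U) \<and>
     (\<forall>U. U \<in> near_triples \<pi> \<rho> \<rightarrow> unitaries \<and> intertwines \<pi> \<rho> U \<longrightarrow>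
          continuous_on (near_triples \<pi> \<rho>) U))"
proof -
  let ?O = "near_triples \<pi> \<rho>"
  have "lift_map \<pi> \<rho> \<in> ?O \<rightarrow> sphere 0 1"
    using lift_map(1)[OF assms] by auto
  moreover have "\<exists>!U. U \<in> ?O \<rightarrow>\<^sub>E unitaries \<and> intertwines \<pi> \<rho> U"
  proof (rule ex_ex1I)
    have "\<forall>x\<in>?O. \<exists>V. V \<in> unitaries \<and>
      blinfun_apply V \<circ> orbit_map \<pi> (fst (snd x)) = orbit_map \<rho> (lift_map \<pi> \<rho> x) \<circ> blinfun_apply (fst x)"
      using ex_lift_unitary[OF assms] by fastforce
    then obtain U where U: "\<forall>x\<in>?O. U x \<in> unitaries \<and>
      blinfun_apply (U x) \<circ> orbit_map \<pi> (fst (snd x)) = orbit_map \<rho> (lift_map \<pi> \<rho> x) \<circ> blinfun_apply (fst x)"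
      by (rule bchoice[THEN exE])
    \<comment> \<open>Restricting fixes the values outside the domain, about which the equation says
      nothing; uniqueness is among such functions.\<close>
    then have "restrict U ?O \<in> ?O \<rightarrow>\<^sub>E unitaries \<and> intertwines \<pi> \<rho> (restrict U ?O)"
      by (fastforce simp: intertwines_def)
    then show "\<exists>U. U \<in> ?O \<rightarrow>\<^sub>E unitaries \<and> intertwines \<pi> \<rho> U" by blast
  next
    fix U U' assume U: "U \<in> ?O \<rightarrow>\<^sub>E unitaries \<and> intertwines \<pi> \<rho> U" and U': "U' \<in> ?O \<rightarrow>\<^sub>E unitaries \<and> intertwines \<pi> \<rho> U'"
    show "U = U'"
    proof (rule PiE_ext)
      show "U x = U' x" if "x \<in> ?O" for x
      proof -
        obtain \<alpha> \<Omega> \<Psi> where x: "x = (\<alpha>, \<Omega>, \<Psi>)" by (cases x)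
        have "\<Omega> \<noteq> 0" using that by (auto simp: x near_triples_iff[OF assms])
        from irreducible_dense[OF assms(1) this] show ?thesis
        proof (intro blinfun_eqI, rule dense_range_eqI)
          show "U x (\<pi> B \<Omega>) = U' x (\<pi> B \<Omega>)" for B
            using intertwinesD[of \<pi> \<rho> U] intertwinesD[of \<pi> \<rho> U'] U U' that by (simp add: x)
        qed (intro continuous_intros)+
      qed
    qed (use U U' in auto)
  qed
  ultimately show ?thesis
    using ex_near_automorphism[OF assms(1)] openin_near_triples[OF assms] continuous_on_lift_map[OF assms]
      continuous_on_intertwiner[OF assms] by simp
qed

end
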